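(* Let $(W,S)$ be a Coxeter system (with $S$ finite), and for $s,t\in S$ let $m(s,t)\in\mathbb{N}\cup\{\infty\}$ denote the order of $st$ in $W$. Suppose that (1) for all $s,t\in S$ with $s\neq t$ such that $m(s,t)$ is odd, $\{s,t\}$ is a maximal spherical subset of $S$; (2) there does not exist a three-element subset $\{s,t,u\}\subset S$ such that $m(s,t)$ and $m(t,u)$ are both odd; and (3) for all $s,t\in S$ with $s\neq t$ such that $m(s,t)$ is odd, the number of maximal spherical subsets $T$ of $S$ with $T\cap\{s,t\}\neq\emptyset$ is at most two. Then $(W,S)$ is reflection rigid.
   Context: A Coxeter system is a pair $(W,S)$ where $W$ is a group with presentation $\langle S \mid (st)^{m(s,t)}=1 \text{ for } s,t\in S\rangle$, with $S$ a finite set and $m:S\times S\to\mathbb{N}\cup\{\infty\}$ satisfying $m(s,t)=m(t,s)$, $m(s,s)=1$, and $m(s,t)\ge 2$ for $s\ne t$ (no relation is imposed when $m(s,t)=\infty$). Then $m(s,t)$ is the order of $st$ in $W$. "Odd" means a finite odd integer; $\infty$ is not odd. A generating set $S'$ of $W$ is a Coxeter generating set for $W$ if $(W,S')$ is a Coxeter system. The reflections of $(W,S)$ are the conjugates in $W$ of elements of $S$. For $T\subset S$, $W_T$ denotes the subgroup of $W$ generated by $T$ ($W_\emptyset$ is trivial). A subset $T\subset S$ is spherical if $W_T$ is finite; a maximal spherical subset is a spherical subset that is maximal with respect to inclusion among spherical subsets of $S$. Two Coxeter systems $(W,S)$ and $(W',S')$ are isomorphic if there is a bijection $\psi:S\to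 S'$ with $m(s,t)=m'(\psi(s),\psi(t))$ for all $s,t\in S$, where $m(s,t)$ is the order of $st$ in $W$ and $m'(s',t')$ is the order of $s't'$ in $W'$. A Coxeter system $(W,S)$ is reflection rigid if for every Coxeter generating set $S'$ for $W$ such that the set of reflections of $(W,S)$ equals the set of reflections of $(W,S')$, the Coxeter systems $(W,S)$ and $(W,S')$ are isomorphic. *)

theory Defs
  imports "HOL-Algebra.Generated_Groups" "HOL-Algebra.Multiplicative_Group" "HOL-Library.Extended_Nat"
begin

section \<open>Group presentations\<close>

text \<open>A word over X is a list of signed letters: (x, True) stands for the generator x and
  (x, False) for its formal inverse.\<close>

type_synonym 'a word = "('a \<times> bool) list"

definition words_over :: "'a set \<Rightarrow> 'a word set" where
  "words_over X = lists (X \<times> UNIV)"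

fun word_val :: "('a, 'b) monoid_scheme \<Rightarrow> 'a word \<Rightarrow> 'a" where
  "word_val G [] = \<one>\<^bsub>G\<^esub>"
| "word_val G ((x, e) # w) = (if e then x else inv\<^bsub>G\<^esub> x) \<otimes>\<^bsub>G\<^esub> word_val G w"

text \<open>The congruence on words over X generated by free cancellation and by deleting or inserting
  words of R. Its classes are the elements of the quotient of the free group on X by the normal
  closure of R.\<close>

inductive word_cong :: "'a set \<Rightarrow> 'a word set \<Rightarrow> 'a word \<Rightarrow> 'a word \<Rightarrow> bool" for X R where
  word_refl: "w \<in> words_over X \<Longrightarrow> word_cong X R w w"
| word_sym: "word_cong X R v w \<Longrightarrow> word_cong X R w v"
| word_trans: "word_cong X R u v \<Longrightarrow> word_cong X R v w \<Longrightarrow> word_cong X R u w"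
| word_cancel: "u \<in> words_over X \<Longrightarrow> v \<in> words_over X \<Longrightarrow> x \<in> X \<Longrightarrow>
    word_cong X R (u @ [(x, e), (x, \<not> e)] @ v) (u @ v)"
| word_relator: "u \<in> words_over X \<Longrightarrow> v \<in> words_over X \<Longrightarrow> r \<in> R \<Longrightarrow>
    word_cong X R (u @ r @ v) (u @ v)"

text \<open>The group G has presentation \<open>\<langle>X | R\<rangle>\<close>, with X a set of elements of G:
  the canonical homomorphism from the free group on X to G is onto, and its kernel is the normal
  closure of R.\<close>

definition has_presentation ::
    "('a, 'b) monoid_scheme \<Rightarrow> 'a set \<Rightarrow> 'a word set \<Rightarrow> bool" where
  "has_presentation G X R \<longleftrightarrow>
     group G \<and> X \<subseteq> carrier G \<and> R \<subseteq> words_over X \<and>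
     generate G X = carrier G \<and>
     (\<forall>w \<in> words_over X. word_val G w = \<one>\<^bsub>G\<^esub> \<longleftrightarrow> word_cong X R w [])"


section \<open>Coxeter systems\<close>

definition coxeter_matrix :: "'a set \<Rightarrow> ('a \<Rightarrow> 'a \<Rightarrow> enat) \<Rightarrow> bool" where
  "coxeter_matrix S m \<longleftrightarrow>
     (\<forall>s\<in>S. \<forall>t\<in>S. m s t = m t s) \<and>
     (\<forall>s\<in>S. m s s = 1) \<and>
     (\<forall>s\<in>S. \<forall>t\<in>S. s \<noteq> t \<longrightarrow> m s t \<ge> 2)"

text \<open>The words \<open>(st)\<^sup>k\<close> with \<open>k = m(s,t)\<close> finite.\<close>

definition coxeter_relators :: "'a set \<Rightarrow> ('a \<Rightarrow> 'a \<Rightarrow> enat) \<Rightarrow> 'a word set" where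
  "coxeter_relators S m =
     {concat (replicate k [(s, True), (t, True)]) | k s t. s \<in> S \<and> t \<in> S \<and> m s t = enat k}"

definition coxeter_system :: "('a, 'b) monoid_scheme \<Rightarrow> 'a set \<Rightarrow> bool" where
  "coxeter_system W S \<longleftrightarrow>
     finite S \<and> (\<exists>m. coxeter_matrix S m \<and> has_presentation W S (coxeter_relators S m))"

text \<open>The library function \<open>group.ord\<close> returns 0 on elements of infinite order.\<close>

definition elt_order :: "('a, 'b) monoid_scheme \<Rightarrow> 'a \<Rightarrow> enat" where
  "elt_order G g = (if group.ord G g = 0 then \<infinity> else enat (group.ord G g))"

definition cox_m :: "('a, 'b) monoid_scheme \<Rightarrow> 'a \<Rightarrow> 'a \<Rightarrow> enat" where
  "cox_m W s t = elt_order W (s \<otimes>\<^bsub>W\<^esub> t)"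

definition odd_enat :: "enat \<Rightarrow> bool" where
  "odd_enat n \<longleftrightarrow> (\<exists>k. n = enat k \<and> odd k)"

definition reflections :: "('a, 'b) monoid_scheme \<Rightarrow> 'a set \<Rightarrow> 'a set" where
  "reflections W S =
     {g \<otimes>\<^bsub>W\<^esub> s \<otimes>\<^bsub>W\<^esub> inv\<^bsub>W\<^esub> g | g s. g \<in> carrier W \<and> s \<in> S}"

definition spherical :: "('a, 'b) monoid_scheme \<Rightarrow> 'a set \<Rightarrow> 'a set \<Rightarrow> bool" where
  "spherical W S T \<longleftrightarrow> T \<subseteq> S \<and> finite (generate W T)"

definition maximal_spherical :: "('a, 'b) monoid_scheme \<Rightarrow> 'a set \<Rightarrow> 'a set \<Rightarrow> bool" where
  "maximal_spherical W S T \<longleftrightarrow>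
     spherical W S T \<and> (\<forall>U. spherical W S U \<and> T \<subseteq> U \<longrightarrow> U = T)"

definition coxeter_isomorphic ::
    "('a, 'b) monoid_scheme \<Rightarrow> 'a set \<Rightarrow> ('c, 'd) monoid_scheme \<Rightarrow> 'c set \<Rightarrow> bool" where
  "coxeter_isomorphic W S W' S' \<longleftrightarrow>
     (\<exists>\<psi>. bij_betw \<psi> S S' \<and> (\<forall>s\<in>S. \<forall>t\<in>S. cox_m W s t = cox_m W' (\<psi> s) (\<psi> t)))"

definition reflection_rigid :: "('a, 'b) monoid_scheme \<Rightarrow> 'a set \<Rightarrow> bool" where
  "reflection_rigid W S \<longleftrightarrow>
     (\<forall>S'. coxeter_system W S' \<and> reflections W S = reflections W S' \<longrightarrow>
        coxeter_isomorphic W S W S')"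

end

(*
A reflection of W lying in a finite subgroup lies, by Tits, in a conjugate of a finite parabolic
subgroup of either system, so finite edges between distinct conjugacy classes of reflections can be
carried from one system to the other; the orders divide each other because the two retractions onto
the same classes have the same kernel.  The only freedom left is, for an odd pair {s, t}, which of
the two generators of the other system in this class carries the finite edges.  The hypotheses make
t a leaf (its only finite edge goes to s), and then by Deodhar's description of the elements mapping
simple roots to simple roots the centralizer of s lies in the finite parabolic subgroup W_T, T being
s together with its other finite neighbours.  Hence each reflection in the class of s lies in
exactly one conjugate of W_T, all reflections of other classes that have finite order product with
it lie in that conjugate, and distinct conjugates by elements of the dihedral group of the pair meet
trivially.  This forces all finite edges leaving the class in the other system to start at the same
generator.
*)

theory Submission
  imports Defs Complex_Main
begin

section \<open>The universal property of a presentation\<close>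

text \<open>The hypotheses speak about S alone, and about S' nothing is known except that it has the
  same reflections. Facts about S' must therefore be pulled back along conjugacy of generators,
  finite subgroups and homomorphisms. Besides the position of finite edges, two of them are
  essential. A class of reflections has at most two generators in S', because three simple roots do
  not fit into the plane spanned by two. Two generators of one class have a product of the same odd
  order in both systems. The leaf comes from counting: {s, t} is itself one of at most two maximal
  spherical subsets meeting {s, t}. If both s and t had a further finite neighbour, the one
  remaining subset would contain s and t together with these neighbours, against the maximality of
  {s, t}. The same count puts s and its remaining finite neighbours into one spherical subset, which
  makes W_T finite.\<close>

fun word_eval :: "('c, 'd) monoid_scheme \<Rightarrow> ('a \<Rightarrow> 'c) \<Rightarrow> 'a word \<Rightarrow> 'c" where
  "word_eval G f [] = \<one>\<^bsub>G\<^esub>"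
| "word_eval G f ((x, e) # w) = (if e then f x else inv\<^bsub>G\<^esub> f x) \<otimes>\<^bsub>G\<^esub> word_eval G f w"

lemma word_val_eq_word_eval: "word_val G w = word_eval G (\<lambda>x. x) w"
  by (induction w) auto

context group
begin

lemma word_eval_closed:
  assumes "f \<in> X \<rightarrow> carrier G" "w \<in> words_over X"
  shows "word_eval G f w \<in> carrier G"
  using assms(2)
proof (induction w)
  case (Cons a w)
  then show ?case using assms(1) by (cases a) (auto simp: words_over_def)
qed (auto simp: words_over_def)

lemma word_eval_append:
  assumes "f \<in> X \<rightarrow> carrier G" "v \<in> words_over X" "w \<in> words_over X"
  shows "word_eval G f (v @ w) = word_eval G f v \<otimes> word_eval G f w"
  using assms(2)
proof (induction v)
  case Nil
  then show ?case using word_eval_closed[OF assms(1,3)] by simp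
next
  case (Cons a v)
  obtain x e where a: "a = (x, e)" by force
  with Cons.prems have v: "v \<in> words_over X" and x: "f x \<in> carrier G"
    using assms(1) by (auto simp: words_over_def)
  then show ?case
    using Cons.IH[OF v] a word_eval_closed[OF assms(1) v] word_eval_closed[OF assms(1,3)]
    by (simp add: m_assoc)
qed

lemma word_eval_cong:
  assumes "word_cong X R v w" "f \<in> X \<rightarrow> carrier G" "R \<subseteq> words_over X"
    "\<And>r. r \<in> R \<Longrightarrow> word_eval G f r = \<one>"
  shows "word_eval G f v = word_eval G f w"
  using assms(1)
proof induction
  case (word_cancel u v x e)
  have c: "[(x, e), (x, \<not> e)] \<in> words_over X" "[(x, e), (x, \<not> e)] @ v \<in> words_over X"
    using word_cancel by (auto simp: words_over_def)
  have "word_eval G f [(x, e), (x, \<not> e)] = \<one>"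
    using word_cancel assms(2) by (cases e) (auto simp: Pi_iff)
  then show ?case
    using word_cancel c word_eval_closed[OF assms(2), of v]
    by (simp only: word_eval_append[OF assms(2)] l_one)
next
  case (word_relator u v r)
  have c: "r \<in> words_over X" "r @ v \<in> words_over X"
    using word_relator assms(3) by (auto simp: words_over_def)
  then show ?case
    using word_relator c word_eval_closed[OF assms(2), of v] assms(4)
    by (simp only: word_eval_append[OF assms(2)] l_one)
qed auto

definition word_inverse :: "'x word \<Rightarrow> 'x word" where
  "word_inverse w = rev (map (\<lambda>(x, e). (x, \<not> e)) w)"

lemma word_inverse_words_over: "w \<in> words_over X \<Longrightarrow> word_inverse w \<in> words_over X"
  by (auto simp: words_over_def word_inverse_def)

lemma word_eval_inverse:
  assumes "f \<in> X \<rightarrow> carrier G" "w \<in> words_over X"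
  shows "word_eval G f (word_inverse w) = inv (word_eval G f w)"
  using assms(2)
proof (induction w)
  case Nil
  then show ?case by (simp add: word_inverse_def)
next
  case (Cons a w)
  obtain x e where a: "a = (x, e)" by force
  with Cons.prems have w: "w \<in> words_over X" and x: "x \<in> X"
    by (auto simp: words_over_def)
  have fx: "f x \<in> carrier G" using x assms(1) by auto
  have "word_inverse (a # w) = word_inverse w @ [(x, \<not> e)]"
    by (simp add: word_inverse_def a)
  then show ?case
    using Cons.IH[OF w] w x word_eval_closed[OF assms(1) w] fx
    by (simp add: word_eval_append[OF assms(1) word_inverse_words_over] words_over_def a
        inv_mult_group)
qed

lemma word_val_surj:
  assumes "X \<subseteq> carrier G" "g \<in> generate G X"
  shows "\<exists>w \<in> words_over X. word_val G w = g"
  using assms(2)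
proof induction
  case one
  then show ?case by (intro bexI[of _ "[]"]) (auto simp: words_over_def)
next
  case (incl x)
  then show ?case using assms(1)
    by (intro bexI[of _ "[(x, True)]"]) (auto simp: words_over_def)
next
  case (inv x)
  then show ?case using assms(1)
    by (intro bexI[of _ "[(x, False)]"]) (auto simp: words_over_def)
next
  case (eng g h)
  then obtain v w where "v \<in> words_over X" "w \<in> words_over X"
    "word_val G v = g" "word_val G w = h" by blast
  moreover have "(\<lambda>x. x) \<in> X \<rightarrow> carrier G" using assms(1) by auto
  ultimately show ?case
    by (intro bexI[of _ "v @ w"])
      (auto simp: word_val_eq_word_eval word_eval_append words_over_def)
qed

end

text \<open>Von Dyck's theorem. The image of g is read off from an arbitrarily chosen word for g.
  The choice does not matter: two words of equal value differ by a word in the kernel, and by the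
  presentation such a word reduces to the empty one by cancellations and relators, all of which
  evaluate trivially in G.\<close>

theorem presentation_hom:
  fixes W :: "('a, 'b) monoid_scheme" and G :: "('c, 'd) monoid_scheme"
  assumes pres: "has_presentation W X R" and G: "group G" and f: "f \<in> X \<rightarrow> carrier G"
    and R: "\<And>r. r \<in> R \<Longrightarrow> word_eval G f r = \<one>\<^bsub>G\<^esub>"
  shows "\<exists>h \<in> hom W G. \<forall>x\<in>X. h x = f x"
proof -
  interpret W: group W using pres by (simp add: has_presentation_def)
  interpret G: group G by (rule G)
  have X: "X \<subseteq> carrier W" and RX: "R \<subseteq> words_over X" and gen: "generate W X = carrier W"
    and ker: "\<And>w. w \<in> words_over X \<Longrightarrow> word_val W w = \<one>\<^bsub>W\<^esub> \<Longrightarrow> word_cong X R w []"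
    using pres by (auto simp: has_presentation_def)
  have i: "(\<lambda>x. x) \<in> X \<rightarrow> carrier W" using X by auto
  have eq: "word_eval G f v = word_eval G f w"
    if v: "v \<in> words_over X" and w: "w \<in> words_over X" and e: "word_val W v = word_val W w" for v w
  proof -
    have wi: "W.word_inverse w \<in> words_over X" by (rule W.word_inverse_words_over[OF w])
    have vw: "v @ W.word_inverse w \<in> words_over X" using v wi by (auto simp: words_over_def)
    have "word_val W (v @ W.word_inverse w) = \<one>\<^bsub>W\<^esub>"
      using e W.word_eval_closed[OF i w]
      by (simp add: word_val_eq_word_eval W.word_eval_append[OF i v wi] W.word_eval_inverse[OF i w])
    from G.word_eval_cong[OF ker[OF vw this] f RX R]
    have "word_eval G f (v @ W.word_inverse w) = \<one>\<^bsub>G\<^esub>" by simp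
    moreover have "W.word_inverse w = G.word_inverse w"
      by (simp add: W.word_inverse_def G.word_inverse_def)
    ultimately have "word_eval G f v \<otimes>\<^bsub>G\<^esub> inv\<^bsub>G\<^esub> word_eval G f w = \<one>\<^bsub>G\<^esub>"
      using G.word_eval_append[OF f v wi] G.word_eval_inverse[OF f w] by simp
    then show ?thesis
      using G.word_eval_closed[OF f v] G.word_eval_closed[OF f w]
      by (metis G.inv_closed G.inv_equality G.inv_inv)
  qed
  define h where "h g = word_eval G f (SOME w. w \<in> words_over X \<and> word_val W w = g)" for g
  have h: "h (word_val W w) = word_eval G f w" if w: "w \<in> words_over X" for w
  proof -
    have "\<exists>v. v \<in> words_over X \<and> word_val W v = word_val W w" using w by blast
    from someI_ex[OF this] show ?thesis unfolding h_def using w by (intro eq) auto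
  qed
  have "h \<in> hom W G"
  proof (rule homI)
    fix g assume "g \<in> carrier W"
    then obtain v where v: "v \<in> words_over X" "word_val W v = g"
      using W.word_val_surj[OF X] gen by blast
    then show "h g \<in> carrier G" using h[OF v(1)] G.word_eval_closed[OF f v(1)] by simp
    fix k assume "k \<in> carrier W"
    then obtain w where w: "w \<in> words_over X" "word_val W w = k"
      using W.word_val_surj[OF X] gen by blast
    have vw: "v @ w \<in> words_over X" using v w by (auto simp: words_over_def)
    have "word_val W (v @ w) = g \<otimes>\<^bsub>W\<^esub> k"
      using v w by (simp add: word_val_eq_word_eval W.word_eval_append[OF i])
    then show "h (g \<otimes>\<^bsub>W\<^esub> k) = h g \<otimes>\<^bsub>G\<^esub> h k"
      using h[OF vw] h[OF v(1)] h[OF w(1)] v w by (simp add: G.word_eval_append[OF f])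
  qed
  moreover have "h x = f x" if x: "x \<in> X" for x
  proof -
    have "[(x, True)] \<in> words_over X" using x by (auto simp: words_over_def)
    from h[OF this] show ?thesis using x X f by (auto simp: Pi_iff subset_iff)
  qed
  ultimately show ?thesis by blast
qed

section \<open>Homomorphisms from a Coxeter group\<close>

lemma (in group) word_eval_replicate:
  assumes "f s \<in> carrier G" "f t \<in> carrier G"
  shows "word_eval G f (concat (replicate k [(s, True), (t, True)])) = (f s \<otimes> f t) [^] k"
proof (induction k)
  case (Suc k)
  then have "word_eval G f (concat (replicate (Suc k) [(s, True), (t, True)]))
      = (f s \<otimes> f t) \<otimes> (f s \<otimes> f t) [^] k"
    using assms by (simp add: m_assoc)
  also have "\<dots> = (f s \<otimes> f t) [^] Suc k" using assms nat_pow_Suc2 by simp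
  finally show ?case .
qed simp

locale coxeter = group W for W :: "('a, 'b) monoid_scheme" (structure) +
  fixes S :: "'a set"
  assumes cox: "coxeter_system W S"
begin

lemma finite_S: "finite S" using cox by (simp add: coxeter_system_def)

lemma S_carrier: "S \<subseteq> carrier W"
  using cox by (auto simp: coxeter_system_def has_presentation_def)

lemma S_closed [simp, intro]: "s \<in> S \<Longrightarrow> s \<in> carrier W"
  using S_carrier by auto

lemma generate_S: "generate W S = carrier W"
  using cox by (auto simp: coxeter_system_def has_presentation_def)

text \<open>Inserting a relator shows that a finite matrix entry kills s t, so that the order of s t
  divides the entry; later statements speak of \<open>ord\<close> instead of the matrix. Positivity
  holds because an entry is 1 or at least 2.\<close>

lemma matrix_exponent:
  obtains m where "coxeter_matrix S m" "has_presentation W S (coxeter_relators S m)"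
    "\<And>s t k. s \<in> S \<Longrightarrow> t \<in> S \<Longrightarrow> m s t = enat k \<Longrightarrow> (s \<otimes> t) [^] k = \<one> \<and> k > 0"
proof -
  obtain m where m: "coxeter_matrix S m" and p: "has_presentation W S (coxeter_relators S m)"
    using cox by (auto simp: coxeter_system_def)
  moreover have "(s \<otimes> t) [^] k = \<one> \<and> k > 0" if s: "s \<in> S" and t: "t \<in> S" and k: "m s t = enat k" for s t k
  proof -
    let ?r = "concat (replicate k [(s, True), (t, True)])"
    have r: "?r \<in> coxeter_relators S m" using s t k by (auto simp: coxeter_relators_def)
    have rw: "?r \<in> words_over S" using p r by (auto simp: has_presentation_def)
    have "word_cong S (coxeter_relators S m) ([] @ ?r @ []) ([] @ [])"
      by (rule word_relator) (use r in \<open>auto simp: words_over_def\<close>)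
    then have "word_val W ?r = \<one>" using p rw by (auto simp: has_presentation_def)
    then have 1: "(s \<otimes> t) [^] k = \<one>"
      using word_eval_replicate[of "\<lambda>x. x" s t k] s t by (simp add: word_val_eq_word_eval)
    have "k \<noteq> 0"
    proof
      assume "k = 0"
      then have "m s t = 0" using k by (simp add: enat_0)
      moreover have "m s t = 1 \<or> m s t \<ge> 2"
        using m s t by (cases "s = t") (auto simp: coxeter_matrix_def)
      ultimately show False by auto
    qed
    with 1 show ?thesis by simp
  qed
  ultimately show thesis using that by blast
qed

lemma S_square [simp]: "s \<in> S \<Longrightarrow> s \<otimes> s = \<one>"
proof -
  assume s: "s \<in> S"
  obtain m where "coxeter_matrix S m"
    "\<And>s t k. s \<in> S \<Longrightarrow> t \<in> S \<Longrightarrow> m s t = enat k \<Longrightarrow> (s \<otimes> t) [^] k = \<one> \<and> k > 0"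
    using matrix_exponent by metis
  then have "(s \<otimes> s) [^] (1::nat) = \<one>"
    using s by (metis coxeter_matrix_def one_enat_def)
  then show ?thesis using s by simp
qed

text \<open>A finite entry of the matrix is a nonzero multiple of \<open>ord\<close>, so relations
  with exponent \<open>ord\<close> imply those of the presentation. \<open>ord\<close> is 0 for
  infinite order, where no relation is imposed.\<close>

theorem coxeter_hom:
  fixes G :: "('c, 'd) monoid_scheme"
  assumes G: "group G" and f: "f \<in> S \<rightarrow> carrier G"
    and rel: "\<And>s t. s \<in> S \<Longrightarrow> t \<in> S \<Longrightarrow> ord (s \<otimes> t) \<noteq> 0 \<Longrightarrow>
      (f s \<otimes>\<^bsub>G\<^esub> f t) [^]\<^bsub>G\<^esub> ord (s \<otimes> t) = \<one>\<^bsub>G\<^esub>"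
  obtains h where "h \<in> hom W G" "\<And>s. s \<in> S \<Longrightarrow> h s = f s"
proof -
  interpret G: group G by (rule G)
  obtain m where m: "has_presentation W S (coxeter_relators S m)"
    "\<And>s t k. s \<in> S \<Longrightarrow> t \<in> S \<Longrightarrow> m s t = enat k \<Longrightarrow> (s \<otimes> t) [^] k = \<one> \<and> k > 0"
    using matrix_exponent by metis
  have "\<exists>h \<in> hom W G. \<forall>x\<in>S. h x = f x"
  proof (rule presentation_hom[OF m(1) G f])
    fix r assume "r \<in> coxeter_relators S m"
    then obtain k s t where r: "r = concat (replicate k [(s, True), (t, True)])"
      and st: "s \<in> S" "t \<in> S" and k: "m s t = enat k" by (auto simp: coxeter_relators_def)
    have 1: "(s \<otimes> t) [^] k = \<one>" "k > 0" using m(2)[OF st k] by auto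
    then have d: "ord (s \<otimes> t) dvd k" using st by (simp add: pow_eq_id)
    then obtain j where j: "k = ord (s \<otimes> t) * j" ..
    have fst: "f s \<in> carrier G" "f t \<in> carrier G" using f st by auto
    have "ord (s \<otimes> t) \<noteq> 0" using j 1(2) by auto
    then have "(f s \<otimes>\<^bsub>G\<^esub> f t) [^]\<^bsub>G\<^esub> k = \<one>\<^bsub>G\<^esub>"
      using rel[OF st] fst by (simp add: j G.nat_pow_pow[symmetric])
    then show "word_eval G f r = \<one>\<^bsub>G\<^esub>"
      unfolding r using fst by (simp add: G.word_eval_replicate)
  qed
  then show thesis using that by blast
qed

end

section \<open>Conjugacy and dihedral groups\<close>

definition (in group) conjugate :: "'a \<Rightarrow> 'a \<Rightarrow> bool" where
  "conjugate x y \<longleftrightarrow> (\<exists>g\<in>carrier G. y = g \<otimes> x \<otimes> inv g)"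

context group
begin

lemma conj_mult:
  assumes "g \<in> carrier G" "h \<in> carrier G" "x \<in> carrier G"
  shows "g \<otimes> (h \<otimes> x \<otimes> inv h) \<otimes> inv g = (g \<otimes> h) \<otimes> x \<otimes> inv (g \<otimes> h)"
  using assms by (simp add: m_assoc inv_mult_group)

lemma conj_inv_cancel:
  assumes "g \<in> carrier G" "x \<in> carrier G"
  shows "inv g \<otimes> (g \<otimes> x \<otimes> inv g) \<otimes> g = x" "g \<otimes> (inv g \<otimes> x \<otimes> g) \<otimes> inv g = x"
proof -
  show "inv g \<otimes> (g \<otimes> x \<otimes> inv g) \<otimes> g = x"
    using conj_mult[of "inv g" g x] assms by simp
  show "g \<otimes> (inv g \<otimes> x \<otimes> g) \<otimes> inv g = x"
    using conj_mult[of g "inv g" x] assms by simp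
qed

lemma conj_conj_prod:
  assumes "g \<in> carrier G" "x \<in> carrier G" "y \<in> carrier G"
  shows "(g \<otimes> x \<otimes> inv g) \<otimes> (g \<otimes> y \<otimes> inv g) = g \<otimes> (x \<otimes> y) \<otimes> inv g"
proof -
  have "(g \<otimes> x \<otimes> inv g) \<otimes> (g \<otimes> y \<otimes> inv g) = g \<otimes> x \<otimes> (inv g \<otimes> (g \<otimes> (y \<otimes> inv g)))"
    using assms by (simp add: m_assoc)
  also have "inv g \<otimes> (g \<otimes> (y \<otimes> inv g)) = y \<otimes> inv g"
    using assms by (simp add: m_assoc[symmetric])
  finally show ?thesis using assms by (simp add: m_assoc)
qed

lemma conj_one_iff:
  assumes "g \<in> carrier G" "x \<in> carrier G"
  shows "g \<otimes> x \<otimes> inv g = \<one> \<longleftrightarrow> x = \<one>"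
  using conj_inv_cancel(1)[OF assms] assms by auto

lemma conjugateI: "g \<in> carrier G \<Longrightarrow> conjugate x (g \<otimes> x \<otimes> inv g)"
  by (auto simp: conjugate_def)

lemma conjugate_refl [simp]: "x \<in> carrier G \<Longrightarrow> conjugate x x"
  unfolding conjugate_def by (rule bexI[of _ \<one>]) auto

lemma conjugate_sym: "x \<in> carrier G \<Longrightarrow> conjugate x y \<Longrightarrow> conjugate y x"
  unfolding conjugate_def
proof safe
  fix g assume x: "x \<in> carrier G" and g: "g \<in> carrier G"
  then have "x = inv g \<otimes> (g \<otimes> x \<otimes> inv g) \<otimes> inv (inv g)" using conj_inv_cancel(1) by simp
  then show "\<exists>h\<in>carrier G. x = h \<otimes> (g \<otimes> x \<otimes> inv g) \<otimes> inv h" using g by blast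
qed

lemma conjugate_trans: "x \<in> carrier G \<Longrightarrow> conjugate x y \<Longrightarrow> conjugate y z \<Longrightarrow> conjugate x z"
  unfolding conjugate_def
proof safe
  fix g h assume "x \<in> carrier G" "g \<in> carrier G" "h \<in> carrier G"
  then have "h \<otimes> (g \<otimes> x \<otimes> inv g) \<otimes> inv h = (h \<otimes> g) \<otimes> x \<otimes> inv (h \<otimes> g)" "h \<otimes> g \<in> carrier G"
    using conj_mult by auto
  then show "\<exists>k\<in>carrier G. h \<otimes> (g \<otimes> x \<otimes> inv g) \<otimes> inv h = k \<otimes> x \<otimes> inv k" by blast
qed

lemma conjugate_closed: "x \<in> carrier G \<Longrightarrow> conjugate x y \<Longrightarrow> y \<in> carrier G"
  by (auto simp: conjugate_def)

lemma int_pow_conj: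
  assumes "a \<in> carrier G" "c \<in> carrier G"
  shows "a \<otimes> c [^] (i::int) \<otimes> inv a = (a \<otimes> c \<otimes> inv a) [^] i"
proof -
  have "(\<lambda>x. a \<otimes> x \<otimes> inv a) \<in> hom G G"
    using assms by (intro homI) (auto simp: conj_conj_prod)
  then interpret h: group_hom G G "\<lambda>x. a \<otimes> x \<otimes> inv a"
    by unfold_locales
  show ?thesis using h.hom_int_pow[of c i] assms by simp
qed

lemma ord_conj:
  assumes "g \<in> carrier G" "x \<in> carrier G"
  shows "ord (g \<otimes> x \<otimes> inv g) = ord x"
proof -
  have "(g \<otimes> x \<otimes> inv g) [^] (n::nat) = \<one> \<longleftrightarrow> x [^] n = \<one>" for n
    using int_pow_conj[OF assms, of "int n"] conj_one_iff[of g "x [^] n"] assms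
    by (simp add: int_pow_int)
  then have "ord (g \<otimes> x \<otimes> inv g) dvd n \<longleftrightarrow> ord x dvd n" for n
    using assms pow_eq_id[of "g \<otimes> x \<otimes> inv g" n] pow_eq_id[of x n] by simp
  then show ?thesis by (meson dvd_antisym dvd_refl)
qed

lemma ord_mult_comm:
  assumes "x \<in> carrier G" "y \<in> carrier G"
  shows "ord (x \<otimes> y) = ord (y \<otimes> x)"
proof -
  have "inv x \<otimes> (x \<otimes> y) \<otimes> inv (inv x) = y \<otimes> x"
    using assms by (simp add: m_assoc[symmetric])
  then show ?thesis using ord_conj[of "inv x" "x \<otimes> y"] assms by simp
qed

end

section \<open>Dihedral groups: rotations c^i and reflections c^i a, indexed by integers\<close>

locale involution_pair = group +
  fixes a b
  assumes a_closed [simp]: "a \<in> carrier G" and b_closed [simp]: "b \<in> carrier G"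
    and a_square [simp]: "a \<otimes> a = \<one>" and b_square [simp]: "b \<otimes> b = \<one>"
begin

lemma inv_a [simp]: "inv a = a" and inv_b [simp]: "inv b = b"
  using inv_equality by auto

abbreviation "c \<equiv> a \<otimes> b"

lemma a_pow: "a \<otimes> c [^] (i::int) = c [^] (- i) \<otimes> a"
proof -
  have "a \<otimes> c \<otimes> inv a = inv c"
    by (simp add: inv_mult_group m_assoc[symmetric])
  then have "a \<otimes> c [^] i \<otimes> a = c [^] (- i)"
    using int_pow_conj[of a c i] by (simp add: int_pow_neg int_pow_inv)
  then have "a \<otimes> c [^] i \<otimes> a \<otimes> a = c [^] (- i) \<otimes> a" by simp
  then show ?thesis by (simp add: m_assoc)
qed

lemma b_eq: "b = c [^] (-1::int) \<otimes> a"
  by (simp add: int_pow_neg int_pow_1 inv_mult_group m_assoc)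

lemma refl_mult: "(c [^] (i::int) \<otimes> a) \<otimes> (c [^] (j::int) \<otimes> a) = c [^] (i - j)"
proof -
  have "(c [^] i \<otimes> a) \<otimes> (c [^] j \<otimes> a) = c [^] i \<otimes> (a \<otimes> c [^] j) \<otimes> a"
    by (simp add: m_assoc)
  also have "\<dots> = c [^] i \<otimes> c [^] (- j)" unfolding a_pow by (simp add: m_assoc)
  also have "\<dots> = c [^] (i - j)" using int_pow_mult[of c i "- j"] by simp
  finally show ?thesis .
qed

lemma rot_mult: "c [^] (i::int) \<otimes> (c [^] (j::int) \<otimes> a) = c [^] (i + j) \<otimes> a"
  by (simp add: int_pow_mult m_assoc)

lemma refl_rot_mult: "(c [^] (i::int) \<otimes> a) \<otimes> c [^] (j::int) = c [^] (i - j) \<otimes> a"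
proof -
  have "(c [^] i \<otimes> a) \<otimes> c [^] j = c [^] i \<otimes> (a \<otimes> c [^] j)" by (simp add: m_assoc)
  then show ?thesis unfolding a_pow using rot_mult[of i "- j"] by simp
qed

lemma generate_cases:
  assumes "x \<in> generate G {a, b}"
  obtains i :: int where "x = c [^] i" | i :: int where "x = c [^] i \<otimes> a"
proof -
  have ia: "a = c [^] (0::int) \<otimes> a" by simp
  have "\<exists>i::int. x = c [^] i \<or> x = c [^] i \<otimes> a"
    using assms
  proof induction
    case one
    have "\<one> = c [^] (0::int)" by simp
    then show ?case by blast
  next
    case (incl h)
    then have "h = a \<or> h = b" by simp
    then show ?case using ia b_eq by blast
  next
    case (inv h)
    then have "inv h = h" by auto
    with inv have "inv h = a \<or> inv h = b" by simp
    then show ?case using ia b_eq by blast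
  next
    case (eng g h)
    then obtain i j :: int where "g = c [^] i \<or> g = c [^] i \<otimes> a" "h = c [^] j \<or> h = c [^] j \<otimes> a"
      by blast
    moreover have "c [^] i \<otimes> c [^] j = c [^] (i + j)" by (simp add: int_pow_mult)
    ultimately have "g \<otimes> h \<in> {c [^] (i + j), c [^] (i + j) \<otimes> a, c [^] (i - j) \<otimes> a, c [^] (i - j)}"
      using refl_mult[of i j] rot_mult[of i j] refl_rot_mult[of i j] by (elim disjE) auto
    then show ?case by blast
  qed
  then show thesis using that by blast
qed

lemma a_in: "a \<in> generate G {a, b}" and b_in: "b \<in> generate G {a, b}"
  by (auto intro: generate.incl)

lemma rot_conj: "c [^] (i::int) \<otimes> a \<otimes> inv (c [^] i) = c [^] (2 * i) \<otimes> a"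
proof -
  have "c [^] i \<otimes> a \<otimes> inv (c [^] i) = (c [^] i \<otimes> a) \<otimes> c [^] (- i)"
    by (simp add: int_pow_neg)
  then show ?thesis by (simp add: refl_rot_mult)
qed

lemma refl_conj: "(c [^] (i::int) \<otimes> a) \<otimes> a \<otimes> inv (c [^] i \<otimes> a) = c [^] (2 * i) \<otimes> a"
proof -
  have "(c [^] i \<otimes> a) \<otimes> a \<otimes> inv (c [^] i \<otimes> a) = c [^] i \<otimes> a \<otimes> inv (c [^] i)"
    by (simp add: inv_mult_group m_assoc)
  then show ?thesis by (simp add: rot_conj)
qed

lemma conj_a_cases:
  assumes "h \<in> generate G {a, b}"
  obtains i :: int where "h = c [^] i \<or> h = c [^] i \<otimes> a" "h \<otimes> a \<otimes> inv h = c [^] (2 * i) \<otimes> a"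
  using assms
proof (cases rule: generate_cases)
  case (1 i)
  then show thesis using that[of i] rot_conj[of i] by blast
next
  case (2 i)
  then show thesis using that[of i] refl_conj[of i] by blast
qed

text \<open>For infinite order \<open>ord c\<close> is 0 and divisibility by 0 is equality, so the
  finite and the infinite dihedral group are treated together.\<close>

lemma rot_eq_iff: "c [^] (i::int) \<otimes> a = c [^] (j::int) \<otimes> a \<longleftrightarrow> int (ord c) dvd i - j"
proof -
  have "c [^] i \<otimes> a = c [^] j \<otimes> a \<longleftrightarrow> c [^] i = c [^] j" by simp
  also have "\<dots> \<longleftrightarrow> c [^] (i - j) = \<one>"
    using inv_equality[of "c [^] i" "inv (c [^] j)"] by (auto simp: int_pow_diff)
  finally show ?thesis by (simp add: int_pow_eq_id)
qed

text \<open>Conjugates of a have even exponents c^(2i) a, while b is c^(-1) a. In the infinite group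
  exponents are determined, so b is excluded by parity and a leaves i = 0.\<close>

lemma infinite_no_conj:
  assumes "ord c = 0" "h \<in> generate G {a, b}" "h \<otimes> a \<otimes> inv h \<in> {a, b}"
  shows "h = \<one> \<or> h = a"
proof -
  obtain i :: int where i: "h = c [^] i \<or> h = c [^] i \<otimes> a" "h \<otimes> a \<otimes> inv h = c [^] (2 * i) \<otimes> a"
    using conj_a_cases[OF assms(2)] by blast
  have "c [^] (2 * i) \<otimes> a = c [^] (0::int) \<otimes> a \<or> c [^] (2 * i) \<otimes> a = c [^] (-1::int) \<otimes> a"
    using assms(3) i(2) b_eq by auto
  then have "2 * i = 0 \<or> 2 * i + 1 = 0" unfolding rot_eq_iff assms(1) by auto
  then have "i = 0" by presburger
  then show ?thesis using i by auto
qed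

text \<open>2 is invertible modulo the odd order, so c^(2i) = 1 already forces c^i = 1.\<close>

lemma odd_centralizer:
  assumes "odd (ord c)" "h \<in> generate G {a, b}" "h \<otimes> a \<otimes> inv h = a"
  shows "h = \<one> \<or> h = a"
proof -
  obtain i :: int where i: "h = c [^] i \<or> h = c [^] i \<otimes> a" "h \<otimes> a \<otimes> inv h = c [^] (2 * i) \<otimes> a"
    using conj_a_cases[OF assms(2)] by blast
  have "c [^] (2 * i) \<otimes> a = c [^] (0::int) \<otimes> a"
    using assms(3) i(2) by auto
  then have "int (ord c) dvd 2 * i" unfolding rot_eq_iff by simp
  moreover have "coprime (int (ord c)) 2" using assms(1) by simp
  ultimately have "int (ord c) dvd i" using coprime_dvd_mult_right_iff by blast
  then have "c [^] i = \<one>" by (simp add: int_pow_eq_id)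
  then show ?thesis using i by auto
qed

lemma odd_refl_conj:
  assumes "odd (ord c)"
  obtains g where "g \<in> generate G {a, b}" "c [^] (i::int) \<otimes> a = g \<otimes> a \<otimes> inv g"
proof -
  obtain n where n: "ord c = 2 * n + 1" using assms by (auto elim: oddE)
  \<comment> \<open>j is half of i modulo the odd order; when i is odd, adding the order first makes
    it even.\<close>
  define j where "j = (if even i then i div 2 else (i + int (ord c)) div 2)"
  have "i - 2 * j = 0 \<or> i - 2 * j = - int (ord c)"
  proof (cases "even i")
    case False
    then have "even (i + int (ord c))" using assms by simp
    then have "2 * j = i + int (ord c)" using False by (simp add: j_def)
    then show ?thesis by simp
  qed (simp add: j_def)
  then have "int (ord c) dvd i - 2 * j" by auto
  then have "c [^] i \<otimes> a = c [^] (2 * j) \<otimes> a" unfolding rot_eq_iff .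
  moreover have "c [^] j \<in> generate G {a, b}"
  proof -
    have "c \<in> generate G {a, b}" using a_in b_in by (rule generate.eng)
    then show ?thesis using generate_is_subgroup[of "{a,b}"] subgroup_int_pow_closed by simp
  qed
  ultimately show thesis using that[of "c [^] j"] rot_conj by simp
qed

lemma odd_conjugate:
  assumes "odd (ord c)"
  obtains g where "g \<in> generate G {a, b}" "b = g \<otimes> a \<otimes> inv g"
  using odd_refl_conj[OF assms, of "-1"] b_eq by metis

lemma finite_generate:
  assumes "ord c \<noteq> 0"
  shows "finite (generate G {a, b})"
proof -
  let ?P = "{c [^] (i::int) |i. True}"
  have "?P \<subseteq> (\<lambda>k::nat. c [^] k) ` {..<ord c}"
  proof safe
    fix i :: int
    have "0 \<le> i mod int (ord c)" "i mod int (ord c) < int (ord c)" using assms by auto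
    moreover have "c [^] i = c [^] (nat (i mod int (ord c)))"
    proof -
      have "int (ord c) dvd i - i mod int (ord c)" by (simp add: dvd_minus_mod)
      then have "c [^] i \<otimes> a = c [^] (i mod int (ord c)) \<otimes> a" unfolding rot_eq_iff .
      then have "c [^] i = c [^] (i mod int (ord c))" by simp
      also have "\<dots> = c [^] int (nat (i mod int (ord c)))" using assms by simp
      finally show ?thesis by (simp add: int_pow_int del: int_nat_eq)
    qed
    ultimately show "c [^] i \<in> (\<lambda>k::nat. c [^] k) ` {..<ord c}"
      by (intro image_eqI[of _ _ "nat (i mod int (ord c))"]) auto
  qed
  then have "finite ?P" by (rule finite_subset) auto
  moreover have "generate G {a, b} \<subseteq> ?P \<union> (\<lambda>x. x \<otimes> a) ` ?P"
    by (rule subsetI, erule generate_cases) auto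
  ultimately show ?thesis by (meson finite_UnI finite_imageI finite_subset)
qed

end

context coxeter
begin

lemma S_inv [simp]: "s \<in> S \<Longrightarrow> inv s = s"
  by (intro inv_equality) auto

lemma S_pair: "s \<in> S \<Longrightarrow> t \<in> S \<Longrightarrow> involution_pair W s t"
  by unfold_locales auto

lemma ord_sym: "s \<in> S \<Longrightarrow> t \<in> S \<Longrightarrow> ord (s \<otimes> t) = ord (t \<otimes> s)"
  by (intro ord_mult_comm) auto

lemma odd_imp_conjugate:
  assumes "s \<in> S" "t \<in> S" "odd (ord (s \<otimes> t))"
  shows "conjugate s t"
proof -
  interpret involution_pair W s t by (rule S_pair[OF assms(1,2)])
  obtain g where "g \<in> generate W {s, t}" "t = g \<otimes> s \<otimes> inv g"
    using odd_conjugate[OF assms(3)] .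
  moreover have "generate W {s, t} \<subseteq> carrier W"
    using assms by (intro generate_incl) auto
  ultimately show ?thesis by (auto simp: conjugate_def)
qed

lemma coxeter_induct [consumes 1, case_names one step]:
  assumes g: "g \<in> carrier W" and one: "P \<one>"
    and step: "\<And>h s. h \<in> carrier W \<Longrightarrow> s \<in> S \<Longrightarrow> P h \<Longrightarrow> P (h \<otimes> s)"
  shows "P g"
proof -
  have *: "P (h \<otimes> x)" if "x \<in> generate W S" "h \<in> carrier W" "P h" for x h
    using that
  proof (induction arbitrary: h)
    case one
    then show ?case by simp
  next
    case (incl x)
    then show ?case using step by blast
  next
    case (inv x)
    then show ?case using step by simp
  next
    case (eng x y)
    have "x \<in> carrier W" "y \<in> carrier W" using eng(1,2) generate_S by auto
    then show ?case using eng by (simp add: m_assoc[symmetric])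
  qed
  show ?thesis using *[of g \<one>] g one generate_S by simp
qed

subsection \<open>Sign characters and retractions\<close>

text \<open>Signs on S extend to W as soon as they agree along odd edges: where the signs differ,
  the exponent of the relation is even and kills the product -1.\<close>

lemma sign_character:
  assumes A: "A \<subseteq> S"
    and odd: "\<And>s t. s \<in> S \<Longrightarrow> t \<in> S \<Longrightarrow> odd (ord (s \<otimes> t)) \<Longrightarrow> s \<in> A \<longleftrightarrow> t \<in> A"
  obtains \<chi> :: "'a \<Rightarrow> int" where
    "\<And>g h. g \<in> carrier W \<Longrightarrow> h \<in> carrier W \<Longrightarrow> \<chi> (g \<otimes> h) = \<chi> g * \<chi> h"
    "\<And>g. g \<in> carrier W \<Longrightarrow> \<chi> g = 1 \<or> \<chi> g = -1"
    "\<And>s. s \<in> S \<Longrightarrow> \<chi> s = (if s \<in> A then -1 else 1)"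
proof -
  define G where "G = \<lparr>carrier = {1, -1::int}, mult = (\<lambda>x y. x * y :: int), one = 1 :: int\<rparr>"
  have G: "group G"
    by (rule groupI) (auto simp: G_def)
  let ?f = "\<lambda>s. if s \<in> A then -1 else (1::int)"
  have pow: "x [^]\<^bsub>G\<^esub> n = x ^ n" for x and n :: nat
  proof (induction n)
    case (Suc n)
    show ?case using Suc by (simp add: nat_pow_def) (simp add: G_def mult.commute)
  qed (simp add: G_def nat_pow_def)
  have f: "?f \<in> S \<rightarrow> carrier G" by (auto simp: G_def)
  have rel: "(?f s \<otimes>\<^bsub>G\<^esub> ?f t) [^]\<^bsub>G\<^esub> ord (s \<otimes> t) = \<one>\<^bsub>G\<^esub>"
    if st: "s \<in> S" "t \<in> S" "ord (s \<otimes> t) \<noteq> 0" for s t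
  proof (cases "s \<in> A \<longleftrightarrow> t \<in> A")
    case True
    then show ?thesis unfolding pow by (auto simp: G_def)
  next
    case False
    then have "even (ord (s \<otimes> t))" using odd st by blast
    then show ?thesis using False unfolding pow by (auto simp: G_def)
  qed
  obtain h where h: "h \<in> hom W G" "\<And>s. s \<in> S \<Longrightarrow> h s = ?f s"
    using coxeter_hom[OF G f rel] by blast
  have "h g \<in> {1, -1}" if "g \<in> carrier W" for g
    using h(1) that by (auto simp: hom_def G_def Pi_iff)
  then show thesis
    using that[of h] h by (auto simp: hom_def G_def)
qed

text \<open>A character does not see conjugation. This is the harder half of the fact that
  generators are conjugate exactly when a path of odd edges joins them.\<close>

lemma conjugate_same_sign:
  assumes A: "A \<subseteq> S"
    and odd: "\<And>s t. s \<in> S \<Longrightarrow> t \<in> S \<Longrightarrow> odd (ord (s \<otimes> t)) \<Longrightarrow> s \<in> A \<longleftrightarrow> t \<in> A"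
    and st: "s \<in> S" "t \<in> S" "conjugate s t" "s \<in> A"
  shows "t \<in> A"
proof -
  obtain \<chi> :: "'a \<Rightarrow> int" where
    \<chi>: "\<And>g h. g \<in> carrier W \<Longrightarrow> h \<in> carrier W \<Longrightarrow> \<chi> (g \<otimes> h) = \<chi> g * \<chi> h"
    "\<And>g. g \<in> carrier W \<Longrightarrow> \<chi> g = 1 \<or> \<chi> g = -1"
    "\<And>s. s \<in> S \<Longrightarrow> \<chi> s = (if s \<in> A then -1 else 1)"
    using sign_character[OF A odd] by blast
  obtain g where g: "g \<in> carrier W" "t = g \<otimes> s \<otimes> inv g" using st by (auto simp: conjugate_def)
  have "t \<otimes> g = g \<otimes> s" using g st by (simp add: m_assoc)
  then have "\<chi> t * \<chi> g = \<chi> g * \<chi> s" using \<chi>(1) g(1) st by (metis S_closed)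
  then have "\<chi> t = \<chi> s" using \<chi>(2)[OF g(1)] by auto
  then show ?thesis using \<chi>(3) st by (auto split: if_splits)
qed

lemma parity_character:
  obtains \<chi> :: "'a \<Rightarrow> int" where
    "\<And>g h. g \<in> carrier W \<Longrightarrow> h \<in> carrier W \<Longrightarrow> \<chi> (g \<otimes> h) = \<chi> g * \<chi> h"
    "\<And>g. g \<in> carrier W \<Longrightarrow> \<chi> g = 1 \<or> \<chi> g = -1"
    "\<And>s. s \<in> S \<Longrightarrow> \<chi> s = -1"
proof -
  obtain \<chi> :: "'a \<Rightarrow> int" where
    "\<And>g h. g \<in> carrier W \<Longrightarrow> h \<in> carrier W \<Longrightarrow> \<chi> (g \<otimes> h) = \<chi> g * \<chi> h"
    "\<And>g. g \<in> carrier W \<Longrightarrow> \<chi> g = 1 \<or> \<chi> g = -1"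
    "\<And>s. s \<in> S \<Longrightarrow> \<chi> s = (if s \<in> S then -1 else 1)"
    using sign_character[of S] by blast
  then show thesis using that[of \<chi>] by simp
qed

lemma S_nontrivial: "s \<in> S \<Longrightarrow> s \<noteq> \<one>"
proof
  assume s: "s \<in> S" "s = \<one>"
  obtain \<chi> :: "'a \<Rightarrow> int" where
    "\<And>g h. g \<in> carrier W \<Longrightarrow> h \<in> carrier W \<Longrightarrow> \<chi> (g \<otimes> h) = \<chi> g * \<chi> h"
    "\<And>s. s \<in> S \<Longrightarrow> \<chi> s = -1"
    using parity_character by metis
  from this(1)[of s s] this(2)[of s] s show False by simp
qed

text \<open>Killing the generators outside C respects the relations: an odd edge makes its ends
  conjugate, so an edge from C to its complement has even or infinite order, and an even power of
  the surviving generator is trivial.\<close>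

lemma retraction:
  assumes C: "\<And>x g. x \<in> C \<Longrightarrow> g \<in> carrier W \<Longrightarrow> g \<otimes> x \<otimes> inv g \<in> C"
  obtains \<phi> where "\<phi> \<in> hom W W" "\<And>s. s \<in> S \<Longrightarrow> \<phi> s = (if s \<in> C then s else \<one>)"
proof -
  let ?f = "\<lambda>s. if s \<in> C then s else \<one>"
  have cc: "y \<in> C" if xy: "conjugate x y" "x \<in> C" for x y
  proof -
    obtain g where "g \<in> carrier W" "y = g \<otimes> x \<otimes> inv g"
      using xy(1) unfolding conjugate_def by blast
    then show ?thesis using C[OF xy(2)] by simp
  qed
  have f: "?f \<in> S \<rightarrow> carrier W" by auto
  have rel: "(?f s \<otimes> ?f t) [^] ord (s \<otimes> t) = \<one>" if st: "s \<in> S" "t \<in> S" "ord (s \<otimes> t) \<noteq> 0" for s t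
  proof (cases "s \<in> C \<longleftrightarrow> t \<in> C")
    case True
    then show ?thesis using st pow_ord_eq_1[of "s \<otimes> t"] by auto
  next
    case False
    have "even (ord (s \<otimes> t))"
    proof (rule ccontr)
      assume "odd (ord (s \<otimes> t))"
      then have c: "conjugate s t" using odd_imp_conjugate[of s t] st by blast
      then have "conjugate t s" using conjugate_sym st by blast
      with c show False using False cc by metis
    qed
    then obtain k where k: "ord (s \<otimes> t) = 2 * k" by (auto elim: evenE)
    have "x [^] (2 * k) = \<one>" if "x \<in> S" for x
    proof -
      have "x [^] (2::nat) = \<one>" using that by (simp add: numeral_2_eq_2)
      then show ?thesis using that nat_pow_pow[of x 2 k] by simp
    qed
    then show ?thesis using False st by (auto simp: k)
  qed
  show thesis
    by (rule coxeter_hom[OF is_group f rel]) (assumption+, rule that)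
qed

end

section \<open>The geometric representation\<close>

definition unit_vec :: "'a \<Rightarrow> 'a \<Rightarrow> real" where
  "unit_vec s = (\<lambda>x. if x = s then 1 else 0)"

lemma unit_vec_simps [simp]: "unit_vec s s = 1" "x \<noteq> s \<Longrightarrow> unit_vec s x = 0"
  by (auto simp: unit_vec_def)

lemma unit_vec_inject [simp]: "unit_vec s = unit_vec t \<longleftrightarrow> s = t"
  by (metis unit_vec_simps zero_neq_one)

text \<open>The target is the group of all bijections of a function space; linearity of the image is
  shown separately by induction over words. Vectors are functions on the whole type, and W only ever
  changes coordinates in S.\<close>

definition map_group :: "('v \<Rightarrow> 'v) monoid" where
  "map_group = \<lparr>carrier = {f. bij f}, mult = (\<circ>), one = id\<rparr>"

lemma map_group_simps: "f \<otimes>\<^bsub>map_group\<^esub> g = f \<circ> g" "\<one>\<^bsub>map_group\<^esub> = id"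
  by (simp_all add: map_group_def)

lemma map_group_group: "group map_group"
proof (rule groupI)
  fix f :: "'v \<Rightarrow> 'v" assume "f \<in> carrier map_group"
  then have "bij (inv_into UNIV f)" "inv_into UNIV f \<circ> f = id"
    by (auto simp: map_group_def bij_imp_bij_inv bij_is_inj)
  then show "\<exists>g\<in>carrier map_group. g \<otimes>\<^bsub>map_group\<^esub> f = \<one>\<^bsub>map_group\<^esub>"
    by (auto simp: map_group_def)
qed (auto simp: map_group_def bij_comp o_assoc)

lemma map_group_pow: "f [^]\<^bsub>map_group\<^esub> n = f ^^ n" for n :: nat
proof (induction n)
  case (Suc n)
  have "f [^]\<^bsub>map_group\<^esub> Suc n = f [^]\<^bsub>map_group\<^esub> n \<otimes>\<^bsub>map_group\<^esub> f"
    by (simp add: nat_pow_def)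
  then show ?case using Suc by (simp add: map_group_def funpow_swap1 fun_eq_iff)
qed (simp add: map_group_def nat_pow_def)

context coxeter
begin

text \<open>The form of Tits, with unit vectors as simple roots. The value -1 at infinite order is
  the limit of -cos(pi/n), and on the diagonal the order 1 gives -cos(pi) = 1.\<close>

definition cox_form :: "'a \<Rightarrow> 'a \<Rightarrow> real" where
  "cox_form s t = (if ord (s \<otimes> t) = 0 then -1 else - cos (pi / real (ord (s \<otimes> t))))"

definition form_with :: "'a \<Rightarrow> ('a \<Rightarrow> real) \<Rightarrow> real" where
  "form_with s v = (\<Sum>t\<in>S. cox_form s t * v t)"

definition srefl :: "'a \<Rightarrow> ('a \<Rightarrow> real) \<Rightarrow> ('a \<Rightarrow> real)" where
  "srefl s v = v(s := v s - 2 * form_with s v)"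

lemma cox_form_self [simp]: "s \<in> S \<Longrightarrow> cox_form s s = 1"
  by (simp add: cox_form_def)

lemma cox_form_sym: "s \<in> S \<Longrightarrow> t \<in> S \<Longrightarrow> cox_form s t = cox_form t s"
  by (simp add: cox_form_def ord_sym)

lemma ord_ge_2: "s \<in> S \<Longrightarrow> t \<in> S \<Longrightarrow> s \<noteq> t \<Longrightarrow> ord (s \<otimes> t) \<noteq> 0 \<Longrightarrow> ord (s \<otimes> t) \<ge> 2"
proof -
  assume st: "s \<in> S" "t \<in> S" "s \<noteq> t" "ord (s \<otimes> t) \<noteq> 0"
  have "ord (s \<otimes> t) \<noteq> 1"
  proof
    assume "ord (s \<otimes> t) = 1"
    then have "s \<otimes> t = \<one>" using st ord_eq_1[of "s \<otimes> t"] by simp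
    then have "inv t = s" using st by (intro inv_equality) auto
    then show False using st by simp
  qed
  then show ?thesis using st by simp
qed

lemma form_with_linear:
  "form_with s (\<lambda>x. a * u x + b * v x) = a * form_with s u + b * form_with s v"
  by (simp add: form_with_def sum.distrib sum_distrib_left algebra_simps)

lemma form_with_unit [simp]: "t \<in> S \<Longrightarrow> form_with s (unit_vec t) = cox_form s t"
proof -
  assume t: "t \<in> S"
  have "form_with s (unit_vec t) = (\<Sum>x\<in>S. if x = t then cox_form s x else 0)"
    unfolding form_with_def by (rule sum.cong) (auto simp: unit_vec_def)
  then show ?thesis using t finite_S by simp
qed

lemma form_with_upd:
  "s \<in> S \<Longrightarrow> form_with t (v(s := a)) = form_with t v + cox_form t s * (a - v s)"
proof -
  assume s: "s \<in> S"
  have "v(s := a) = (\<lambda>x. 1 * v x + (a - v s) * unit_vec s x)" by (auto simp: unit_vec_def)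
  then show ?thesis using s form_with_linear[of t 1 v "a - v s" "unit_vec s"] by simp
qed

lemma srefl_linear: "srefl s (\<lambda>x. a * u x + b * v x) = (\<lambda>x. a * srefl s u x + b * srefl s v x)"
  by (auto simp: srefl_def form_with_linear algebra_simps)

lemma srefl_eq: "srefl s v = (\<lambda>x. v x - 2 * form_with s v * unit_vec s x)"
  by (auto simp: srefl_def unit_vec_def)

lemma srefl_srefl: "s \<in> S \<Longrightarrow> srefl s (srefl s v) = v"
  by (auto simp: srefl_def form_with_upd)

lemma bij_srefl: "s \<in> S \<Longrightarrow> bij (srefl s)"
  by (rule o_bij[of "srefl s"]) (auto simp: srefl_srefl)

text \<open>The Chebyshev polynomial of the second kind of degree j - 1, evaluated at
  \<open>- cox_form s t\<close>, that is sin(j \<theta>) / sin \<theta> with its limit j at \<theta>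
  = 0. Its values are the coefficients of the roots in the dihedral orbit of a simple root.\<close>

definition cheb :: "'a \<Rightarrow> 'a \<Rightarrow> int \<Rightarrow> real" where
  "cheb s t j = (if ord (s \<otimes> t) = 0 then real_of_int j
     else sin (real_of_int j * (pi / ord (s \<otimes> t))) / sin (pi / ord (s \<otimes> t)))"

lemma sin_pi_div_pos: "n \<ge> 2 \<Longrightarrow> sin (pi / real n) > 0"
  by (rule sin_gt_zero) (auto simp: field_simps)

context
  fixes s t
  assumes s: "s \<in> S" and t: "t \<in> S" and neq: "s \<noteq> t"
begin

lemma cheb_rec: "cheb s t (j + 2) = - 2 * cox_form s t * cheb s t (j + 1) - cheb s t j"
proof (cases "ord (s \<otimes> t) = 0")
  case True
  then show ?thesis by (simp add: cheb_def cox_form_def)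
next
  case False
  define \<theta> where "\<theta> = pi / real (ord (s \<otimes> t))"
  have "sin \<theta> > 0" unfolding \<theta>_def using ord_ge_2[OF s t neq False] by (rule sin_pi_div_pos)
  moreover have "sin ((of_int j + 2) * \<theta>) = 2 * cos \<theta> * sin ((of_int j + 1) * \<theta>) - sin (of_int j * \<theta>)"
  proof -
    have "sin ((of_int j + 1) * \<theta> + \<theta>) + sin ((of_int j + 1) * \<theta> - \<theta>) = 2 * cos \<theta> * sin ((of_int j + 1) * \<theta>)"
      unfolding sin_add sin_diff by simp
    moreover have "(of_int j + 1) * \<theta> + \<theta> = (of_int j + 2) * \<theta>" "(of_int j + 1) * \<theta> - \<theta> = of_int j * \<theta>"
      by (simp_all add: algebra_simps)
    ultimately show ?thesis by simp
  qed
  ultimately show ?thesis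
    using False by (simp add: cheb_def cox_form_def \<theta>_def[symmetric] field_simps)
qed

lemma cheb_0 [simp]: "cheb s t 0 = 0"
  by (simp add: cheb_def)

lemma cheb_1 [simp]: "cheb s t 1 = 1"
proof (cases "ord (s \<otimes> t) = 0")
  case False
  then show ?thesis using sin_pi_div_pos[OF ord_ge_2[OF s t neq False]] by (simp add: cheb_def)
qed (simp add: cheb_def)

lemma cheb_nonneg:
  assumes "ord (s \<otimes> t) = 0 \<or> k \<le> ord (s \<otimes> t)"
  shows "cheb s t (int k) \<ge> 0"
proof (cases "ord (s \<otimes> t) = 0")
  case False
  have "sin (pi / real (ord (s \<otimes> t))) > 0"
    by (rule sin_pi_div_pos[OF ord_ge_2[OF s t neq False]])
  moreover have "sin (real k * (pi / real (ord (s \<otimes> t)))) \<ge> 0"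
    by (rule sin_ge_zero) (use assms False in \<open>auto simp: field_simps\<close>)
  ultimately show ?thesis using False by (simp add: cheb_def)
qed (simp add: cheb_def)

text \<open>Only the coordinates at s and t move. They undergo an affine map whose linear part is a
  rotation through 2 \<theta>, and m steps make a full turn 2 pi. Working with a fixed point of this
  affine map treats arbitrary vectors at once, without splitting off a complement of the
  plane.\<close>

lemma srefl_power_ord:
  assumes fin: "ord (s \<otimes> t) \<noteq> 0"
  shows "((srefl s \<circ> srefl t) ^^ ord (s \<otimes> t)) v = v"
proof -
  define m where "m = ord (s \<otimes> t)"
  define \<kappa> where "\<kappa> = cox_form s t"
  define \<theta> where "\<theta> = pi / real m"
  have sin: "sin \<theta> > 0"
    unfolding \<theta>_def m_def using ord_ge_2[OF s t neq fin] by (rule sin_pi_div_pos)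
  have k: "\<kappa> = - cos \<theta>" using fin by (simp add: \<kappa>_def cox_form_def \<theta>_def m_def)
  \<comment> \<open>1 - \<kappa>^2 is sin^2 \<theta>, the Gram determinant of the plane of the two
    simple roots; it is nonzero as the order is finite and at least 2.\<close>
  have det: "1 - \<kappa>\<^sup>2 \<noteq> 0"
    using sin sin_squared_eq[of \<theta>] unfolding k by (metis less_irrefl power2_minus zero_eq_power2)
  \<comment> \<open>A and D are the contributions of the coordinates other than s and t to the two
    forms, hence constant along the orbit.\<close>
  define A where "A = form_with s v - v s - \<kappa> * v t"
  define D where "D = form_with t v - v t - \<kappa> * v s"
  \<comment> \<open>The coordinates at s and t of the orbit of v are shifted by the fixed point (a, b).\<close>
  define a where "a = (\<kappa> * D - A) / (1 - \<kappa>\<^sup>2)"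
  define b where "b = (\<kappa> * A - D) / (1 - \<kappa>\<^sup>2)"
  have ab: "a * (1 - \<kappa>\<^sup>2) = \<kappa> * D - A" "b * (1 - \<kappa>\<^sup>2) = \<kappa> * A - D"
    using det by (simp_all add: a_def b_def)
  have "(a + \<kappa> * b) * (1 - \<kappa>\<^sup>2) = - A * (1 - \<kappa>\<^sup>2)" "(b + \<kappa> * a) * (1 - \<kappa>\<^sup>2) = - D * (1 - \<kappa>\<^sup>2)"
  proof -
    have "(a + \<kappa> * b) * (1 - \<kappa>\<^sup>2) = a * (1 - \<kappa>\<^sup>2) + \<kappa> * (b * (1 - \<kappa>\<^sup>2))"
      "(b + \<kappa> * a) * (1 - \<kappa>\<^sup>2) = b * (1 - \<kappa>\<^sup>2) + \<kappa> * (a * (1 - \<kappa>\<^sup>2))"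
      by (simp_all only: distrib_right mult.assoc)
    then show "(a + \<kappa> * b) * (1 - \<kappa>\<^sup>2) = - A * (1 - \<kappa>\<^sup>2)"
      "(b + \<kappa> * a) * (1 - \<kappa>\<^sup>2) = - D * (1 - \<kappa>\<^sup>2)"
      unfolding ab by (simp_all add: algebra_simps power2_eq_square)
  qed
  then have "a + \<kappa> * b = - A" "b + \<kappa> * a = - D"
    unfolding mult_right_cancel[OF det] by blast+
  then have A: "A = - a - \<kappa> * b" and D: "D = - b - \<kappa> * a" by simp_all
  define x where "x = v s - a"
  define y where "y = v t - b"
  let ?p = "cheb s t"
  have orbit: "((srefl s \<circ> srefl t) ^^ n) v
      = v(s := a + ?p (2 * int n + 1) * x - ?p (2 * int n) * y,
          t := b + ?p (2 * int n) * x - ?p (2 * int n - 1) * y)" (is "_ = ?v n") for n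
  proof (induction n)
    case 0
    \<comment> \<open>The orbit formula reaches back to index -1 at n = 0, which is why
      \<open>cheb\<close> takes integers.\<close>
    have "?p (-1) = -1" using cheb_rec[of "-1"] by simp
    then show ?case using neq by (auto simp: x_def y_def)
  next
    case (Suc n)
    let ?j = "2 * int n"
    have r1: "?p (?j + 2) = - 2 * \<kappa> * ?p (?j + 1) - ?p ?j"
      and r2: "?p (?j + 1) = - 2 * \<kappa> * ?p ?j - ?p (?j - 1)"
      and r3: "?p (?j + 3) = - 2 * \<kappa> * ?p (?j + 2) - ?p (?j + 1)"
      using cheb_rec[of ?j] cheb_rec[of "?j - 1"] cheb_rec[of "?j + 1"] by (simp_all add: \<kappa>_def add.commute)
    have s0: "?p (?j - 1) = - 2 * \<kappa> * ?p ?j - ?p (?j + 1)"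
      and s1: "?p ?j = - 2 * \<kappa> * ?p (?j + 1) - ?p (?j + 2)"
      using r1 r2 by simp_all
    define p0 p1 p2 p3 pm where
      p: "p0 = ?p ?j" "p1 = ?p (?j + 1)" "p2 = ?p (?j + 2)" "p3 = ?p (?j + 3)" "pm = ?p (?j - 1)"
    note s0 = s0[folded p] and s1 = s1[folded p] and r1' = r1[folded p] and r3' = r3[folded p]
    define a' where "a' = a + ?p (?j + 1) * x - ?p ?j * y"
    define b' where "b' = b + ?p ?j * x - ?p (?j - 1) * y"
    have v: "?v n = v(s := a', t := b')" unfolding a'_def b'_def by (rule refl)
    have ft: "form_with t (v(s := a', t := b')) = b' + \<kappa> * a' + D"
      using s t neq by (simp add: form_with_upd D_def \<kappa>_def cox_form_sym[OF t s] algebra_simps)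
    define b'' where "b'' = b' - 2 * (b' + \<kappa> * a' + D)"
    have t1: "srefl t (?v n) = v(s := a', t := b'')"
      unfolding v srefl_def ft using neq by (auto simp: b''_def)
    have fs: "form_with s (v(s := a', t := b'')) = a' + \<kappa> * b'' + A"
      using s t neq by (simp add: form_with_upd A_def \<kappa>_def algebra_simps)
    have t2: "srefl s (srefl t (?v n)) = v(s := a' - 2 * (a' + \<kappa> * b'' + A), t := b'')"
      unfolding t1 unfolding srefl_def fs using neq by (auto simp: fun_upd_twist)
    have b2: "b'' = b + ?p (?j + 2) * x - ?p (?j + 1) * y"
      unfolding b''_def D b'_def a'_def p[symmetric] s0 r1' by (simp add: algebra_simps)
    have a2: "a' - 2 * (a' + \<kappa> * b'' + A) = a + ?p (?j + 3) * x - ?p (?j + 2) * y"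
      unfolding b2 A a'_def p[symmetric] r3' s1 by (simp add: algebra_simps)
    have "((srefl s \<circ> srefl t) ^^ Suc n) v = srefl s (srefl t (?v n))"
      by (simp only: funpow.simps(2) comp_apply Suc)
    also have "\<dots> = v(s := a + ?p (?j + 3) * x - ?p (?j + 2) * y,
        t := b + ?p (?j + 2) * x - ?p (?j + 1) * y)"
      by (rule t2[unfolded a2, unfolded b2])
    also have "\<dots> = ?v (Suc n)"
    proof -
      have "2 * int (Suc n) + 1 = ?j + 3" "2 * int (Suc n) = ?j + 2" "?j + 2 - 1 = ?j + 1"
        by simp_all
      then show ?thesis by (simp only:)
    qed
    finally show ?case .
  qed
  have "?p (2 * int m + 1) = 1" "?p (2 * int m) = 0" "?p (2 * int m - 1) = -1"
  proof -
    have m: "real m * \<theta> = pi" using fin by (simp add: \<theta>_def m_def)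
    have c: "?p j = sin (real_of_int j * \<theta>) / sin \<theta>" for j
      using fin by (simp add: cheb_def \<theta>_def m_def)
    have e: "real_of_int (2 * int m + 1) * \<theta> = \<theta> + 2 * pi" "real_of_int (2 * int m) * \<theta> = 2 * pi"
      "real_of_int (2 * int m - 1) * \<theta> = - \<theta> + 2 * pi"
      using m by (simp_all add: algebra_simps)
    show "?p (2 * int m + 1) = 1" "?p (2 * int m) = 0" "?p (2 * int m - 1) = -1"
      unfolding c e using sin by (simp_all add: sin_add sin_diff)
  qed
  then show ?thesis using orbit[of m] neq by (auto simp: m_def[symmetric] x_def y_def)
qed

end

lemma rep_exists:
  "\<exists>h \<in> hom W (map_group :: (('a \<Rightarrow> real) \<Rightarrow> ('a \<Rightarrow> real)) monoid). \<forall>s\<in>S. h s = srefl s"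
proof -
  have f: "srefl \<in> S \<rightarrow> carrier (map_group :: (('a \<Rightarrow> real) \<Rightarrow> ('a \<Rightarrow> real)) monoid)"
    by (auto simp: map_group_def bij_srefl)
  have rel: "(srefl s \<otimes>\<^bsub>map_group\<^esub> srefl t) [^]\<^bsub>map_group\<^esub> ord (s \<otimes> t) = \<one>\<^bsub>map_group\<^esub>"
    if st: "s \<in> S" "t \<in> S" "ord (s \<otimes> t) \<noteq> 0" for s t
  proof (cases "s = t")
    case True
    then show ?thesis using st
      by (simp add: map_group_pow) (simp add: map_group_def fun_eq_iff srefl_srefl)
  next
    case False
    then show ?thesis unfolding map_group_pow using srefl_power_ord[OF st(1,2) False st(3)]
      by (simp add: map_group_def fun_eq_iff)
  qed
  obtain h where "h \<in> hom W (map_group :: (('a \<Rightarrow> real) \<Rightarrow> ('a \<Rightarrow> real)) monoid)" "\<And>s. s \<in> S \<Longrightarrow> h s = srefl s"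
    by (rule coxeter_hom[OF map_group_group f rel]) (assumption+, rule that)
  then show ?thesis by (intro bexI[of _ h] ballI)
qed

definition rep :: "'a \<Rightarrow> ('a \<Rightarrow> real) \<Rightarrow> ('a \<Rightarrow> real)" where
  "rep = (SOME h. h \<in> hom W map_group \<and> (\<forall>s\<in>S. h s = srefl s))"

lemma rep_spec: "rep \<in> hom W map_group" "s \<in> S \<Longrightarrow> rep s = srefl s"
proof -
  have "\<exists>h. h \<in> hom W map_group \<and> (\<forall>s\<in>S. h s = srefl s)"
    using rep_exists by (simp only: Bex_def)
  from someI_ex[OF this] have "rep \<in> hom W map_group \<and> (\<forall>s\<in>S. rep s = srefl s)"
    unfolding rep_def .
  then show "rep \<in> hom W map_group" "s \<in> S \<Longrightarrow> rep s = srefl s" by simp_all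
qed

lemma rep_mult [simp]:
  "g \<in> carrier W \<Longrightarrow> h \<in> carrier W \<Longrightarrow> rep (g \<otimes> h) v = rep g (rep h v)"
  by (simp only: hom_mult[OF rep_spec(1)] map_group_simps comp_apply)

lemma rep_one [simp]: "rep \<one> v = v"
  by (simp only: hom_one[OF rep_spec(1) is_group map_group_group] map_group_simps id_apply)

lemma rep_inv [simp]:
  "g \<in> carrier W \<Longrightarrow> rep (inv g) (rep g v) = v" "g \<in> carrier W \<Longrightarrow> rep g (rep (inv g) v) = v"
  using rep_mult[of "inv g" g v] rep_mult[of g "inv g" v] by (simp_all del: rep_mult)

lemma rep_linear:
  "g \<in> carrier W \<Longrightarrow> rep g (\<lambda>x. a * u x + b * v x) = (\<lambda>x. a * rep g u x + b * rep g v x)"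
proof (induction arbitrary: u v rule: coxeter_induct)
  case (step h s)
  then show ?case by (simp add: rep_spec(2) srefl_linear)
qed simp

end

section \<open>Length and positivity of roots\<close>

context group
begin

text \<open>The alternating product of k factors with a rightmost, so that a acts first; new factors
  are put on at the left.\<close>

primrec alt_word :: "nat \<Rightarrow> 'a \<Rightarrow> 'a \<Rightarrow> 'a" where
  "alt_word 0 a b = \<one>"
| "alt_word (Suc k) a b = (if even k then a else b) \<otimes> alt_word k a b"

lemma alt_word_closed [simp]:
  "a \<in> carrier G \<Longrightarrow> b \<in> carrier G \<Longrightarrow> alt_word k a b \<in> carrier G"
  by (induction k) auto

lemma alt_word_Suc_right:
  "a \<in> carrier G \<Longrightarrow> b \<in> carrier G \<Longrightarrow> alt_word (Suc k) a b = alt_word k b a \<otimes> a"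
  by (induction k) (auto simp: m_assoc)

end

context involution_pair
begin

lemma alt_word_even: "alt_word (2 * j) b a = c [^] (int j)" "alt_word (2 * j) a b = c [^] (- int j)"
proof -
  show "alt_word (2 * j) b a = c [^] (int j)"
  proof (induction j)
    case (Suc j)
    have "alt_word (2 * Suc j) b a = c \<otimes> alt_word (2 * j) b a" by (simp add: m_assoc)
    also have "\<dots> = c [^] (1 + int j)" unfolding Suc using int_pow_mult[of c 1 "int j"] by simp
    finally show ?case by simp
  qed simp
  show "alt_word (2 * j) a b = c [^] (- int j)"
  proof (induction j)
    case (Suc j)
    have "alt_word (2 * Suc j) a b = (b \<otimes> a) \<otimes> alt_word (2 * j) a b" by (simp add: m_assoc)
    also have "b \<otimes> a = c [^] (-1 :: int)" by (simp add: int_pow_neg inv_mult_group)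
    also have "c [^] (-1 :: int) \<otimes> alt_word (2 * j) a b = c [^] (- 1 + - int j)"
      unfolding Suc using int_pow_mult[of c "-1" "- int j"] by simp
    finally show ?case by (simp add: algebra_simps)
  qed simp
qed

lemma braid:
  assumes "ord c = m"
  shows "alt_word m b a = alt_word m a b"
proof (cases "even m")
  case True
  then obtain j where j: "m = 2 * j" by (auto elim: evenE)
  have "int (ord c) dvd int j - (- int j)" by (simp add: assms j)
  then have "c [^] (int j) \<otimes> a = c [^] (- int j) \<otimes> a" unfolding rot_eq_iff .
  then show ?thesis by (simp add: j alt_word_even)
next
  case False
  then obtain j where j: "m = 2 * j + 1" by (auto elim: oddE)
  have "alt_word m b a = b \<otimes> c [^] (int j)" by (simp add: j alt_word_even)
  also have "\<dots> = c [^] (-1 - int j) \<otimes> a"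
    using refl_rot_mult[of "-1" "int j"] by (simp add: b_eq[symmetric])
  also have "\<dots> = c [^] (int j) \<otimes> a"
  proof -
    have "(-1 - int j) - int j = - int m" by (simp add: j)
    then show ?thesis unfolding rot_eq_iff assms by simp
  qed
  also have "\<dots> = a \<otimes> c [^] (- int j)" by (simp add: a_pow)
  also have "\<dots> = alt_word m a b" by (simp add: j alt_word_even)
  finally show ?thesis .
qed

end

section \<open>Word length and the positivity of roots\<close>

context coxeter
begin

text \<open>Products of exactly n generators, not of at most n; this makes the parity character
  equal to (-1)^n on \<open>word_ball n\<close>.\<close>

primrec word_ball :: "nat \<Rightarrow> 'a set" where
  "word_ball 0 = {\<one>}"
| "word_ball (Suc n) = {h \<otimes> s |h s. h \<in> word_ball n \<and> s \<in> S}"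

definition len :: "'a \<Rightarrow> nat" where
  "len g = (LEAST n. g \<in> word_ball n)"

lemma word_ball_closed: "g \<in> word_ball n \<Longrightarrow> g \<in> carrier W"
  by (induction n arbitrary: g) auto

lemma word_ball_mult:
  "g \<in> word_ball m \<Longrightarrow> h \<in> word_ball n \<Longrightarrow> g \<otimes> h \<in> word_ball (m + n)"
proof (induction n arbitrary: h)
  case 0
  then show ?case using word_ball_closed by simp
next
  case (Suc n)
  then obtain k s where k: "h = k \<otimes> s" "k \<in> word_ball n" "s \<in> S" by auto
  then have "g \<otimes> k \<in> word_ball (m + n)" using Suc by blast
  moreover have "g \<otimes> h = (g \<otimes> k) \<otimes> s"
    using k Suc.prems word_ball_closed by (simp add: m_assoc)
  ultimately show ?case using k by auto
qed

lemma S_word_ball: "s \<in> S \<Longrightarrow> s \<in> word_ball 1"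
  by force

lemma word_ball_inv: "g \<in> word_ball n \<Longrightarrow> inv g \<in> word_ball n"
proof (induction n arbitrary: g)
  case (Suc n)
  then obtain h s where h: "g = h \<otimes> s" "h \<in> word_ball n" "s \<in> S" by auto
  then have "s \<otimes> inv h \<in> word_ball (1 + n)" using Suc S_word_ball word_ball_mult by blast
  then show ?case using h word_ball_closed by (simp add: inv_mult_group)
qed simp

lemma in_word_ball: "g \<in> carrier W \<Longrightarrow> \<exists>n. g \<in> word_ball n"
proof (induction rule: coxeter_induct)
  case one
  have "\<one> \<in> word_ball 0" by simp
  then show ?case by blast
next
  case (step h s)
  then obtain n where "h \<in> word_ball n" by blast
  then have "h \<otimes> s \<in> word_ball (Suc n)" using step by auto
  then show ?case by blast
qed

lemma in_word_ball_len: "g \<in> carrier W \<Longrightarrow> g \<in> word_ball (len g)"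
  unfolding len_def using in_word_ball by (rule LeastI_ex)

lemma len_le: "g \<in> word_ball n \<Longrightarrow> len g \<le> n"
  unfolding len_def by (rule Least_le)

lemma len_one [simp]: "len \<one> = 0"
  using len_le[of \<one> 0] by simp

lemma len_0: "g \<in> carrier W \<Longrightarrow> len g = 0 \<Longrightarrow> g = \<one>"
  using in_word_ball_len[of g] by simp

lemma len_mult_le: "g \<in> carrier W \<Longrightarrow> h \<in> carrier W \<Longrightarrow> len (g \<otimes> h) \<le> len g + len h"
  by (intro len_le word_ball_mult in_word_ball_len)

lemma len_inv [simp]: "g \<in> carrier W \<Longrightarrow> len (inv g) = len g"
  using len_le[OF word_ball_inv[OF in_word_ball_len], of g]
    len_le[OF word_ball_inv[OF in_word_ball_len], of "inv g"] by simp

lemma mult_S_cancel [simp]: "g \<in> carrier W \<Longrightarrow> s \<in> S \<Longrightarrow> g \<otimes> s \<otimes> s = g"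
  by (simp add: m_assoc)

lemma S_mult_cancel:
  assumes "g \<in> carrier W" "s \<in> S"
  shows "s \<otimes> (s \<otimes> g) = g"
proof -
  have "s \<otimes> (s \<otimes> g) = s \<otimes> s \<otimes> g" using assms by (simp only: m_assoc S_closed)
  then show ?thesis using assms by simp
qed

text \<open>The parity character changes sign under multiplication by s, which rules out equal
  lengths; the triangle inequality leaves a difference of one.\<close>

lemma len_mult_S:
  assumes g: "g \<in> carrier W" and s: "s \<in> S"
  shows "len (g \<otimes> s) = len g + 1 \<or> len (g \<otimes> s) + 1 = len g"
proof -
  obtain \<chi> :: "'a \<Rightarrow> int" where
    \<chi>: "\<And>g h. g \<in> carrier W \<Longrightarrow> h \<in> carrier W \<Longrightarrow> \<chi> (g \<otimes> h) = \<chi> g * \<chi> h"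
    "\<And>s. s \<in> S \<Longrightarrow> \<chi> s = -1" "\<And>g. g \<in> carrier W \<Longrightarrow> \<chi> g = 1 \<or> \<chi> g = -1"
    using parity_character by metis
  have one: "\<chi> \<one> = 1" using \<chi>(1)[of \<one> \<one>] \<chi>(3)[of \<one>] by auto
  have pow: "\<chi> h = (-1) ^ n" if "h \<in> word_ball n" for h n
    using that
  proof (induction n arbitrary: h)
    case (Suc n)
    then obtain k x where k: "h = k \<otimes> x" "k \<in> word_ball n" "x \<in> S" by auto
    then show ?case using Suc.IH[OF k(2)] \<chi>(1)[of k x] \<chi>(2)[OF k(3)] word_ball_closed by simp
  qed (simp add: one)
  have "(-1) ^ len (g \<otimes> s) = - ((-1::int) ^ len g)"
    using pow[OF in_word_ball_len[OF g]] pow[OF in_word_ball_len, of "g \<otimes> s"] \<chi>(1)[of g s] \<chi>(2)[OF s] g s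
    by simp
  then have "len (g \<otimes> s) \<noteq> len g" by auto
  moreover have s1: "len s \<le> 1" using len_le[OF S_word_ball[OF s]] .
  moreover have "len (g \<otimes> s) \<le> len g + len s" using g s by (intro len_mult_le) auto
  moreover have "len (g \<otimes> s \<otimes> s) \<le> len (g \<otimes> s) + len s" using g s by (intro len_mult_le) auto
  then have "len g \<le> len (g \<otimes> s) + len s" using g s by simp
  ultimately show ?thesis by linarith
qed

lemma descent_exists:
  assumes g: "g \<in> carrier W" "g \<noteq> \<one>"
  obtains s where "s \<in> S" "len (g \<otimes> s) + 1 = len g"
proof -
  have "len g \<noteq> 0" using len_0[OF g(1)] g(2) by blast
  then obtain n where n: "len g = Suc n" using not0_implies_Suc by blast
  then obtain h s where h: "g = h \<otimes> s" "h \<in> word_ball n" "s \<in> S"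
    using in_word_ball_len[OF g(1)] by auto
  then have "g \<otimes> s = h" using word_ball_closed by simp
  then have "len (g \<otimes> s) \<le> n" using len_le h by simp
  then have "len (g \<otimes> s) + 1 = len g" using len_mult_S[OF g(1) h(3)] n by linarith
  then show thesis by (rule that[OF h(3)])
qed

lemma alt_word_ball: "s \<in> S \<Longrightarrow> t \<in> S \<Longrightarrow> alt_word k t s \<in> word_ball k"
proof (induction k)
  case (Suc k)
  have "(if even k then t else s) \<in> word_ball 1" using S_word_ball Suc.prems by auto
  from word_ball_mult[OF this Suc.IH[OF Suc.prems]] show ?case by simp
qed simp

text \<open>With at least \<open>ord\<close> letters the braid relation can be applied to the last
  \<open>ord\<close> of them, and the word that ended in t then ends in s. Multiplying by s on the
  right therefore shortens it.\<close>

lemma alt_word_shorten: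
  assumes s: "s \<in> S" and t: "t \<in> S" and m: "ord (s \<otimes> t) \<noteq> 0" and k: "ord (s \<otimes> t) \<le> k"
  shows "\<exists>h \<in> word_ball (k - 1). alt_word k t s = h \<otimes> s"
  using k
proof (induction k rule: dec_induct)
  case base
  interpret involution_pair W s t using s t by (rule S_pair)
  obtain n where n: "ord (s \<otimes> t) = Suc n" using m by (cases "ord (s \<otimes> t)") auto
  have "alt_word (ord (s \<otimes> t)) t s = alt_word n t s \<otimes> s"
    using braid[OF refl] alt_word_Suc_right[of s t n] s t by (simp only: n S_closed)
  then show ?case using alt_word_ball[OF s t, of n] n by auto
next
  case (step k)
  then obtain h where h: "h \<in> word_ball (k - 1)" "alt_word k t s = h \<otimes> s" by blast
  let ?x = "if even k then t else s"
  have "?x \<in> word_ball 1" using S_word_ball s t by auto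
  then have "?x \<otimes> h \<in> word_ball (1 + (k - 1))" using word_ball_mult h by blast
  moreover have "1 + (k - 1) = Suc k - 1" using step m by simp
  moreover have "alt_word (Suc k) t s = (?x \<otimes> h) \<otimes> s"
    using h word_ball_closed s t by (simp add: m_assoc)
  ultimately show ?case by metis
qed

text \<open>Each new letter changes one of two coefficients, by exactly the Chebyshev recursion, so
  the coefficients are always two consecutive values of \<open>cheb\<close>.\<close>

lemma rep_alt_word:
  assumes s: "s \<in> S" and t: "t \<in> S" and neq: "s \<noteq> t"
  shows "rep (alt_word k t s) (unit_vec s) =
    (if even k then (\<lambda>x. cheb s t (int k + 1) * unit_vec s x + cheb s t (int k) * unit_vec t x)
     else (\<lambda>x. cheb s t (int k) * unit_vec s x + cheb s t (int k + 1) * unit_vec t x))"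
proof (induction k)
  case 0
  then show ?case using cheb_0[OF s t neq] cheb_1[OF s t neq] s t by simp
next
  case (Suc k)
  have r: "cheb s t (int k + 2) = - 2 * cox_form s t * cheb s t (int k + 1) - cheb s t (int k)"
    by (rule cheb_rec[OF s t neq])
  have lin: "srefl r (\<lambda>x. a * unit_vec s x + b * unit_vec t x) = (\<lambda>x. a * unit_vec s x + b * unit_vec t x
      - 2 * (a * cox_form r s + b * cox_form r t) * unit_vec r x)" for r a b
    unfolding srefl_eq using s t by (simp add: form_with_linear)
  let ?x = "if even k then t else s"
  have "rep (alt_word (Suc k) t s) (unit_vec s) = srefl ?x (rep (alt_word k t s) (unit_vec s))"
    using s t by (simp add: rep_spec(2))
  also have "\<dots> = (if even (Suc k) then (\<lambda>x. cheb s t (int (Suc k) + 1) * unit_vec s x + cheb s t (int (Suc k)) * unit_vec t x)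
     else (\<lambda>x. cheb s t (int (Suc k)) * unit_vec s x + cheb s t (int (Suc k) + 1) * unit_vec t x))"
  proof (cases "even k")
    case True
    have "cheb s t (int (Suc k) + 1) = cheb s t (int k + 2)" by (simp add: add.commute)
    moreover have "srefl ?x (rep (alt_word k t s) (unit_vec s))
        = srefl t (\<lambda>x. cheb s t (int k + 1) * unit_vec s x + cheb s t (int k) * unit_vec t x)"
      using Suc True by simp
    ultimately show ?thesis using True s t neq unfolding lin
      by (auto simp: r cox_form_sym[OF t s] fun_eq_iff unit_vec_def algebra_simps)
  next
    case False
    have "cheb s t (int (Suc k) + 1) = cheb s t (int k + 2)" by (simp add: add.commute)
    moreover have "srefl ?x (rep (alt_word k t s) (unit_vec s))
        = srefl s (\<lambda>x. cheb s t (int k) * unit_vec s x + cheb s t (int k + 1) * unit_vec t x)"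
      using Suc False by simp
    ultimately show ?thesis using False s t neq unfolding lin
      by (auto simp: r cox_form_sym[OF t s] fun_eq_iff unit_vec_def algebra_simps)
  qed
  finally show ?case .
qed

text \<open>Take a descent t of g and split off the longest possible tail in s and t ending in t.
  The remaining factor v ascends at both s and t, so by induction it sends both simple roots to
  nonnegative vectors. The tail sends the root of s to a combination of the two simple roots, and
  its coefficients are nonnegative because the tail is shorter than the order: otherwise the braid
  relation would turn its last letter into s, and s would be a descent of g.\<close>

theorem positive_root:
  assumes "g \<in> carrier W" "s \<in> S" "len (g \<otimes> s) > len g"
  shows "rep g (unit_vec s) x \<ge> 0"
  using assms
proof (induction "len g" arbitrary: g s rule: less_induct)
  case less
  note g = less.prems(1) and s = less.prems(2)
  show ?case
  proof (cases "g = \<one>")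
    case True
    then show ?thesis by (simp add: unit_vec_def)
  next
    case False
    then obtain t where t: "t \<in> S" and gt: "len (g \<otimes> t) + 1 = len g"
      using descent_exists[OF g] by blast
    have neq: "s \<noteq> t" using gt less.prems(3) by auto
    \<comment> \<open>The lengths of tails that can be split off without loss, that is with lengths
      adding up.\<close>
    define K where "K = {k. \<exists>v\<in>carrier W. g = v \<otimes> alt_word k t s \<and> len v + k = len g}"
    have K1: "1 \<in> K"
      unfolding K_def using g t gt by (auto intro!: bexI[of _ "g \<otimes> t"])
    have finK: "finite K" by (rule finite_subset[of _ "{..len g}"]) (auto simp: K_def)
    define k where "k = Max K"
    have kK: "k \<in> K" and kmax: "\<And>j. j \<in> K \<Longrightarrow> j \<le> k"
      unfolding k_def using finK K1 by (auto intro: Max_in)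
    have k1: "k \<ge> 1" using kmax K1 by blast
    obtain v where v: "v \<in> carrier W" "g = v \<otimes> alt_word k t s" "len v + k = len g"
      using kK by (auto simp: K_def)
    \<comment> \<open>\<open>?x\<close> is the letter that would prolong the tail and
      \<open>?y\<close> the letter put on last. A descent of v at \<open>?x\<close> contradicts the
      maximality of k, one at \<open>?y\<close> contradicts the additivity of lengths.\<close>
    let ?x = "if even k then t else s"
    let ?y = "if even k then s else t"
    have xS: "?x \<in> S" and yS: "?y \<in> S" using s t by auto
    have "len (v \<otimes> ?x) > len v"
    proof (rule ccontr)
      assume "\<not> len (v \<otimes> ?x) > len v"
      then have l: "len (v \<otimes> ?x) + 1 = len v" using len_mult_S[OF v(1) xS] by auto
      have "(v \<otimes> ?x) \<otimes> alt_word (Suc k) t s = v \<otimes> (?x \<otimes> (?x \<otimes> alt_word k t s))"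
        using v(1) xS s t by (simp only: alt_word.simps m_assoc alt_word_closed S_closed m_closed)
      also have "?x \<otimes> (?x \<otimes> alt_word k t s) = alt_word k t s"
        using xS s t by (intro S_mult_cancel) auto
      also have "v \<otimes> alt_word k t s = g" using v(2) ..
      finally have "Suc k \<in> K"
        unfolding K_def using l v(1,3) xS S_closed by (intro CollectI bexI[of _ "v \<otimes> ?x"]) auto
      then show False using kmax by fastforce
    qed
    moreover have "len (v \<otimes> ?y) > len v"
    proof (rule ccontr)
      assume "\<not> len (v \<otimes> ?y) > len v"
      then have l: "len (v \<otimes> ?y) + 1 = len v" using len_mult_S[OF v(1) yS] by auto
      obtain j where j: "k = Suc j" using k1 by (cases k) auto
      have "alt_word k t s = ?y \<otimes> alt_word j t s" by (simp add: j)
      then have "g = (v \<otimes> ?y) \<otimes> alt_word j t s" using v s t by (simp add: m_assoc)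
      then have "len g \<le> len (v \<otimes> ?y) + len (alt_word j t s)"
        using v(1) s t by (auto intro: len_mult_le)
      also have "len (alt_word j t s) \<le> j" using alt_word_ball[OF s t] by (rule len_le)
      finally show False using l v(3) j by simp
    qed
    ultimately have "len (v \<otimes> s) > len v" "len (v \<otimes> t) > len v" by (auto split: if_splits)
    moreover have "len v < len g" using v(3) k1 by simp
    ultimately have pos: "rep v (unit_vec s) x \<ge> 0" "rep v (unit_vec t) x \<ge> 0"
      using less.hyps v(1) s t by auto
    have km: "ord (s \<otimes> t) = 0 \<or> Suc k \<le> ord (s \<otimes> t)"
    proof (rule ccontr)
      assume "\<not> (ord (s \<otimes> t) = 0 \<or> Suc k \<le> ord (s \<otimes> t))"
      then obtain h where h: "h \<in> word_ball (k - 1)" "alt_word k t s = h \<otimes> s"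
        using alt_word_shorten[OF s t, of k] by auto
      then have "g \<otimes> s = v \<otimes> h" using v s word_ball_closed by (simp add: m_assoc)
      then have "len (g \<otimes> s) \<le> len v + len h" using len_mult_le v(1) word_ball_closed h(1) by simp
      also have "len h \<le> k - 1" using h(1) by (rule len_le)
      finally show False using v(3) k1 less.prems(3) by simp
    qed
    then have c: "cheb s t (int k) \<ge> 0" "cheb s t (int k + 1) \<ge> 0"
      using cheb_nonneg[OF s t neq, of k] cheb_nonneg[OF s t neq, of "Suc k"] by (auto simp: add.commute)
    have "rep g (unit_vec s) = rep v (rep (alt_word k t s) (unit_vec s))"
      using v s t by simp
    then show ?thesis
      unfolding rep_alt_word[OF s t neq] using c pos
      by (cases "even k") (simp_all add: rep_linear[OF v(1)])
  qed
qed

end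

section \<open>Roots and reflections\<close>

abbreviation nonneg :: "('a \<Rightarrow> real) \<Rightarrow> bool" where
  "nonneg v \<equiv> \<forall>x. 0 \<le> v x"

abbreviation nonpos :: "('a \<Rightarrow> real) \<Rightarrow> bool" where
  "nonpos v \<equiv> \<forall>x. v x \<le> 0"

context coxeter
begin

definition root :: "('a \<Rightarrow> real) \<Rightarrow> bool" where
  "root v \<longleftrightarrow> (\<exists>g\<in>carrier W. \<exists>s\<in>S. v = rep g (unit_vec s))"

definition bil :: "('a \<Rightarrow> real) \<Rightarrow> ('a \<Rightarrow> real) \<Rightarrow> real" where
  "bil u v = (\<Sum>s\<in>S. u s * form_with s v)"

lemma rootI: "g \<in> carrier W \<Longrightarrow> s \<in> S \<Longrightarrow> root (rep g (unit_vec s))"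
  by (auto simp: root_def)

lemma root_unit: "s \<in> S \<Longrightarrow> root (unit_vec s)"
  using rootI[of \<one> s] by simp

lemma root_rep: "g \<in> carrier W \<Longrightarrow> root v \<Longrightarrow> root (rep g v)"
  unfolding root_def by (metis m_closed rep_mult)

lemma rep_scale: "g \<in> carrier W \<Longrightarrow> rep g (\<lambda>x. a * u x) = (\<lambda>x. a * rep g u x)"
  using rep_linear[of g a u 0 u] by simp

lemma rep_zero: "g \<in> carrier W \<Longrightarrow> rep g (\<lambda>x. 0) = (\<lambda>x. 0)"
  using rep_scale[of g 0 "\<lambda>x. 0"] by simp

lemma rep_neg: "g \<in> carrier W \<Longrightarrow> rep g (\<lambda>x. - u x) = (\<lambda>x. - rep g u x)"
  using rep_scale[of g "-1" u] by simp

lemma rep_S_unit: "s \<in> S \<Longrightarrow> rep s (unit_vec s) = (\<lambda>x. - unit_vec s x)"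
  by (auto simp: rep_spec(2) srefl_eq)

lemma rep_mult_S_unit:
  "g \<in> carrier W \<Longrightarrow> s \<in> S \<Longrightarrow> rep (g \<otimes> s) (unit_vec s) = (\<lambda>x. - rep g (unit_vec s) x)"
  by (simp add: rep_S_unit rep_neg)

lemma negative_root:
  assumes "g \<in> carrier W" "s \<in> S" "len (g \<otimes> s) < len g"
  shows "nonpos (rep g (unit_vec s))"
proof
  fix x
  have "len (g \<otimes> s \<otimes> s) > len (g \<otimes> s)" using assms by simp
  then have "rep (g \<otimes> s) (unit_vec s) x \<ge> 0" using assms positive_root[of "g \<otimes> s" s] by simp
  then show "rep g (unit_vec s) x \<le> 0" using assms by (simp add: rep_S_unit rep_neg)
qed

lemma rep_inj: "g \<in> carrier W \<Longrightarrow> rep g u = rep g v \<Longrightarrow> u = v"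
  by (metis rep_inv(1))

lemma root_nonzero: "root v \<Longrightarrow> v \<noteq> (\<lambda>x. 0)"
  unfolding root_def using rep_inj rep_zero by (metis unit_vec_simps(1) zero_neq_one)

lemma root_sign: "root v \<Longrightarrow> nonneg v \<or> nonpos v"
  unfolding root_def using positive_root negative_root len_mult_S by (metis less_add_one)

lemma root_not_both: "root v \<Longrightarrow> nonneg v \<Longrightarrow> \<not> nonpos v"
  using root_nonzero by (metis antisym ext)

lemma root_neg: "root v \<Longrightarrow> root (\<lambda>x. - v x)"
  unfolding root_def using rep_mult_S_unit by (metis S_closed m_closed)

lemma rep_supp:
  assumes J: "J \<subseteq> S" and g: "g \<in> generate W J" and x: "x \<notin> J"
  shows "rep g v x = v x"
  using g
proof (induction arbitrary: v)
  case (incl h)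
  then have "h \<noteq> x" "h \<in> S" using J x by auto
  then show ?case by (simp add: rep_spec(2) srefl_def)
next
  case (inv h)
  then have "h \<noteq> x" "h \<in> S" using J x by auto
  then show ?case by (simp add: rep_spec(2) srefl_def)
next
  case (eng h k)
  have "generate W J \<subseteq> carrier W" using J S_carrier by (intro generate_incl) auto
  then show ?case using eng by (simp add: subset_iff)
qed simp

lemma root_supp: "root v \<Longrightarrow> x \<notin> S \<Longrightarrow> v x = 0"
  unfolding root_def using rep_supp[of S] generate_S by (metis order_refl unit_vec_simps(2))

lemma rep_sum:
  assumes g: "g \<in> carrier W" and J: "finite J"
  shows "rep g (\<lambda>y. \<Sum>x\<in>J. c x * u x y) = (\<lambda>y. \<Sum>x\<in>J. c x * rep g (u x) y)"
  using J
proof induction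
  case empty
  then show ?case using rep_zero[OF g] by simp
next
  case (insert x J)
  then show ?case
    using rep_linear[OF g, of "c x" "u x" 1 "\<lambda>y. \<Sum>x\<in>J. c x * u x y"] by simp
qed

lemma vec_expand:
  assumes "finite J" "\<And>x. x \<notin> J \<Longrightarrow> v x = 0"
  shows "v = (\<lambda>y. \<Sum>x\<in>J. v x * unit_vec x y)"
proof
  fix y
  have "(\<Sum>x\<in>J. v x * unit_vec x y) = (\<Sum>x\<in>J. if x = y then v x else 0)"
    by (rule sum.cong) (auto simp: unit_vec_def)
  also have "\<dots> = v y" using assms by auto
  finally show "v y = (\<Sum>x\<in>J. v x * unit_vec x y)" by simp
qed

lemma rep_expand:
  assumes g: "g \<in> carrier W" and J: "finite J" "\<And>x. x \<notin> J \<Longrightarrow> v x = 0"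
  shows "rep g v y = (\<Sum>x\<in>J. v x * rep g (unit_vec x) y)"
  by (subst vec_expand[OF J], assumption) (simp only: rep_sum[OF g J(1)])

lemma form_with_bil: "s \<in> S \<Longrightarrow> bil (unit_vec s) v = form_with s v"
proof -
  assume s: "s \<in> S"
  have "bil (unit_vec s) v = (\<Sum>t\<in>S. if t = s then form_with t v else 0)"
    unfolding bil_def by (rule sum.cong) (auto simp: unit_vec_def)
  then show ?thesis using s finite_S by simp
qed

lemma bil_sym: "bil u v = bil v u"
proof -
  have "bil u v = (\<Sum>s\<in>S. \<Sum>t\<in>S. u s * cox_form s t * v t)"
    by (simp add: bil_def form_with_def sum_distrib_left mult.assoc)
  also have "\<dots> = (\<Sum>t\<in>S. \<Sum>s\<in>S. u s * cox_form s t * v t)" by (rule sum.swap)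
  also have "\<dots> = (\<Sum>t\<in>S. \<Sum>s\<in>S. v t * cox_form t s * u s)"
    by (intro sum.cong) (auto simp: cox_form_sym)
  also have "\<dots> = bil v u"
    by (simp add: bil_def form_with_def sum_distrib_left mult.assoc)
  finally show ?thesis .
qed

lemma bil_linear_right: "bil u (\<lambda>x. a * v x + b * w x) = a * bil u v + b * bil u w"
  by (simp add: bil_def form_with_linear sum.distrib sum_distrib_left algebra_simps)

lemma bil_linear_left: "bil (\<lambda>x. a * v x + b * w x) u = a * bil v u + b * bil w u"
  using bil_linear_right bil_sym by metis

lemma bil_srefl: "s \<in> S \<Longrightarrow> bil (srefl s u) (srefl s v) = bil u v"
proof -
  assume s: "s \<in> S"
  have e: "srefl s w = (\<lambda>x. 1 * w x + (- 2 * form_with s w) * unit_vec s x)" for w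
    by (simp add: srefl_eq)
  show ?thesis
    unfolding e bil_linear_right unfolding bil_linear_left
    using s bil_sym[of _ "unit_vec s"] by (simp add: form_with_bil)
qed

lemma bil_rep: "g \<in> carrier W \<Longrightarrow> bil (rep g u) (rep g v) = bil u v"
proof (induction arbitrary: u v rule: coxeter_induct)
  case (step h s)
  then show ?case by (simp add: rep_spec(2) bil_srefl)
qed simp

lemma bil_root: "root v \<Longrightarrow> bil v v = 1"
  unfolding root_def using bil_rep form_with_bil form_with_unit cox_form_self by metis

lemma rep_reflection:
  assumes g: "g \<in> carrier W" and s: "s \<in> S"
  shows "rep (g \<otimes> s \<otimes> inv g) v
    = (\<lambda>x. v x - 2 * bil (rep g (unit_vec s)) v * rep g (unit_vec s) x)"
proof -
  have e: "srefl s w = (\<lambda>x. 1 * w x + (- 2 * bil (unit_vec s) w) * unit_vec s x)" for w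
    using s by (simp add: srefl_eq form_with_bil)
  have "rep (g \<otimes> s \<otimes> inv g) v = rep g (srefl s (rep (inv g) v))"
    using g s by (simp add: rep_spec(2))
  also have "\<dots> = (\<lambda>x. v x - 2 * bil (unit_vec s) (rep (inv g) v) * rep g (unit_vec s) x)"
    unfolding e rep_linear[OF g] using g by simp
  also have "bil (unit_vec s) (rep (inv g) v) = bil (rep g (unit_vec s)) v"
    using bil_rep[OF g, of "unit_vec s" "rep (inv g) v"] g by simp
  finally show ?thesis .
qed

text \<open>A nontrivial element has a descent, and the simple root of a descent is made negative,
  hence not fixed.\<close>

theorem rep_faithful:
  assumes g: "g \<in> carrier W" and id: "\<And>s. s \<in> S \<Longrightarrow> rep g (unit_vec s) = unit_vec s"
  shows "g = \<one>"
proof (rule ccontr)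
  assume "g \<noteq> \<one>"
  then obtain s where s: "s \<in> S" "len (g \<otimes> s) + 1 = len g" using descent_exists[OF g] by blast
  then have "nonpos (rep g (unit_vec s))" using negative_root[OF g] by simp
  then show False using id[OF s(1)] by (metis unit_vec_simps(1) not_one_le_zero)
qed

lemma rep_eqI:
  assumes "g \<in> carrier W" "h \<in> carrier W" "\<And>v. rep g v = rep h v"
  shows "g = h"
proof -
  have "inv h \<otimes> g = \<one>" using assms by (intro rep_faithful) auto
  then show ?thesis using assms by (metis inv_closed inv_equality inv_inv)
qed

lemma reflection_eqI:
  assumes "g \<in> carrier W" "h \<in> carrier W" "s \<in> S" "t \<in> S" "rep g (unit_vec s) = rep h (unit_vec t)"
  shows "g \<otimes> s \<otimes> inv g = h \<otimes> t \<otimes> inv h"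
  by (rule rep_eqI) (use assms in \<open>simp_all add: rep_reflection del: rep_mult\<close>)

text \<open>Roots have norm 1, so the only nonnegative multiple of a simple root that is a root is
  the simple root itself.\<close>

lemma positive_multiple_unit:
  assumes v: "root v" "nonneg v" and s: "s \<in> S" and supp: "\<And>x. x \<noteq> s \<Longrightarrow> v x = 0"
  shows "v = unit_vec s"
proof -
  have e: "v = (\<lambda>x. v s * unit_vec s x + 0 * unit_vec s x)"
    using supp by (auto simp: unit_vec_def)
  have "bil v v = v s * v s"
    by (subst (1 2) e) (use s in \<open>simp only: bil_linear_left bil_linear_right form_with_bil form_with_unit cox_form_self, simp\<close>)
  then have "v s = 1" using bil_root[OF v(1)] v(2) by (metis abs_mult_self_eq abs_of_nonneg square_eq_1_iff mult_1 power2_eq_square power_one real_sqrt_abs2 real_sqrt_one)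
  then show ?thesis using e by simp
qed

text \<open>The reflection changes only the coordinate at s, and some other coordinate is positive;
  a root with one positive coordinate is positive.\<close>

lemma srefl_positive:
  assumes v: "root v" "nonneg v" and s: "s \<in> S" and neq: "v \<noteq> unit_vec s"
  shows "nonneg (srefl s v)"
proof -
  obtain x where x: "x \<noteq> s" "v x \<noteq> 0" using positive_multiple_unit[OF v s] neq by blast
  then have "srefl s v x > 0" using v(2) by (simp add: srefl_def less_le)
  moreover have "root (srefl s v)" using root_rep[OF _ v(1), of s] s by (simp add: rep_spec(2))
  ultimately show ?thesis using root_sign by (meson not_less)
qed

subsection \<open>Finite subgroups\<close>

definition inversions :: "'a \<Rightarrow> ('a \<Rightarrow> real) set" where
  "inversions g = {v. root v \<and> nonneg v \<and> nonpos (rep g v)}"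

text \<open>A further letter s contributes at most the root of s, since s permutes the other
  positive roots.\<close>

lemma finite_inversions: "g \<in> carrier W \<Longrightarrow> finite (inversions g)"
proof (induction rule: coxeter_induct)
  case one
  have "inversions \<one> = {}" using root_not_both by (auto simp: inversions_def)
  then show ?case by simp
next
  case (step h s)
  have "inversions (h \<otimes> s) \<subseteq> insert (unit_vec s) (srefl s ` inversions h)"
  proof
    fix v assume v: "v \<in> inversions (h \<otimes> s)"
    then have v1: "root v" "nonneg v" and v2: "nonpos (rep h (srefl s v))"
      using step by (auto simp: inversions_def rep_spec(2))
    show "v \<in> insert (unit_vec s) (srefl s ` inversions h)"
    proof (cases "v = unit_vec s")
      case False
      have "root (srefl s v)" using root_rep[OF _ v1(1), of s] step by (simp add: rep_spec(2))
      then have "srefl s v \<in> inversions h"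
        using srefl_positive[OF v1 step(2) False] v2 by (simp add: inversions_def)
      then show ?thesis using srefl_srefl[OF step(2), of v] by (metis image_eqI insertI2)
    qed simp
  qed
  then show ?case using step by (meson finite_imageI finite_insert finite_subset)
qed

text \<open>A point of the dual space, where the Tits cone lives. The fundamental chamber consists
  of the functionals that are nonnegative on all simple roots.\<close>

definition functional :: "(('a \<Rightarrow> real) \<Rightarrow> real) \<Rightarrow> bool" where
  "functional X \<longleftrightarrow> (\<forall>a u b v. X (\<lambda>x. a * u x + b * v x) = a * X u + b * X v)"

lemma functional_rep: "functional X \<Longrightarrow> g \<in> carrier W \<Longrightarrow> functional (\<lambda>v. X (rep g v))"
  by (simp add: functional_def rep_linear)

lemma functional_neg: "functional X \<Longrightarrow> X (\<lambda>x. - v x) = - X v"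
proof -
  assume "functional X"
  then have "X (\<lambda>x. (-1) * v x + 0 * v x) = (-1) * X v + 0 * X v"
    unfolding functional_def by (elim allE)
  then show ?thesis by simp
qed

lemma functional_sum:
  assumes "functional X" "finite J"
  shows "X (\<lambda>y. \<Sum>x\<in>J. c x * u x y) = (\<Sum>x\<in>J. c x * X (u x))"
proof -
  have f: "X (\<lambda>x. a * u x + b * v x) = a * X u + b * X v" for a b u v
    using assms(1) by (simp add: functional_def)
  show ?thesis using assms(2)
proof induction
  case empty
  from f[of 0 "\<lambda>_. 0" 0 "\<lambda>_. 0"] show ?case by simp
next
  case (insert x J)
  then show ?case using f[of "c x" "u x" 1 "\<lambda>y. \<Sum>x\<in>J. c x * u x y"] by simp
  qed
qed

lemma functional_nonpos:
  assumes X: "functional X" "\<And>s. s \<in> S \<Longrightarrow> X (unit_vec s) \<ge> 0" and v: "root v" "nonpos v"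
  shows "X v \<le> 0"
proof -
  have "X v = X (\<lambda>y. \<Sum>x\<in>S. v x * unit_vec x y)"
    using vec_expand[OF finite_S, of v] root_supp[OF v(1)] by simp
  also have "\<dots> = (\<Sum>x\<in>S. v x * X (unit_vec x))" by (rule functional_sum[OF X(1) finite_S])
  also have "\<dots> \<le> 0" using v(2) X(2) by (intro sum_nonpos mult_nonpos_nonneg) auto
  finally show ?thesis .
qed

lemma functional_srefl:
  assumes "functional X" "X (unit_vec s) = 0"
  shows "X (srefl s v) = X v"
proof -
  have "X (\<lambda>x. 1 * v x + (- 2 * form_with s v) * unit_vec s x) = 1 * X v + (- 2 * form_with s v) * X (unit_vec s)"
    using assms(1) unfolding functional_def by (elim allE)
  then show ?thesis using assms(2) by (simp add: srefl_eq)
qed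

text \<open>If X is negative on a simple root, applying that simple reflection removes this root
  from the set of positive roots with negative value and permutes the rest, so the cardinality of
  the set drops.\<close>

lemma chamber_exists:
  assumes "functional X" "finite {v. root v \<and> nonneg v \<and> X v < 0}"
  shows "\<exists>g\<in>carrier W. \<forall>s\<in>S. X (rep g (unit_vec s)) \<ge> 0"
  using assms
proof (induction "card {v. root v \<and> nonneg v \<and> X v < 0}" arbitrary: X rule: less_induct)
  case less
  show ?case
  proof (cases "\<forall>s\<in>S. X (unit_vec s) \<ge> 0")
    case True
    then show ?thesis by (intro bexI[of _ \<one>]) auto
  next
    case False
    then obtain s where s: "s \<in> S" and neg: "X (unit_vec s) < 0" by force
    let ?N = "\<lambda>X. {v. root v \<and> nonneg v \<and> X v < 0}"
    let ?Y = "\<lambda>v. X (rep s v)"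
    have Y: "functional ?Y" using functional_rep less.prems(1) s by blast
    have es: "unit_vec s \<in> ?N X" using neg root_unit[OF s] by (simp add: unit_vec_def)
    have sub: "srefl s ` ?N ?Y \<subseteq> ?N X - {unit_vec s}"
    proof
      fix w assume "w \<in> srefl s ` ?N ?Y"
      then obtain v where w: "w = srefl s v" and v: "root v" "nonneg v" "X (srefl s v) < 0"
        using s by (auto simp: rep_spec(2))
      have "X (srefl s (unit_vec s)) = - X (unit_vec s)"
        using rep_S_unit[OF s] functional_neg[OF less.prems(1)] by (simp add: rep_spec(2)[OF s])
      then have "v \<noteq> unit_vec s" using v(3) neg by auto
      then have "nonneg w" unfolding w by (rule srefl_positive[OF v(1,2) s])
      moreover have "root w" using root_rep[OF _ v(1), of s] s by (simp add: rep_spec(2) w)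
      moreover have "w \<noteq> unit_vec s"
      proof
        assume "w = unit_vec s"
        then have "v = srefl s (unit_vec s)" using w srefl_srefl[OF s] by metis
        then have "v s = -1" using rep_S_unit[OF s] by (simp add: rep_spec(2)[OF s])
        then show False using v(2) by (metis not_one_le_zero le_minus_one_simps(3))
      qed
      ultimately show "w \<in> ?N X - {unit_vec s}" using v(3) w by auto
    qed
    have inj: "inj_on (srefl s) A" for A using bij_srefl[OF s] by (meson bij_is_inj inj_on_subset subset_UNIV)
    have fin: "finite (?N ?Y)"
      using finite_subset[OF sub] less.prems(2) inj by (meson finite_Diff finite_imageD)
    have "card (?N ?Y) = card (srefl s ` ?N ?Y)" using card_image[OF inj] by metis
    also have "\<dots> \<le> card (?N X - {unit_vec s})" using sub less.prems(2) by (intro card_mono) auto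
    also have "\<dots> < card (?N X)" using es less.prems(2) by (intro card_Diff1_less)
    finally obtain g where "g \<in> carrier W" "\<forall>t\<in>S. X (rep s (rep g (unit_vec t))) \<ge> 0"
      using less.hyps[OF _ Y fin] by blast
    then show ?thesis using s by (intro bexI[of _ "s \<otimes> g"]) auto
  qed
qed

text \<open>A descent s of k gives a negative root, on which X is nonpositive. By invariance X is
  nonpositive on the root of s too, hence zero there. So s fixes X, and it can be stripped off
  k.\<close>

lemma stabilizer_parabolic:
  assumes X: "functional X" "\<And>s. s \<in> S \<Longrightarrow> X (unit_vec s) \<ge> 0"
    and k: "k \<in> carrier W" "\<And>v. X (rep k v) = X v"
  shows "k \<in> generate W {s \<in> S. X (unit_vec s) = 0}"
  using k
proof (induction "len k" arbitrary: k rule: less_induct)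
  case less
  show ?case
  proof (cases "k = \<one>")
    case True
    then show ?thesis by (simp add: generate.one)
  next
    case False
    then obtain s where s: "s \<in> S" "len (k \<otimes> s) + 1 = len k"
      using descent_exists[OF less.prems(1)] by blast
    have "X (rep k (unit_vec s)) \<le> 0"
      using s less.prems(1) by (intro functional_nonpos X negative_root rootI) auto
    then have z: "X (unit_vec s) = 0" using X(2)[OF s(1)] less.prems(2) by simp
    have "k \<otimes> s \<in> generate W {s \<in> S. X (unit_vec s) = 0}"
      using s less.prems functional_srefl[OF X(1) z] by (intro less.hyps) (auto simp: rep_spec(2))
    moreover have "s \<in> generate W {s \<in> S. X (unit_vec s) = 0}" using s z by (intro generate.incl) auto
    ultimately have "k \<otimes> s \<otimes> s \<in> generate W {s \<in> S. X (unit_vec s) = 0}" by (rule generate.eng)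
    then show ?thesis using s less.prems by simp
  qed
qed

lemma generate_closed: "J \<subseteq> S \<Longrightarrow> g \<in> generate W J \<Longrightarrow> g \<in> carrier W"
  using generate_incl[of J] S_carrier by blast

lemma generate_inv: "J \<subseteq> S \<Longrightarrow> g \<in> generate W J \<Longrightarrow> inv g \<in> generate W J"
  using generate_m_inv_closed S_carrier by blast

text \<open>Tits's theorem, in a form that records finite orders for all pairs of T. An F-invariant
  functional is moved into the fundamental chamber, where its stabilizer is the parabolic subgroup
  of the simple roots it kills. A pair of infinite order among these would yield infinitely many
  roots killed by X, but X is positive on all but finitely many positive roots.\<close>

theorem finite_subgroup_parabolic:
  assumes F: "subgroup F W" "finite F"
  obtains g T where "g \<in> carrier W" "T \<subseteq> S"
    "\<And>s t. s \<in> T \<Longrightarrow> t \<in> T \<Longrightarrow> ord (s \<otimes> t) \<noteq> 0"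
    "\<And>h. h \<in> F \<Longrightarrow> inv g \<otimes> h \<otimes> g \<in> generate W T"
proof -
  have Fc: "h \<in> carrier W" if "h \<in> F" for h using F(1) that subgroup.subset by blast
  define X where "X v = (\<Sum>h\<in>F. \<Sum>s\<in>S. rep h v s)" for v
  have X: "functional X"
    unfolding functional_def X_def
    by (simp add: rep_linear Fc sum.distrib sum_distrib_left)
  have inv: "X (rep k v) = X v" if k: "k \<in> F" for k v
  proof -
    have kc: "k \<in> carrier W" using Fc k .
    have bij: "bij_betw (\<lambda>h. h \<otimes> k) F F"
    proof (rule bij_betwI[of _ _ _ "\<lambda>h. h \<otimes> inv k"])
      show "(\<lambda>h. h \<otimes> k) \<in> F \<rightarrow> F" "(\<lambda>h. h \<otimes> inv k) \<in> F \<rightarrow> F"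
        using F(1) k by (auto intro: subgroup.m_closed subgroup.m_inv_closed)
    qed (use Fc kc in \<open>auto simp: m_assoc\<close>)
    have "X (rep k v) = (\<Sum>h\<in>F. \<Sum>s\<in>S. rep (h \<otimes> k) v s)"
      unfolding X_def using Fc kc by (intro sum.cong refl) simp
    also have "\<dots> = X v"
      unfolding X_def by (rule sum.reindex_bij_betw[OF bij, of "\<lambda>h. \<Sum>s\<in>S. rep h v s"])
    finally show ?thesis .
  qed
  \<comment> \<open>The zeros of X are included. For moving X into the chamber the negative values
    are enough; the zeros bound the roots in the stabilizer.\<close>
  define A where "A = {v. root v \<and> nonneg v \<and> X v \<le> 0}"
  have "A \<subseteq> (\<Union>h\<in>F. inversions h)"
  proof
    fix v assume "v \<in> A"
    then have v: "root v" "nonneg v" "X v \<le> 0" by (auto simp: A_def)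
    show "v \<in> (\<Union>h\<in>F. inversions h)"
    proof (rule ccontr)
      assume "v \<notin> (\<Union>h\<in>F. inversions h)"
      then have "\<not> nonpos (rep h v)" if "h \<in> F" for h
        using that v by (auto simp: inversions_def)
      then have nn: "nonneg (rep h v)" if "h \<in> F" for h
        using that root_sign[OF root_rep[OF Fc[OF that] v(1)]] by blast
      obtain x where x: "v x \<noteq> 0" using root_nonzero[OF v(1)] by blast
      then have xS: "x \<in> S" using root_supp[OF v(1)] by blast
      have "(\<Sum>s\<in>S. v s) > 0"
        using x xS v(2) finite_S by (intro sum_pos2[of S x]) (auto simp: less_le)
      then have "X v > 0"
        unfolding X_def using F nn subgroup.one_closed[OF F(1)]
        by (intro sum_pos2[of F \<one>] sum_nonneg) auto
      then show False using v(3) by simp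
    qed
  qed
  moreover have "finite (\<Union>h\<in>F. inversions h)" using F(2) finite_inversions Fc by blast
  ultimately have finA: "finite A" by (rule finite_subset)
  have "{v. root v \<and> nonneg v \<and> X v < 0} \<subseteq> A" by (auto simp: A_def)
  then have "finite {v. root v \<and> nonneg v \<and> X v < 0}" using finA finite_subset by blast
  then obtain g where g: "g \<in> carrier W" "\<And>s. s \<in> S \<Longrightarrow> X (rep g (unit_vec s)) \<ge> 0"
    using chamber_exists[OF X] by blast
  let ?Y = "\<lambda>v. X (rep g v)"
  have Y: "functional ?Y" by (rule functional_rep[OF X g(1)])
  let ?T = "{s \<in> S. ?Y (unit_vec s) = 0}"
  have "inv g \<otimes> h \<otimes> g \<in> generate W ?T" if h: "h \<in> F" for h
    using inv[OF h] g(1) Fc[OF h] by (intro stabilizer_parabolic[OF Y g(2)]) auto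
  moreover have "ord (s \<otimes> t) \<noteq> 0" if s: "s \<in> ?T" and t: "t \<in> ?T" for s t
  proof
    assume o: "ord (s \<otimes> t) = 0"
    interpret involution_pair W s t using s t by (intro S_pair) auto
    have st: "s \<in> S" "t \<in> S" using s t by auto
    \<comment> \<open>The images of the root of s under the powers of s t, transported by g. X
      vanishes on all of them, so they lie in A up to sign, and for infinite order they are pairwise
      distinct.\<close>
    define \<gamma> where "\<gamma> n = rep (g \<otimes> (s \<otimes> t) [^] (n::nat)) (unit_vec s)" for n
    have Yn: "?Y (rep ((s \<otimes> t) [^] (n::nat)) v) = ?Y v" for n v
    proof (induction n arbitrary: v)
      case (Suc n)
      have "rep ((s \<otimes> t) [^] Suc n) v = rep ((s \<otimes> t) [^] n) (srefl s (srefl t v))"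
        using st by (simp add: rep_spec(2))
      then show ?case using Suc functional_srefl[OF Y] s t by simp
    qed simp
    have "\<gamma> n \<in> A \<union> (\<lambda>v x. - v x) ` A" for n
    proof -
      have X0: "X (\<gamma> n) = 0" using Yn[of n "unit_vec s"] s g(1) st by (simp add: \<gamma>_def)
      have r: "root (\<gamma> n)" unfolding \<gamma>_def using g(1) st by (intro rootI) auto
      show ?thesis
      proof (cases "nonneg (\<gamma> n)")
        case True
        then show ?thesis using r X0 by (simp add: A_def)
      next
        case False
        then have "nonpos (\<gamma> n)" using root_sign[OF r] by blast
        then have "(\<lambda>x. - \<gamma> n x) \<in> A"
          using root_neg[OF r] functional_neg[OF X, of "\<gamma> n"] X0 by (simp add: A_def)
        then have "(\<lambda>v x. - v x) (\<lambda>x. - \<gamma> n x) \<in> (\<lambda>v x. - v x) ` A" by (rule imageI)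
        then show ?thesis by simp
      qed
    qed
    then have "finite (range \<gamma>)" using finA by (meson finite_UnI finite_imageI finite_subset image_subsetI)
    then obtain m n where mn: "m \<noteq> n" "\<gamma> m = \<gamma> n" using finite_imageD[of \<gamma> UNIV] by (auto simp: inj_on_def)
    have k: "(g \<otimes> (s \<otimes> t) [^] n) \<otimes> s \<otimes> inv (g \<otimes> (s \<otimes> t) [^] n)
        = g \<otimes> (c [^] (2 * int n) \<otimes> s) \<otimes> inv g" for n :: nat
      using rot_conj[of "int n"] conj_mult[of g "(s \<otimes> t) [^] n" s] g(1) st by (simp add: int_pow_int)
    have "g \<otimes> (c [^] (2 * int m) \<otimes> s) \<otimes> inv g = g \<otimes> (c [^] (2 * int n) \<otimes> s) \<otimes> inv g"
      unfolding k[symmetric] using mn(2) g(1) st by (intro reflection_eqI) (auto simp: \<gamma>_def)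
    then have "c [^] (2 * int m) \<otimes> s = c [^] (2 * int n) \<otimes> s"
      using g(1) by simp
    then show False unfolding rot_eq_iff o using mn(1) by simp
  qed
  moreover have "?T \<subseteq> S" by blast
  ultimately show thesis using that[OF g(1)] by blast
qed

subsection \<open>Parabolic subgroups\<close>

text \<open>A simple root spans an extremal ray of the cone of nonnegative vectors, so every summand
  with positive coefficient lies on that ray, and roots on it coincide.\<close>

lemma nonneg_combination_unit:
  assumes J: "finite J" and c: "\<And>x. x \<in> J \<Longrightarrow> c x \<ge> 0"
    and u: "\<And>x. x \<in> J \<Longrightarrow> root (u x)" "\<And>x. x \<in> J \<Longrightarrow> nonneg (u x)"
    and s: "s \<in> S" and e: "\<And>y. unit_vec s y = (\<Sum>x\<in>J. c x * u x y)"
    and x: "x \<in> J" "c x > 0"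
  shows "u x = unit_vec s"
proof (rule positive_multiple_unit[OF u(1)[OF x(1)] u(2)[OF x(1)] s])
  fix y assume "y \<noteq> s"
  then have "(\<Sum>x\<in>J. c x * u x y) = 0" using e[of y] by simp
  then have "c x * u x y = 0"
    using sum_nonneg_eq_0_iff[OF J, of "\<lambda>x. c x * u x y"] c u(2) x(1) by simp
  then show "u x y = 0" using x(2) by simp
qed

lemma parabolic_descent:
  assumes J: "J \<subseteq> S" and g: "g \<in> generate W J" "g \<noteq> \<one>"
  obtains x where "x \<in> J" "nonpos (rep g (unit_vec x))"
proof -
  have gc: "g \<in> carrier W" using generate_closed J g(1) .
  obtain s where s: "s \<in> S" "len (g \<otimes> s) + 1 = len g" using descent_exists[OF gc g(2)] by blast
  then have n: "nonpos (rep g (unit_vec s))" using negative_root[OF gc] by simp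
  then have "s \<in> J" using rep_supp[OF J g(1), of s "unit_vec s"] by (metis not_one_le_zero unit_vec_simps(1))
  then show thesis using that n by blast
qed

lemma unit_not_nonpos: "\<not> nonpos (unit_vec (s::'a))"
  by (metis not_one_le_zero unit_vec_simps(1))

text \<open>Replace g by the shortest element g0 of the coset W_J g; then inv g0 keeps the simple
  roots of J positive. The root \<beta> of the conjugated reflection is supported on J, so applying
  inv g0 writes the root of s as a combination of positive roots. Extremality identifies it with the
  image of one simple root of J.\<close>

lemma parabolic_reflection:
  assumes J: "J \<subseteq> S" and g: "g \<in> carrier W" and s: "s \<in> S"
    and r: "g \<otimes> s \<otimes> inv g \<in> generate W J"
  obtains h x where "h \<in> generate W J" "x \<in> J" "g \<otimes> s \<otimes> inv g = h \<otimes> x \<otimes> inv h"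
proof -
  note Jc = generate_closed[OF J]
  obtain k where k: "k \<in> generate W J" and kmin: "\<And>h. h \<in> generate W J \<Longrightarrow> len (k \<otimes> g) \<le> len (h \<otimes> g)"
    using ex_has_least_nat[of "\<lambda>k. k \<in> generate W J" \<one> "\<lambda>k. len (k \<otimes> g)"] generate.one by blast
  define g0 where "g0 = k \<otimes> g"
  have g0: "g0 \<in> carrier W" using g Jc[OF k] by (simp add: g0_def)
  have pos: "nonneg (rep (inv g0) (unit_vec x))" if x: "x \<in> J" for x
  proof -
    have xS: "x \<in> S" using x J by blast
    have "x \<otimes> k \<in> generate W J" by (rule generate.eng[OF generate.incl[OF x] k])
    then have "len g0 \<le> len (x \<otimes> g0)"
      using kmin[of "x \<otimes> k"] g Jc[OF k] xS by (simp add: g0_def m_assoc)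
    moreover have "inv (x \<otimes> g0) = inv g0 \<otimes> x" using g0 xS by (simp add: inv_mult_group)
    then have "len (inv g0 \<otimes> x) = len (x \<otimes> g0)" using len_inv[of "x \<otimes> g0"] g0 xS by simp
    ultimately have "len (inv g0 \<otimes> x) > len (inv g0)"
      using len_mult_S[of "inv g0" x] g0 xS by auto
    then show ?thesis using positive_root[of "inv g0" x] g0 xS by simp
  qed
  let ?f = "g0 \<otimes> s \<otimes> inv g0"
  have f_eq: "?f = k \<otimes> (g \<otimes> s \<otimes> inv g) \<otimes> inv k"
    unfolding g0_def using conj_mult[of k g s] g s Jc[OF k] by simp
  then have f: "?f \<in> generate W J"
    using k r generate_inv[OF J k] by (simp only: generate.eng)
  have "?f \<noteq> \<one>" using conj_one_iff[OF g0, of s] S_nontrivial s by auto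
  then obtain z where z: "z \<in> S" "rep ?f (unit_vec z) \<noteq> unit_vec z"
    using rep_faithful[of ?f] g0 s by auto
  define \<beta> where "\<beta> = rep g0 (unit_vec s)"
  have \<beta>root: "root \<beta>" unfolding \<beta>_def using g0 s by (rule rootI)
  have fz: "rep ?f (unit_vec z) = (\<lambda>x. unit_vec z x - 2 * bil \<beta> (unit_vec z) * \<beta> x)"
    unfolding \<beta>_def by (rule rep_reflection[OF g0 s])
  then have nz: "bil \<beta> (unit_vec z) \<noteq> 0" using z(2) by auto
  \<comment> \<open>A vector not fixed by the reflection moves by a nonzero multiple of \<beta>,
    while an element of W_J changes no coordinate outside J.\<close>
  have supp: "\<beta> y = 0" if "y \<notin> J" for y
    using rep_supp[OF J f that, of "unit_vec z"] nz unfolding fz by simp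
  have finJ: "finite J" using J finite_S finite_subset by blast
  have inv\<beta>: "rep (inv g0) \<beta> = unit_vec s" unfolding \<beta>_def using g0 by simp
  have e: "unit_vec s y = (\<Sum>x\<in>J. \<beta> x * rep (inv g0) (unit_vec x) y)" for y
    unfolding inv\<beta>[symmetric] using rep_expand[OF _ finJ supp, of "inv g0"] g0 by simp
  have "nonneg \<beta>"
  proof (rule ccontr)
    assume "\<not> nonneg \<beta>"
    then have "nonpos \<beta>" using root_sign[OF \<beta>root] by blast
    then have "nonpos (unit_vec s)"
      unfolding e using pos by (intro allI sum_nonpos mult_nonpos_nonneg) auto
    then show False by (rule notE[OF unit_not_nonpos])
  qed
  obtain x where x: "\<beta> x \<noteq> 0" using root_nonzero[OF \<beta>root] by blast
  then have xJ: "x \<in> J" using supp by blast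
  have xS: "x \<in> S" using xJ J by blast
  have "rep (inv g0) (unit_vec x) = unit_vec s"
  proof (rule nonneg_combination_unit[OF finJ _ _ _ s e xJ])
    show "\<beta> x > 0" using x \<open>nonneg \<beta>\<close> by (simp add: less_le)
  qed (use \<open>nonneg \<beta>\<close> pos g0 J in \<open>auto intro!: rootI\<close>)
  then have "rep g0 (unit_vec s) = rep \<one> (unit_vec x)" using g0 by (metis rep_inv(2) rep_one)
  then have "?f = \<one> \<otimes> x \<otimes> inv \<one>" using g0 s xS by (intro reflection_eqI) auto
  then have "x = k \<otimes> (g \<otimes> s \<otimes> inv g) \<otimes> inv k" using f_eq xS by simp
  then have "g \<otimes> s \<otimes> inv g = inv k \<otimes> x \<otimes> inv (inv k)"
    using conj_inv_cancel(1)[OF Jc[OF k], of "g \<otimes> s \<otimes> inv g"] g s Jc[OF k] by simp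
  then show thesis using that[OF generate_inv[OF J k] xJ] by blast
qed

text \<open>The rank two step behind Deodhar's description. Write w = w1 h with w1 shortest in the
  coset of the dihedral subgroup of x and t, so that w1 keeps both simple roots positive. The image
  of the root of x under h is a combination of these two roots which w1 carries to a simple root; by
  extremality it is one of the two itself, and the shorter w1 again carries a simple root to a
  simple root.\<close>

theorem simple_to_simple:
  assumes w: "w \<in> carrier W" and x: "x \<in> S" and y: "y \<in> S" and t: "t \<in> S"
    and wx: "rep w (unit_vec x) = unit_vec y" and wt: "nonpos (rep w (unit_vec t))"
  obtains h where "h \<in> generate W {x, t}" "h \<noteq> \<one>"
    "rep h (unit_vec x) = unit_vec x \<or> rep h (unit_vec x) = unit_vec t"
    "len (w \<otimes> inv h) < len w" "ord (x \<otimes> t) \<noteq> 0"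
proof -
  have neq: "x \<noteq> t" using wx wt unit_not_nonpos by metis
  have J: "{x, t} \<subseteq> S" using x t by auto
  note Jc = generate_closed[OF J]
  obtain h where h: "h \<in> generate W {x, t}"
    and hmin: "\<And>k. k \<in> generate W {x, t} \<Longrightarrow> len (w \<otimes> inv h) \<le> len (w \<otimes> inv k)"
    using ex_has_least_nat[of "\<lambda>k. k \<in> generate W {x, t}" \<one> "\<lambda>k. len (w \<otimes> inv k)"] generate.one by blast
  define w1 where "w1 = w \<otimes> inv h"
  have w1: "w1 \<in> carrier W" using w Jc[OF h] by (simp add: w1_def)
  have w_eq: "w = w1 \<otimes> h" using w Jc[OF h] by (simp add: w1_def m_assoc)
  have pos: "nonneg (rep w1 (unit_vec z))" if z: "z \<in> {x, t}" for z
  proof -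
    have zS: "z \<in> S" using z J by blast
    have "z \<otimes> h \<in> generate W {x, t}" by (rule generate.eng[OF generate.incl[OF z] h])
    moreover have "w \<otimes> inv (z \<otimes> h) = w1 \<otimes> z"
      using w Jc[OF h] zS by (simp add: w1_def inv_mult_group m_assoc)
    ultimately have "len w1 \<le> len (w1 \<otimes> z)" using hmin[of "z \<otimes> h"] by (simp add: w1_def)
    then have "len (w1 \<otimes> z) > len w1" using len_mult_S[OF w1 zS] by auto
    then show ?thesis using positive_root[OF w1 zS] by simp
  qed
  have h1: "h \<noteq> \<one>"
  proof
    assume "h = \<one>"
    then have "nonneg (rep w (unit_vec t))" using pos[of t] w by (simp add: w1_def)
    then show False using wt root_not_both[OF rootI[OF w t]] by blast
  qed
  have "len (w \<otimes> t) < len w"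
  proof (rule ccontr)
    assume "\<not> len (w \<otimes> t) < len w"
    then have "len (w \<otimes> t) > len w" using len_mult_S[OF w t] by auto
    then have "nonneg (rep w (unit_vec t))" using positive_root[OF w t] by simp
    then show False using wt root_not_both[OF rootI[OF w t]] by blast
  qed
  moreover have "len w1 \<le> len (w \<otimes> inv t)"
    unfolding w1_def by (rule hmin) (auto intro: generate.incl)
  ultimately have lt: "len (w \<otimes> inv h) < len w" using t by (simp add: w1_def)
  define \<beta> where "\<beta> = rep h (unit_vec x)"
  have \<beta>root: "root \<beta>" unfolding \<beta>_def using Jc[OF h] x by (rule rootI)
  have supp: "\<beta> z = 0" if "z \<notin> {x, t}" for z
    unfolding \<beta>_def using rep_supp[OF J h that] that by simp
  have w1\<beta>: "rep w1 \<beta> = unit_vec y"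
    using wx w1 Jc[OF h] by (simp add: \<beta>_def w_eq)
  have e: "unit_vec y z = (\<Sum>u\<in>{x, t}. \<beta> u * rep w1 (unit_vec u) z)" for z
    unfolding w1\<beta>[symmetric] by (rule rep_expand[OF w1]) (use supp in auto)
  have nn: "nonneg \<beta>"
  proof (rule ccontr)
    assume "\<not> nonneg \<beta>"
    then have "nonpos \<beta>" using root_sign[OF \<beta>root] by blast
    then have "nonpos (unit_vec y)"
      unfolding e using pos by (intro allI sum_nonpos mult_nonpos_nonneg) auto
    then show False by (rule notE[OF unit_not_nonpos])
  qed
  have ue: "rep w1 (unit_vec u) = unit_vec y" if u: "u \<in> {x, t}" "\<beta> u \<noteq> 0" for u
  proof (rule nonneg_combination_unit[OF _ _ _ _ y e u(1)])
    show "\<beta> u > 0" using u nn by (simp add: less_le)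
  qed (use nn pos w1 J in \<open>auto intro!: rootI\<close>)
  \<comment> \<open>Two nonzero coordinates would make w1 send both simple roots to the root of y,
    against injectivity.\<close>
  have "\<beta> x = 0 \<or> \<beta> t = 0"
  proof (rule ccontr)
    assume "\<not> (\<beta> x = 0 \<or> \<beta> t = 0)"
    then have "rep w1 (unit_vec x) = rep w1 (unit_vec t)" using ue[of x] ue[of t] by simp
    then show False using rep_inj[OF w1] neq by (metis unit_vec_inject)
  qed
  then have \<beta>: "\<beta> = unit_vec x \<or> \<beta> = unit_vec t"
  proof
    assume "\<beta> x = 0"
    then have "\<beta> z = 0" if "z \<noteq> t" for z using supp[of z] that by (cases "z = x") auto
    then show ?thesis using positive_multiple_unit[OF \<beta>root nn t] by simp
  next
    assume "\<beta> t = 0"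
    then have "\<beta> z = 0" if "z \<noteq> x" for z using supp[of z] that by (cases "z = t") auto
    then show ?thesis using positive_multiple_unit[OF \<beta>root nn x] by simp
  qed
  \<comment> \<open>In an infinite dihedral group only 1 and x conjugate x into {x, t}; h is not 1,
    and x makes its own root negative.\<close>
  have "ord (x \<otimes> t) \<noteq> 0"
  proof
    assume o: "ord (x \<otimes> t) = 0"
    interpret involution_pair W x t using x t by (rule S_pair)
    have "h \<otimes> x \<otimes> inv h = \<one> \<otimes> x \<otimes> inv \<one> \<or> h \<otimes> x \<otimes> inv h = \<one> \<otimes> t \<otimes> inv \<one>"
      using \<beta> reflection_eqI[of h \<one> x x] reflection_eqI[of h \<one> x t] Jc[OF h] x t by (auto simp: \<beta>_def)
    then have "h \<otimes> x \<otimes> inv h \<in> {x, t}" by simp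
    then have "h = x" using infinite_no_conj[OF o h] h1 by blast
    then have "nonpos \<beta>" using rep_S_unit[OF x] by (simp add: \<beta>_def unit_vec_def)
    then show False using \<beta> unit_not_nonpos by auto
  qed
  then show thesis using that[OF h h1 _ lt] \<beta> by (simp add: \<beta>_def)
qed

end

section \<open>Odd pairs with a leaf\<close>

context coxeter
begin

text \<open>The common reflection negates \<beta> and moves every vector along \<gamma>, so the two
  are proportional, and both have norm 1.\<close>

lemma reflection_root_unique:
  assumes g: "g \<in> carrier W" and h: "h \<in> carrier W" and s: "s \<in> S" and t: "t \<in> S"
    and eq: "g \<otimes> s \<otimes> inv g = h \<otimes> t \<otimes> inv h"
  shows "rep g (unit_vec s) = rep h (unit_vec t) \<or> rep g (unit_vec s) = (\<lambda>x. - rep h (unit_vec t) x)"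
proof -
  define \<beta> where "\<beta> = rep g (unit_vec s)"
  define \<gamma> where "\<gamma> = rep h (unit_vec t)"
  have \<beta>: "bil \<beta> \<beta> = 1" and \<gamma>: "bil \<gamma> \<gamma> = 1"
    unfolding \<beta>_def \<gamma>_def using g h s t by (auto intro!: bil_root rootI)
  have "rep (g \<otimes> s \<otimes> inv g) \<beta> = rep (h \<otimes> t \<otimes> inv h) \<beta>" by (simp only: eq)
  then have e: "(\<lambda>x. \<beta> x - 2 * bil \<beta> \<beta> * \<beta> x) = (\<lambda>x. \<beta> x - 2 * bil \<gamma> \<beta> * \<gamma> x)"
    unfolding rep_reflection[OF g s] rep_reflection[OF h t] \<beta>_def[symmetric] \<gamma>_def[symmetric] .
  have b: "\<beta> x = bil \<gamma> \<beta> * \<gamma> x" for x using fun_cong[OF e, of x] \<beta> by simp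
  then have "\<beta> = (\<lambda>x. bil \<gamma> \<beta> * \<gamma> x + 0 * \<gamma> x)" by auto
  then have "bil \<gamma> \<beta> * bil \<gamma> \<beta> = 1"
    using \<beta> bil_linear_left[of "bil \<gamma> \<beta>" \<gamma> 0 \<gamma> \<beta>] by simp
  then have "bil \<gamma> \<beta> = 1 \<or> bil \<gamma> \<beta> = -1" using square_eq_1_iff by blast
  then show ?thesis using b unfolding \<beta>_def[symmetric] \<gamma>_def[symmetric] by auto
qed

end

text \<open>The local picture at an odd pair whose second member t is a leaf. T is meant to be s
  with its finite neighbours other than t. Since s s and t t have order 1, the neighbour sets
  contain s and t themselves.\<close>

locale odd_pair = coxeter +
  fixes s t T
  assumes s [simp]: "s \<in> S" and t [simp]: "t \<in> S" and s_neq_t: "s \<noteq> t"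
    and odd_ord: "odd (ord (s \<otimes> t))"
    and pair_class: "\<And>x. x \<in> S \<Longrightarrow> conjugate s x \<Longrightarrow> x \<in> {s, t}"
    and T: "T \<subseteq> S" "s \<in> T" "t \<notin> T" "finite (generate W T)"
    and neighbours_s: "\<And>x. x \<in> S \<Longrightarrow> ord (s \<otimes> x) \<noteq> 0 \<Longrightarrow> x \<in> insert t T"
    and neighbours_t: "\<And>x. x \<in> S \<Longrightarrow> ord (t \<otimes> x) \<noteq> 0 \<Longrightarrow> x \<in> {s, t}"
    and T_classes: "\<And>x y. x \<in> T \<Longrightarrow> y \<in> T \<Longrightarrow> conjugate x y \<Longrightarrow> x = y"
begin

lemma st_subset: "{s, t} \<subseteq> S" by simp

lemma T_closed: "g \<in> generate W T \<Longrightarrow> g \<in> carrier W"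
  using generate_closed T(1) by blast

lemma st_closed: "g \<in> generate W {s, t} \<Longrightarrow> g \<in> carrier W"
  using generate_closed st_subset by blast

lemma subgroup_T: "subgroup (generate W T) W" and subgroup_st: "subgroup (generate W {s, t}) W"
  using T(1) S_carrier by (auto intro!: generate_is_subgroup)

text \<open>For odd order the centralizer of s in the dihedral group is {1, s}, and s negates its
  root.\<close>

lemma st_fix_unit:
  assumes h: "h \<in> generate W {s, t}" and e: "rep h (unit_vec s) = unit_vec s"
  shows "h = \<one>"
proof -
  interpret P: involution_pair W s t by (rule S_pair) auto
  have "h \<otimes> s \<otimes> inv h = \<one> \<otimes> s \<otimes> inv \<one>" using e st_closed[OF h] by (intro reflection_eqI) auto
  then have "h = \<one> \<or> h = s" using P.odd_centralizer[OF odd_ord h] by simp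
  moreover have "h \<noteq> s"
  proof
    assume "h = s"
    then have "(\<lambda>x. - unit_vec s x) = unit_vec s" using e rep_S_unit[OF s] by simp
    from fun_cong[OF this, of s] show False by simp
  qed
  ultimately show ?thesis by blast
qed

text \<open>An element of the dihedral group conjugating s to t carries the root of s to that of t
  only up to sign; a right factor s corrects the sign.\<close>

definition transporter :: 'a where
  "transporter = (SOME d. d \<in> generate W {s, t} \<and> rep d (unit_vec s) = unit_vec t)"

lemma transporter: "transporter \<in> generate W {s, t}" "rep transporter (unit_vec s) = unit_vec t"
proof -
  interpret P: involution_pair W s t by (rule S_pair) auto
  obtain d where d: "d \<in> generate W {s, t}" "t = d \<otimes> s \<otimes> inv d"
    using P.odd_conjugate[OF odd_ord] by blast
  have "\<exists>d. d \<in> generate W {s, t} \<and> rep d (unit_vec s) = unit_vec t"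
  proof -
    have "d \<otimes> s \<otimes> inv d = \<one> \<otimes> t \<otimes> inv \<one>" unfolding d(2)[symmetric] by simp
    then have "rep d (unit_vec s) = rep \<one> (unit_vec t) \<or> rep d (unit_vec s) = (\<lambda>x. - rep \<one> (unit_vec t) x)"
      using st_closed[OF d(1)] by (intro reflection_root_unique) auto
    then show ?thesis
    proof
      assume "rep d (unit_vec s) = (\<lambda>x. - rep \<one> (unit_vec t) x)"
      then have "rep (d \<otimes> s) (unit_vec s) = unit_vec t"
        using rep_mult_S_unit[OF st_closed[OF d(1)] s] by simp
      moreover have "d \<otimes> s \<in> generate W {s, t}" using d(1) P.a_in by (rule generate.eng)
      ultimately show ?thesis by blast
    qed (use d in auto)
  qed
  from someI_ex[OF this] show "transporter \<in> generate W {s, t}" "rep transporter (unit_vec s) = unit_vec t"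
    unfolding transporter_def by auto
qed

definition to_class :: "'a \<Rightarrow> 'a" where
  "to_class x = (if x = s then \<one> else transporter)"

lemma to_class:
  assumes "x \<in> {s, t}"
  shows "to_class x \<in> generate W {s, t}" "rep (to_class x) (unit_vec s) = unit_vec x"
  using assms transporter generate.one by (auto simp: to_class_def)

lemma to_class_closed [simp]: "to_class x \<in> carrier W"
  using transporter(1) st_closed by (auto simp: to_class_def)

lemma conjugate_of_rep:
  assumes "w \<in> carrier W" "x \<in> S" "y \<in> S" "rep w (unit_vec x) = unit_vec y"
  shows "conjugate x y"
proof -
  have "w \<otimes> x \<otimes> inv w = \<one> \<otimes> y \<otimes> inv \<one>" using assms by (intro reflection_eqI) auto
  then have "y = w \<otimes> x \<otimes> inv w" using assms by simp
  then show ?thesis using assms(1) by (auto simp: conjugate_def)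
qed

lemma in_pair:
  assumes "w \<in> carrier W" "x \<in> {s, t}" "y \<in> S" "rep w (unit_vec x) = unit_vec y"
  shows "y \<in> {s, t}"
proof -
  have "conjugate s x" using to_class(2)[OF assms(2)] assms(2) by (intro conjugate_of_rep[of "to_class x"]) auto
  moreover have "conjugate x y" using assms by (intro conjugate_of_rep) auto
  ultimately have "conjugate s y" by (rule conjugate_trans[OF S_closed[OF s]])
  then show ?thesis by (rule pair_class[OF assms(3)])
qed

text \<open>Decompose into rank two steps with \<open>simple_to_simple\<close>: a step along a finite edge at s stays in
  the parabolic subgroup of T, and a step along the odd edge is unique, as only the identity of an odd
  dihedral group fixes a simple root.\<close>

lemma unit_to_unit:
  assumes "w \<in> carrier W" "x \<in> {s, t}" "y \<in> S" "rep w (unit_vec x) = unit_vec y"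
  shows "inv (to_class y) \<otimes> w \<otimes> to_class x \<in> generate W T"
  using assms
proof (induction "len w" arbitrary: w x rule: less_induct)
  case less
  note w = less.prems(1) and x = less.prems(2) and y = less.prems(3)
  have xS: "x \<in> S" using x by auto
  show ?case
  proof (cases "w = \<one>")
    case True
    then have "x = y" using less.prems(4) by simp
    then show ?thesis using True by (simp add: generate.one)
  next
    case False
    have "w \<in> generate W S" using w generate_S by simp
    then obtain z where z: "z \<in> S" "nonpos (rep w (unit_vec z))"
      using parabolic_descent[OF order_refl _ False] by blast
    obtain h where h: "h \<in> generate W {x, z}" "h \<noteq> \<one>"
      and hx: "rep h (unit_vec x) = unit_vec x \<or> rep h (unit_vec x) = unit_vec z"
      and lt: "len (w \<otimes> inv h) < len w" and ord: "ord (x \<otimes> z) \<noteq> 0"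
      using simple_to_simple[OF w xS y z(1) less.prems(4) z(2)] by blast
    have xz: "x \<noteq> z" using z(2) less.prems(4) unit_not_nonpos by metis
    have hc: "h \<in> carrier W" using h(1) xS z(1) generate_closed[of "{x, z}"] by auto
    obtain v where v: "v \<in> {x, z}" "rep h (unit_vec x) = unit_vec v" using hx by blast
    have vS: "v \<in> S" using v(1) xS z(1) by auto
    have v_pair: "v \<in> {s, t}" by (rule in_pair[OF hc x vS v(2)])
    have "rep (w \<otimes> inv h) (unit_vec v) = unit_vec y"
      using less.prems(4) hc w v(2)[symmetric] by simp
    then have IH: "inv (to_class y) \<otimes> (w \<otimes> inv h) \<otimes> to_class v \<in> generate W T"
      using less.hyps[OF lt _ v_pair y] w hc by simp
    have step: "inv (to_class v) \<otimes> h \<otimes> to_class x \<in> generate W T"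
    proof (cases "z \<in> {s, t}")
      case True
      have "{x, z} \<subseteq> {s, t}" using x True by auto
      then have "h \<in> generate W {s, t}" using h(1) mono_generate by blast
      then have k: "inv (to_class v) \<otimes> h \<otimes> to_class x \<in> generate W {s, t}"
        using to_class(1)[OF x] to_class(1)[OF v_pair] subgroup_st
        by (intro subgroup.m_closed subgroup.m_inv_closed)
      have "rep (inv (to_class v) \<otimes> h \<otimes> to_class x) (unit_vec s) = unit_vec s"
        using to_class(2)[OF x] v(2) hc rep_inv(1)[OF to_class_closed, of v "unit_vec s"] to_class(2)[OF v_pair]
        by simp
      then show ?thesis using st_fix_unit[OF k] generate.one by simp
    next
      case False
      have "x = s"
        using ord neighbours_t[OF z(1)] False x by auto
      then have zT: "z \<in> T" using neighbours_s[OF z(1)] ord False by blast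
      have "v = s"
        using v(1) v_pair False \<open>x = s\<close> by auto
      have "{x, z} \<subseteq> T" using \<open>x = s\<close> zT T(2) by simp
      then have "h \<in> generate W T" using h(1) mono_generate by blast
      then show ?thesis using \<open>x = s\<close> \<open>v = s\<close> hc by (simp add: to_class_def)
    qed
    have "inv (to_class y) \<otimes> w \<otimes> to_class x
        = (inv (to_class y) \<otimes> (w \<otimes> inv h) \<otimes> to_class v) \<otimes> (inv (to_class v) \<otimes> h \<otimes> to_class x)"
    proof -
      have "to_class v \<otimes> (inv (to_class v) \<otimes> (h \<otimes> to_class x)) = h \<otimes> to_class x"
        using hc by (simp add: m_assoc[symmetric])
      moreover have "inv h \<otimes> (h \<otimes> to_class x) = to_class x"
        using hc by (simp add: m_assoc[symmetric])
      ultimately show ?thesis using w hc by (simp add: m_assoc)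
    qed
    then show ?thesis using generate.eng[OF IH step] by simp
  qed
qed

text \<open>Commuting with s means fixing its root up to sign. If the sign is negative, w s fixes
  the root, and s lies in W_T.\<close>

theorem centralizer_parabolic:
  assumes w: "w \<in> carrier W" and c: "w \<otimes> s \<otimes> inv w = s"
  shows "w \<in> generate W T"
proof -
  have *: "w \<in> generate W T" if "w \<in> carrier W" "rep w (unit_vec s) = unit_vec s" for w
    using unit_to_unit[OF that(1) _ s that(2)] that(1) by (simp add: to_class_def)
  have "w \<otimes> s \<otimes> inv w = \<one> \<otimes> s \<otimes> inv \<one>" using c by simp
  then have "rep w (unit_vec s) = rep \<one> (unit_vec s) \<or> rep w (unit_vec s) = (\<lambda>x. - rep \<one> (unit_vec s) x)"
    using w by (intro reflection_root_unique) auto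
  then show ?thesis
  proof
    assume "rep w (unit_vec s) = (\<lambda>x. - rep \<one> (unit_vec s) x)"
    then have "rep (w \<otimes> s) (unit_vec s) = unit_vec s"
      using rep_mult_S_unit[OF w s] by simp
    then have "w \<otimes> s \<in> generate W T" using * w by simp
    then have "w \<otimes> s \<otimes> s \<in> generate W T" using generate.eng generate.incl T(2) by metis
    then show ?thesis using w by simp
  qed (use * w in simp)
qed

text \<open>If g is nontrivial, k = inv b g b has a descent x in T. The root \<delta> = b(x) is
  positive, while g makes it negative because b keeps the roots of T positive. As g lives on T, so
  does \<delta>, and extremality under inv b shows that \<delta> is a simple root of T. It belongs
  to a generator conjugate to x, hence to x itself. But b makes the root of t negative, so the rank
  two step gives x a finite edge to t; thus x = s and b fixes the root of s, which forces b =
  1.\<close>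

lemma reduced_coset_trivial:
  assumes b: "b \<in> generate W {s, t}" "b \<noteq> \<one>"
    and pos: "nonneg (rep b (unit_vec s))" "nonneg (rep (inv b) (unit_vec s))"
    and g: "g \<in> generate W T" "inv b \<otimes> g \<otimes> b \<in> generate W T"
  shows "g = \<one>"
proof (rule ccontr)
  assume g1: "g \<noteq> \<one>"
  have bc: "b \<in> carrier W" and gc: "g \<in> carrier W" using st_closed b(1) T_closed g(1) by auto
  have finT: "finite T" using T(1) finite_S finite_subset by blast
  define k where "k = inv b \<otimes> g \<otimes> b"
  have k: "k \<in> generate W T" using g(2) by (simp add: k_def)
  have bk: "b \<otimes> k = g \<otimes> b" using bc gc by (simp add: k_def m_assoc[symmetric])
  have "k \<noteq> \<one>"
  proof
    assume "k = \<one>"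
    then have "g \<otimes> b = b" using bk bc by simp
    then show False using g1 bc gc by simp
  qed
  then obtain x where x: "x \<in> T" "nonpos (rep k (unit_vec x))"
    using parabolic_descent[OF T(1) k] by blast
  \<comment> \<open>Away from s, an element of the dihedral group leaves coordinate i of the root of
    i equal to 1, and one positive coordinate makes a root positive.\<close>
  have T_pos: "nonneg (rep a (unit_vec i))"
    if a: "a \<in> generate W {s, t}" "nonneg (rep a (unit_vec s))" and i: "i \<in> T" for a i
  proof (cases "i = s")
    case False
    then have "i \<notin> {s, t}" using i T(3) by auto
    then have "rep a (unit_vec i) i = 1" using rep_supp[OF st_subset a(1), of i "unit_vec i"] by simp
    then have "\<not> nonpos (rep a (unit_vec i))" by (metis not_one_le_zero)
    then show ?thesis using root_sign[OF rootI[OF st_closed[OF a(1)]]] i T(1) by blast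
  qed (use a in simp)
  have ib: "inv b \<in> generate W {s, t}" using b(1) generate_inv st_subset by blast
  have xS: "x \<in> S" using x(1) T(1) by blast
  define \<delta> where "\<delta> = rep b (unit_vec x)"
  have \<delta>_pos: "nonneg \<delta>" unfolding \<delta>_def by (rule T_pos[OF b(1) pos(1) x(1)])
  have \<delta>_root: "root \<delta>" unfolding \<delta>_def using bc xS by (rule rootI)
  have "rep k (unit_vec x) i = 0" if "i \<notin> T" for i
  proof -
    have "i \<noteq> x" using x(1) that by auto
    then show ?thesis using rep_supp[OF T(1) k that] by simp
  qed
  then have "rep b (rep k (unit_vec x)) y = (\<Sum>i\<in>T. rep k (unit_vec x) i * rep b (unit_vec i) y)" for y
    by (intro rep_expand[OF bc finT]) auto
  then have np: "nonpos (rep b (rep k (unit_vec x)))"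
    using x(2) T_pos[OF b(1) pos(1)] by (auto intro!: sum_nonpos mult_nonpos_nonneg)
  have "rep b (rep k (unit_vec x)) = rep (b \<otimes> k) (unit_vec x)" using bc T_closed[OF k] by simp
  also have "\<dots> = rep g \<delta>" unfolding bk \<delta>_def using bc gc by simp
  finally have "nonpos (rep g \<delta>)" using np by simp
  then have supp: "\<delta> i = 0" if "i \<notin> T" for i
    using rep_supp[OF T(1) g(1) that, of \<delta>] \<delta>_pos by (metis antisym)
  have e: "unit_vec x y = (\<Sum>i\<in>T. \<delta> i * rep (inv b) (unit_vec i) y)" for y
  proof -
    have "rep (inv b) \<delta> y = (\<Sum>i\<in>T. \<delta> i * rep (inv b) (unit_vec i) y)"
      by (rule rep_expand[OF inv_closed[OF bc] finT supp])
    then show ?thesis using bc by (simp add: \<delta>_def)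
  qed
  obtain i where i: "\<delta> i \<noteq> 0" using root_nonzero[OF \<delta>_root] by blast
  then have iT: "i \<in> T" using supp by blast
  have "rep (inv b) (unit_vec i) = unit_vec x"
  proof (rule nonneg_combination_unit[OF finT _ _ _ xS e iT])
    show "\<delta> i > 0" using i \<delta>_pos by (simp add: less_le)
  qed (use \<delta>_pos T_pos[OF ib pos(2)] bc T(1) in \<open>auto intro!: rootI\<close>)
  then have bx: "rep b (unit_vec x) = unit_vec i" using bc by (metis rep_inv(2))
  have iS: "i \<in> S" using iT T(1) by blast
  have "x = i" using T_classes[OF x(1) iT] conjugate_of_rep[OF bc xS iS bx] .
  obtain z where z: "z \<in> {s, t}" "nonpos (rep b (unit_vec z))"
    using parabolic_descent[OF st_subset b] by blast
  have "z \<noteq> s" using root_not_both[OF rootI[OF bc s] pos(1)] z(2) by auto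
  then have "nonpos (rep b (unit_vec t))" using z by auto
  then have "ord (x \<otimes> t) \<noteq> 0" using simple_to_simple[OF bc xS iS t bx] by blast
  then have "x \<in> {s, t}" using neighbours_t[OF xS] ord_sym[OF xS t] by simp
  then have "x = s" using x(1) T(3) by auto
  then show False using st_fix_unit[OF b(1)] bx \<open>x = i\<close> b(2) by simp
qed

text \<open>Multiplying b by s on either side makes it reduced on both sides. As s lies in W_T, this
  only changes g and its conjugate within W_T. Excluding 1 and s keeps the reduced element
  nontrivial.\<close>

lemma conj_parabolic_trivial:
  assumes b: "b \<in> generate W {s, t}" "b \<noteq> \<one>" "b \<noteq> s"
    and g: "g \<in> generate W T" "inv b \<otimes> g \<otimes> b \<in> generate W T"
  shows "g = \<one>"
proof -
  have bc: "b \<in> carrier W" and gc: "g \<in> carrier W" using st_closed b(1) T_closed g(1) by auto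
  have s_st: "s \<in> generate W {s, t}" and s_T: "s \<in> generate W T"
    using T(2) by (auto intro: generate.incl)
  obtain b1 where b1: "b1 \<in> generate W {s, t}" "b1 = b \<or> b1 = b \<otimes> s" "nonneg (rep b1 (unit_vec s))"
  proof (cases "nonneg (rep b (unit_vec s))")
    case False
    then have "nonpos (rep b (unit_vec s))" using root_sign[OF rootI[OF bc s]] by blast
    then have "nonneg (rep (b \<otimes> s) (unit_vec s))" using rep_mult_S_unit[OF bc s] by simp
    then show thesis using that[of "b \<otimes> s"] generate.eng[OF b(1) s_st] by blast
  qed (use that b in blast)
  have b1c: "b1 \<in> carrier W" using st_closed b1(1) .
  have b1_ne: "b1 \<noteq> \<one>" "b1 \<noteq> s"
  proof -
    have "b = b1 \<or> b = b1 \<otimes> s" using b1(2) bc by auto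
    then show "b1 \<noteq> \<one>" "b1 \<noteq> s" using b(2,3) by auto
  qed
  have g1: "inv b1 \<otimes> g \<otimes> b1 \<in> generate W T"
    using b1(2)
  proof
    assume e: "b1 = b \<otimes> s"
    have "inv b1 \<otimes> g \<otimes> b1 = s \<otimes> (inv b \<otimes> g \<otimes> b) \<otimes> s"
      using bc gc by (simp add: e inv_mult_group m_assoc)
    then show ?thesis using s_T g(2) by (simp only: generate.eng)
  qed (use g in simp)
  show ?thesis
  proof (cases "nonneg (rep (inv b1) (unit_vec s))")
    case True
    show ?thesis by (rule reduced_coset_trivial[OF b1(1) b1_ne(1) b1(3) True g(1) g1])
  next
    case False
    let ?b2 = "s \<otimes> b1"
    have np: "nonpos (rep (inv b1) (unit_vec s))"
      using False root_sign[OF rootI[of "inv b1" s]] b1c by auto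
    have "rep b1 (unit_vec s) \<noteq> unit_vec s"
      using st_fix_unit[OF b1(1)] b1_ne by blast
    then have "nonneg (rep ?b2 (unit_vec s))"
      using srefl_positive[OF rootI[OF b1c s] b1(3) s] b1c by (simp add: rep_spec(2))
    moreover have "nonneg (rep (inv ?b2) (unit_vec s))"
      using np rep_mult_S_unit[of "inv b1" s] b1c by (simp add: inv_mult_group del: rep_mult)
    moreover have "?b2 \<in> generate W {s, t}" by (rule generate.eng[OF s_st b1(1)])
    moreover have "?b2 \<noteq> \<one>"
    proof
      assume "?b2 = \<one>"
      then have "inv b1 = s" using b1c by (intro inv_equality) auto
      then show False using b1_ne(2) b1c by (metis S_inv inv_inv s)
    qed
    moreover have "s \<otimes> g \<otimes> s \<in> generate W T" using s_T g(1) by (simp only: generate.eng)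
    moreover have "inv ?b2 \<otimes> (s \<otimes> g \<otimes> s) \<otimes> ?b2 = inv b1 \<otimes> g \<otimes> b1"
      using b1c gc by (simp add: inv_mult_group m_assoc S_mult_cancel)
    ultimately have "s \<otimes> g \<otimes> s = \<one>" using reduced_coset_trivial[of ?b2 "s \<otimes> g \<otimes> s"] g1 by simp
    then have "s \<otimes> g \<otimes> inv s = \<one>" by simp
    then show ?thesis using conj_one_iff[of s g] gc by simp
  qed
qed

text \<open>The finite dihedral group of r and v lies in a conjugate by a of some W_J with only
  finite edges in J. J contains a generator y outside the class of s, so the leaf t is not in J;
  hence s is, and J is part of T. Comparing the two descriptions of r gives g = a p w with p in W_J
  and w centralizing s, hence with p and w in W_T.\<close>

lemma finite_neighbour_parabolic:
  assumes g: "g \<in> carrier W" and h: "h \<in> carrier W" and u: "u \<in> S"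
    and r: "r = g \<otimes> s \<otimes> inv g" and v: "v = h \<otimes> u \<otimes> inv h"
    and nc: "\<not> conjugate s u" and fin: "ord (r \<otimes> v) \<noteq> 0"
  shows "inv g \<otimes> v \<otimes> g \<in> generate W T"
proof -
  have rc: "r \<in> carrier W" and vc: "v \<in> carrier W" using g h u r v by auto
  have "r \<otimes> r = \<one>" "v \<otimes> v = \<one>" using g h u by (auto simp: r v conj_conj_prod)
  then interpret P: involution_pair W r v using rc vc by unfold_locales auto
  have sub: "subgroup (generate W {r, v}) W" using rc vc by (intro generate_is_subgroup) auto
  obtain a J where a: "a \<in> carrier W" and J: "J \<subseteq> S"
    and Jfin: "\<And>x y. x \<in> J \<Longrightarrow> y \<in> J \<Longrightarrow> ord (x \<otimes> y) \<noteq> 0"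
    and conj: "\<And>k. k \<in> generate W {r, v} \<Longrightarrow> inv a \<otimes> k \<otimes> a \<in> generate W J"
    using finite_subgroup_parabolic[OF sub P.finite_generate[OF fin]] by blast
  have conj_a: "inv a \<otimes> (k \<otimes> x \<otimes> inv k) \<otimes> a = (inv a \<otimes> k) \<otimes> x \<otimes> inv (inv a \<otimes> k)"
    if "k \<in> carrier W" "x \<in> carrier W" for k x
    using conj_mult[of "inv a" k x] a that by simp
  obtain p x where p: "p \<in> generate W J" "x \<in> J" "(inv a \<otimes> g) \<otimes> s \<otimes> inv (inv a \<otimes> g) = p \<otimes> x \<otimes> inv p"
    using parabolic_reflection[OF J, of "inv a \<otimes> g" s] conj[OF P.a_in] conj_a[OF g, of s] a g r by auto
  obtain q y where q: "q \<in> generate W J" "y \<in> J" "(inv a \<otimes> h) \<otimes> u \<otimes> inv (inv a \<otimes> h) = q \<otimes> y \<otimes> inv q"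
    using parabolic_reflection[OF J, of "inv a \<otimes> h" u] conj[OF P.b_in] conj_a[OF h, of u] a h u v by auto
  have pc: "p \<in> carrier W" and qc: "q \<in> carrier W" using generate_closed[OF J] p(1) q(1) by auto
  have xS: "x \<in> S" and yS: "y \<in> S" using J p(2) q(2) by auto
  have conj_of: "conjugate b c"
    if "k \<in> carrier W" "l \<in> carrier W" "b \<in> carrier W" "c \<in> carrier W" "k \<otimes> b \<otimes> inv k = l \<otimes> c \<otimes> inv l" for k l b c
  proof -
    have "conjugate b (k \<otimes> b \<otimes> inv k)" using that by (intro conjugateI)
    moreover have "conjugate (l \<otimes> c \<otimes> inv l) c"
      by (rule conjugate_sym[OF that(4) conjugateI[OF that(2)]])
    then have "conjugate (k \<otimes> b \<otimes> inv k) c" using that(5) by simp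
    ultimately show ?thesis by (rule conjugate_trans[OF that(3)])
  qed
  have "conjugate s x" using conj_of[OF _ pc _ _ p(3)] a g xS by simp
  then have x_pair: "x \<in> {s, t}" using pair_class xS by blast
  have uy: "conjugate u y" using conj_of[OF _ qc _ _ q(3)] a h u yS by simp
  have y_pair: "y \<notin> {s, t}"
  proof
    assume "y \<in> {s, t}"
    then have "conjugate s y" using to_class[of y] conjugate_of_rep[of "to_class y" s y] by auto
    moreover have "conjugate y u" using conjugate_sym[OF _ uy] u by simp
    ultimately have "conjugate s u" by (rule conjugate_trans[OF S_closed[OF s]])
    then show False using nc by simp
  qed
  have "t \<notin> J" using Jfin[OF _ q(2), of t] neighbours_t[OF yS] y_pair by blast
  then have "x = s" using x_pair p(2) by auto
  have "J \<subseteq> T" using Jfin[OF p(2)] neighbours_s \<open>x = s\<close> \<open>t \<notin> J\<close> J by blast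
  then have JT: "generate W J \<subseteq> generate W T" by (rule mono_generate)
  define w where "w = inv p \<otimes> (inv a \<otimes> g)"
  have wc: "w \<in> carrier W" using pc a g by (simp add: w_def)
  have "w \<otimes> s \<otimes> inv w = inv p \<otimes> (p \<otimes> x \<otimes> inv p) \<otimes> inv (inv p)"
    unfolding w_def using conj_mult[of "inv p" "inv a \<otimes> g" s] p(3) pc a g by simp
  then have "w \<otimes> s \<otimes> inv w = s" using conj_inv_cancel(1)[OF pc, of x] pc xS \<open>x = s\<close> by simp
  then have w: "w \<in> generate W T" by (rule centralizer_parabolic[OF wc])
  have g_eq: "g = a \<otimes> p \<otimes> w"
  proof -
    have "a \<otimes> p \<otimes> w = a \<otimes> (p \<otimes> (inv p \<otimes> (inv a \<otimes> g)))" unfolding w_def using pc a g by (simp add: m_assoc)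
    also have "p \<otimes> (inv p \<otimes> (inv a \<otimes> g)) = inv a \<otimes> g" using pc a g by (simp add: m_assoc[symmetric])
    also have "a \<otimes> (inv a \<otimes> g) = g" using a g by (simp add: m_assoc[symmetric])
    finally show ?thesis by simp
  qed
  have "inv g \<otimes> v \<otimes> g = inv w \<otimes> (inv p \<otimes> (inv a \<otimes> v \<otimes> a) \<otimes> p) \<otimes> w"
    unfolding g_eq using pc a vc wc by (simp add: inv_mult_group m_assoc)
  moreover have "inv a \<otimes> v \<otimes> a \<in> generate W T" using conj[OF P.b_in] JT by blast
  moreover have "p \<in> generate W T" using p(1) JT by blast
  ultimately show ?thesis
    using w generate_inv[OF T(1)] by (simp only: generate.eng)
qed

text \<open>Both r and r' are conjugates of s by elements f a and f b with a, b in the dihedral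
  group, and v lies in both corresponding conjugates of W_T. As r and r' differ, inv a b is neither
  1 nor s; the conjugates then meet trivially, which is absurd for a reflection.\<close>

lemma no_common_neighbour:
  assumes f: "f \<in> carrier W" and g: "g \<in> carrier W" "g' \<in> carrier W"
    and r: "r = g \<otimes> s \<otimes> inv g" "r' = g' \<otimes> s \<otimes> inv g'" "r \<noteq> r'"
    and st: "inv f \<otimes> r \<otimes> f \<in> generate W {s, t}" "inv f \<otimes> r' \<otimes> f \<in> generate W {s, t}"
    and v: "h \<in> carrier W" "u \<in> S" "v = h \<otimes> u \<otimes> inv h" "\<not> conjugate s u"
    and fin: "ord (r \<otimes> v) \<noteq> 0" "ord (r' \<otimes> v) \<noteq> 0"
  shows False
proof -
  have vc: "v \<in> carrier W" using v by simp
  have form: "\<exists>a\<in>generate W {s, t}. k \<otimes> s \<otimes> inv k = (f \<otimes> a) \<otimes> s \<otimes> inv (f \<otimes> a)"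
    if k: "k \<in> carrier W" "inv f \<otimes> (k \<otimes> s \<otimes> inv k) \<otimes> f \<in> generate W {s, t}" for k
  proof -
    have e: "inv f \<otimes> (k \<otimes> s \<otimes> inv k) \<otimes> f = (inv f \<otimes> k) \<otimes> s \<otimes> inv (inv f \<otimes> k)"
      using conj_mult[of "inv f" k s] f k by simp
    obtain p x where p: "p \<in> generate W {s, t}" "x \<in> {s, t}"
      "(inv f \<otimes> k) \<otimes> s \<otimes> inv (inv f \<otimes> k) = p \<otimes> x \<otimes> inv p"
      using parabolic_reflection[OF st_subset, of "inv f \<otimes> k" s] k f e by auto
    have pc: "p \<in> carrier W" using st_closed p(1) .
    have "x = to_class x \<otimes> s \<otimes> inv (to_class x)"
      using reflection_eqI[of "to_class x" \<one> s x] to_class(2)[OF p(2)] p(2) by auto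
    then have "p \<otimes> x \<otimes> inv p = (p \<otimes> to_class x) \<otimes> s \<otimes> inv (p \<otimes> to_class x)"
      using conj_mult[OF pc, of "to_class x" s] by simp
    moreover have "k \<otimes> s \<otimes> inv k = f \<otimes> (inv f \<otimes> (k \<otimes> s \<otimes> inv k) \<otimes> f) \<otimes> inv f"
      using conj_inv_cancel(2)[OF f, of "k \<otimes> s \<otimes> inv k"] k by simp
    ultimately have "k \<otimes> s \<otimes> inv k = f \<otimes> ((p \<otimes> to_class x) \<otimes> s \<otimes> inv (p \<otimes> to_class x)) \<otimes> inv f"
      using e p(3) by simp
    also have "\<dots> = (f \<otimes> (p \<otimes> to_class x)) \<otimes> s \<otimes> inv (f \<otimes> (p \<otimes> to_class x))"
      using conj_mult[OF f, of "p \<otimes> to_class x" s] pc by simp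
    finally show ?thesis using generate.eng[OF p(1) to_class(1)[OF p(2)]] by blast
  qed
  obtain a where a: "a \<in> generate W {s, t}" "r = (f \<otimes> a) \<otimes> s \<otimes> inv (f \<otimes> a)"
    using form[OF g(1)] st(1) r(1) by auto
  obtain b where b: "b \<in> generate W {s, t}" "r' = (f \<otimes> b) \<otimes> s \<otimes> inv (f \<otimes> b)"
    using form[OF g(2)] st(2) r(2) by auto
  have ac: "a \<in> carrier W" and bc: "b \<in> carrier W" using st_closed a(1) b(1) by auto
  define x where "x = inv (f \<otimes> a) \<otimes> v \<otimes> (f \<otimes> a)"
  have x: "x \<in> generate W T"
    unfolding x_def using finite_neighbour_parabolic[OF _ v(1,2) a(2) v(3,4) fin(1)] f ac by simp
  have y: "inv (f \<otimes> b) \<otimes> v \<otimes> (f \<otimes> b) \<in> generate W T"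
    using finite_neighbour_parabolic[OF _ v(1,2) b(2) v(3,4) fin(2)] f bc by simp
  define d where "d = inv a \<otimes> b"
  have d: "d \<in> generate W {s, t}"
    unfolding d_def using a(1) b(1) subgroup_st by (intro subgroup.m_closed subgroup.m_inv_closed)
  have dc: "d \<in> carrier W" using st_closed d .
  have b_eq: "f \<otimes> b = (f \<otimes> a) \<otimes> d" unfolding d_def using f ac bc
    by (simp add: m_assoc) (simp add: m_assoc[symmetric])
  have "inv d \<otimes> x \<otimes> d = inv (f \<otimes> b) \<otimes> v \<otimes> (f \<otimes> b)"
    unfolding b_eq x_def using f ac dc vc by (simp add: inv_mult_group m_assoc)
  then have dx: "inv d \<otimes> x \<otimes> d \<in> generate W T" using y by simp
  have rr: "r' = (f \<otimes> a) \<otimes> (d \<otimes> s \<otimes> inv d) \<otimes> inv (f \<otimes> a)"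
    unfolding b(2) b_eq using conj_mult[of "f \<otimes> a" d s] f ac dc by simp
  have "d \<noteq> \<one>" "d \<noteq> s" using rr a(2) r(3) by auto
  then have "x = \<one>" using conj_parabolic_trivial[OF d _ _ x dx] by blast
  then have "v = \<one>" unfolding x_def using conj_one_iff[of "inv (f \<otimes> a)" v] f ac vc by simp
  then show False using v(1,2,3) conj_one_iff[OF v(1), of u] S_nontrivial[OF v(2)] by auto
qed

end

section \<open>Two Coxeter systems with the same reflections\<close>

context group
begin

lemma hom_generate:
  assumes \<phi>: "\<phi> \<in> hom G G" and J: "J \<subseteq> carrier G" and x: "x \<in> generate G J"
  shows "\<phi> x \<in> generate G (\<phi> ` J)"
proof -
  interpret h: group_hom G G \<phi> using \<phi> by unfold_locales
  show ?thesis using h.generate_img[OF J] x by blast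
qed

lemma hom_conj:
  assumes "\<phi> \<in> hom G G" "g \<in> carrier G" "x \<in> carrier G"
  shows "\<phi> (g \<otimes> x \<otimes> inv g) = \<phi> g \<otimes> \<phi> x \<otimes> inv (\<phi> g)"
proof -
  interpret h: group_hom G G \<phi> using assms(1) by unfold_locales
  show ?thesis using assms by simp
qed

lemma generate_involution:
  assumes "a \<in> carrier G" "a \<otimes> a = \<one>" "x \<in> generate G J" "J \<subseteq> {\<one>, a}"
  shows "x \<in> {\<one>, a}"
  using assms(3)
proof induction
  case (inv h)
  then have "h = \<one> \<or> h = a" using assms(4) by auto
  moreover have "inv a = a" using assms(1,2) by (intro inv_equality) auto
  ultimately show ?case by auto
next
  case (eng g h)
  then show ?case using assms(1,2) by auto
qed (use assms(4) in auto)

definition conj_class :: "'a \<Rightarrow> 'a set" where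
  "conj_class x = {z. conjugate x z}"

lemma class_conj:
  assumes "x \<in> carrier G" "z \<in> conj_class x" "g \<in> carrier G"
  shows "g \<otimes> z \<otimes> inv g \<in> conj_class x"
  using assms conjugate_trans[OF assms(1), of z "g \<otimes> z \<otimes> inv g"] conjugateI[OF assms(3), of z]
  by (simp add: conj_class_def)

end

locale two_systems = coxeter W S + B: coxeter W S'
  for W :: "('a, 'b) monoid_scheme" (structure) and S S' +
  assumes same_reflections: "reflections W S = reflections W S'"
begin

lemma swap: "two_systems W S' S"
  using same_reflections by unfold_locales simp

lemma partner:
  assumes x: "x \<in> S"
  obtains g y where "g \<in> carrier W" "y \<in> S'" "x = g \<otimes> y \<otimes> inv g"
proof -
  have "x = \<one> \<otimes> x \<otimes> inv \<one>" using x by simp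
  then have "x \<in> reflections W S" unfolding reflections_def using x by blast
  then show thesis using that unfolding same_reflections by (auto simp: reflections_def)
qed

lemma partner':
  assumes x: "x \<in> S'"
  obtains g y where "g \<in> carrier W" "y \<in> S" "x = g \<otimes> y \<otimes> inv g"
  using two_systems.partner[OF swap x] by blast

lemma partner_conjugate:
  assumes x: "x \<in> S"
  obtains y where "y \<in> S'" "conjugate x y"
proof -
  obtain g y where g: "g \<in> carrier W" "y \<in> S'" "x = g \<otimes> y \<otimes> inv g" using partner[OF x] .
  then have "conjugate y x" by (auto simp: conjugate_def)
  then show thesis using that[OF g(2)] conjugate_sym g(2) by simp
qed

text \<open>The retractions of the two systems onto a union of conjugacy classes of reflections kill the
  same elements, so each of them can be evaluated on the generators of the other system.\<close>

definition retracts :: "'a set \<Rightarrow> ('a \<Rightarrow> 'a) \<Rightarrow> bool" where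
  "retracts C \<phi> \<longleftrightarrow> \<phi> \<in> hom W W \<and> (\<forall>z\<in>S'. \<phi> z = (if z \<in> C then z else \<one>)) \<and>
     (\<forall>z\<in>S. z \<notin> C \<longrightarrow> \<phi> z = \<one>)"

lemma retracts_exists:
  assumes C: "\<And>x g. x \<in> C \<Longrightarrow> g \<in> carrier W \<Longrightarrow> g \<otimes> x \<otimes> inv g \<in> C"
  obtains \<phi> where "retracts C \<phi>"
proof -
  obtain \<phi> where \<phi>: "\<phi> \<in> hom W W" "\<And>s. s \<in> S' \<Longrightarrow> \<phi> s = (if s \<in> C then s else \<one>)"
    using B.retraction[OF C] by metis
  have "\<phi> z = \<one>" if z: "z \<in> S" "z \<notin> C" for z
  proof -
    obtain g y where g: "g \<in> carrier W" "y \<in> S'" "z = g \<otimes> y \<otimes> inv g" using partner[OF z(1)] .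
    then have "y \<notin> C" using C z(2) by blast
    then have "\<phi> y = \<one>" using \<phi>(2)[OF g(2)] by simp
    moreover have "\<phi> g \<in> carrier W" using \<phi>(1) g(1) by (rule hom_in_carrier)
    ultimately show ?thesis unfolding g(3) using hom_conj[OF \<phi>(1) g(1), of y] g(2) by simp
  qed
  then have "retracts C \<phi>" using \<phi> by (simp add: retracts_def)
  then show thesis by (rule that)
qed

lemma retracts_square:
  assumes "retracts C \<phi>" "a \<in> S"
  shows "\<phi> a \<in> carrier W" "\<phi> a \<otimes> \<phi> a = \<one>"
proof -
  have \<phi>: "\<phi> \<in> hom W W" using assms(1) by (simp add: retracts_def)
  show "\<phi> a \<in> carrier W" by (rule hom_in_carrier[OF \<phi> S_closed[OF assms(2)]])
  have "\<phi> a \<otimes> \<phi> a = \<phi> (a \<otimes> a)" using \<phi> assms(2) by (simp only: hom_mult[OF \<phi>] S_closed)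
  then show "\<phi> a \<otimes> \<phi> a = \<one>" using assms(2) hom_one[OF \<phi> is_group is_group] by simp
qed

text \<open>With at most one generator of J in C, the retraction sends W_J into a group of order at
  most two, so a conjugate of W_J has at most one nontrivial image.\<close>

lemma retracts_unique_image:
  assumes \<phi>: "retracts C \<phi>" and J: "J \<subseteq> S" and one: "\<And>x y. x \<in> J \<inter> C \<Longrightarrow> y \<in> J \<inter> C \<Longrightarrow> x = y"
    and g: "g \<in> carrier W" and r: "r \<in> carrier W" "r' \<in> carrier W"
    and in_J: "inv g \<otimes> r \<otimes> g \<in> generate W J" "inv g \<otimes> r' \<otimes> g \<in> generate W J"
    and ne: "\<phi> r \<noteq> \<one>" "\<phi> r' \<noteq> \<one>"
  shows "\<phi> r = \<phi> r'"
proof -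
  have h: "\<phi> \<in> hom W W" using \<phi> by (simp add: retracts_def)
  have Jc: "J \<subseteq> carrier W" using J S_carrier by blast
  obtain a where a: "a \<in> carrier W" "a \<otimes> a = \<one>" "\<phi> ` J \<subseteq> {\<one>, a}"
  proof (cases "J \<inter> C = {}")
    case True
    then have "\<phi> ` J \<subseteq> {\<one>, \<one>}" using \<phi> J by (auto simp: retracts_def)
    then show thesis using that[of \<one>] by simp
  next
    case False
    then obtain x where x: "x \<in> J \<inter> C" by blast
    have "\<phi> z \<in> {\<one>, \<phi> x}" if z: "z \<in> J" for z
    proof (cases "z \<in> C")
      case True
      then show ?thesis using one[of z x] x z by simp
    next
      case False
      then show ?thesis using \<phi> J z by (auto simp: retracts_def)
    qed
    then have "\<phi> ` J \<subseteq> {\<one>, \<phi> x}" by blast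
    then show thesis using that[of "\<phi> x"] retracts_square[OF \<phi>, of x] x J by blast
  qed
  have *: "\<phi> k = \<phi> g \<otimes> a \<otimes> inv (\<phi> g)"
    if k: "k \<in> carrier W" "inv g \<otimes> k \<otimes> g \<in> generate W J" "\<phi> k \<noteq> \<one>" for k
  proof -
    have "k = g \<otimes> (inv g \<otimes> k \<otimes> g) \<otimes> inv g" using conj_inv_cancel(2)[OF g k(1)] by simp
    then have e: "\<phi> k = \<phi> g \<otimes> \<phi> (inv g \<otimes> k \<otimes> g) \<otimes> inv (\<phi> g)"
      using hom_conj[OF h g, of "inv g \<otimes> k \<otimes> g"] g k(1) by simp
    have "\<phi> (inv g \<otimes> k \<otimes> g) \<in> {\<one>, a}"
      by (rule generate_involution[OF a(1,2) hom_generate[OF h Jc k(2)] a(3)])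
    moreover have "\<phi> g \<in> carrier W" using hom_in_carrier[OF h g] .
    ultimately show ?thesis using e k(3) by auto
  qed
  show ?thesis using *[OF r(1) in_J(1) ne(1)] *[OF r(2) in_J(2) ne(2)] by simp
qed

lemma class_retracts:
  assumes "x \<in> carrier W"
  obtains \<phi> where "retracts (conj_class x) \<phi>"
  using retracts_exists[of "conj_class x"] class_conj[OF assms] by blast

text \<open>Here J is all of S: the retraction onto the class has image of order two, yet it fixes
  every generator of S' in the class.\<close>

lemma single_class:
  assumes x: "x \<in> S" and single: "\<And>z. z \<in> S \<Longrightarrow> conjugate x z \<Longrightarrow> z = x"
    and y: "y \<in> S'" "y' \<in> S'" "conjugate x y" "conjugate x y'"
  shows "y = y'"
proof -
  obtain \<phi> where \<phi>: "retracts (conj_class x) \<phi>" using class_retracts[of x] x by blast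
  have e: "\<phi> y = y" "\<phi> y' = y'" using \<phi> y by (auto simp: retracts_def conj_class_def)
  have "\<phi> y = \<phi> y'"
  proof (rule retracts_unique_image[OF \<phi> order_refl _ one_closed])
    show "inv \<one> \<otimes> y \<otimes> \<one> \<in> generate W S" "inv \<one> \<otimes> y' \<otimes> \<one> \<in> generate W S"
      using y generate_S by simp_all
  qed (use single e y B.S_nontrivial in \<open>auto simp: conj_class_def\<close>)
  then show ?thesis using e by simp
qed

lemma pair_class_image:
  assumes s: "s \<in> S" and t: "t \<in> S" and pair: "\<And>z. z \<in> S \<Longrightarrow> conjugate s z \<Longrightarrow> z \<in> {s, t}"
    and \<phi>: "retracts (conj_class s) \<phi>" and y: "y \<in> S'" "conjugate s y"
  shows "y \<in> generate W {\<phi> s, \<phi> t}"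
proof -
  have h: "\<phi> \<in> hom W W" using \<phi> by (simp add: retracts_def)
  have fy: "\<phi> y = y" using \<phi> y by (auto simp: retracts_def conj_class_def)
  have "\<phi> ` S \<subseteq> generate W {\<phi> s, \<phi> t}"
  proof
    fix z assume "z \<in> \<phi> ` S"
    then obtain x where x: "x \<in> S" "z = \<phi> x" by blast
    show "z \<in> generate W {\<phi> s, \<phi> t}"
    proof (cases "x \<in> conj_class s")
      case True
      then have "x \<in> {s, t}" using pair x(1) by (simp add: conj_class_def)
      then show ?thesis using x(2) by (auto intro: generate.incl)
    next
      case False
      then show ?thesis using \<phi> x by (simp add: retracts_def generate.one)
    qed
  qed
  moreover have sub: "subgroup (generate W {\<phi> s, \<phi> t}) W"
    using retracts_square(1)[OF \<phi>] s t by (intro generate_is_subgroup) auto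
  ultimately have "generate W (\<phi> ` S) \<subseteq> generate W {\<phi> s, \<phi> t}"
    by (rule generate_subgroup_incl)
  moreover have "\<phi> y \<in> generate W (\<phi> ` S)"
    using hom_generate[OF h S_carrier, of y] generate_S y(1) by simp
  ultimately show ?thesis using fy by auto
qed

text \<open>The retraction maps W into the dihedral group of \<phi> s and \<phi> t, whose rotations
  are killed by the odd number n. The generators y and y' are fixed by it, and as involutions they
  are reflections there, so y y' is a rotation.\<close>

lemma pair_class_ord_dvd:
  assumes s: "s \<in> S" and t: "t \<in> S" and pair: "\<And>z. z \<in> S \<Longrightarrow> conjugate s z \<Longrightarrow> z \<in> {s, t}"
    and odd: "odd (ord (s \<otimes> t))"
    and y: "y \<in> S'" "conjugate s y" and y': "y' \<in> S'" "conjugate s y'"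
  shows "ord (y \<otimes> y') dvd ord (s \<otimes> t)"
proof -
  obtain \<phi> where \<phi>: "retracts (conj_class s) \<phi>" using class_retracts[of s] s by blast
  have h: "\<phi> \<in> hom W W" using \<phi> by (simp add: retracts_def)
  interpret P: involution_pair W "\<phi> s" "\<phi> t"
    using retracts_square[OF \<phi>] s t by unfold_locales auto
  define n where "n = ord (s \<otimes> t)"
  have "(\<phi> s \<otimes> \<phi> t) [^] n = \<phi> ((s \<otimes> t) [^] n)"
  proof -
    interpret h: group_hom W W \<phi> using h by unfold_locales
    show ?thesis using s t by (simp add: h.hom_nat_pow)
  qed
  also have "\<dots> = \<one>" using s t hom_one[OF h is_group is_group] by (simp add: n_def)
  finally have cn: "(\<phi> s \<otimes> \<phi> t) [^] n = \<one>" .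
  then have dn: "int (ord (\<phi> s \<otimes> \<phi> t)) dvd int n" by (simp add: pow_eq_id)
  have refl: "\<exists>i::int. z = P.c [^] i \<otimes> \<phi> s" if z: "z \<in> S'" "conjugate s z" for z
  proof -
    have "z \<in> generate W {\<phi> s, \<phi> t}" by (rule pair_class_image[OF s t pair \<phi> z])
    then show ?thesis
    proof (cases rule: P.generate_cases)
      \<comment> \<open>A rotation is killed by the odd n and y is also killed by 2, so y would be
        trivial.\<close>
      case (1 i)
      have "z [^] int n = P.c [^] (i * int n)" unfolding 1 by (simp add: int_pow_pow)
      also have "\<dots> = \<one>" using dn by (simp add: int_pow_eq_id)
      finally have "z [^] n = \<one>" by (simp add: int_pow_int)
      then have "ord z dvd n" using z by (simp add: pow_eq_id)
      moreover have "z [^] (2::nat) = \<one>" using z by (simp add: numeral_2_eq_2)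
      then have "ord z dvd 2" using z by (simp add: pow_eq_id)
      ultimately have "ord z dvd gcd n 2" by simp
      moreover have "gcd n 2 = 1" using odd by (simp add: n_def)
      ultimately have "z = \<one>" using z ord_eq_1[of z] by simp
      then show ?thesis using B.S_nontrivial[OF z(1)] by simp
    qed blast
  qed
  obtain i :: int where i: "y = P.c [^] i \<otimes> \<phi> s" using refl[OF y] by blast
  obtain j :: int where j: "y' = P.c [^] j \<otimes> \<phi> s" using refl[OF y'] by blast
  have "y \<otimes> y' = P.c [^] (i - j)" unfolding i j by (rule P.refl_mult)
  then have "(y \<otimes> y') [^] int n = P.c [^] ((i - j) * int n)" by (simp add: int_pow_pow)
  also have "\<dots> = \<one>" using dn by (simp add: int_pow_eq_id)
  finally have "(y \<otimes> y') [^] n = \<one>" by (simp add: int_pow_int)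
  then show ?thesis using y y' by (simp add: pow_eq_id n_def)
qed

end

text \<open>The identity matrix of size three does not have rank two. D is the minor of \<alpha> and
  \<beta> at y and z: the row of x forces D = 0, while the rows of y and z write 1 as a multiple of
  D.\<close>

lemma no_identity_in_plane:
  fixes \<alpha> \<beta> :: "'i \<Rightarrow> real"
  assumes e: "\<And>i j. i \<in> {x, y, z} \<Longrightarrow> j \<in> {x, y, z} \<Longrightarrow> (if j = i then 1 else 0) = p i * \<alpha> j + q i * \<beta> j"
    and d: "x \<noteq> y" "x \<noteq> z" "y \<noteq> z"
  shows False
proof -
  have x: "p x * \<alpha> x + q x * \<beta> x = 1" "p x * \<alpha> y + q x * \<beta> y = 0" "p x * \<alpha> z + q x * \<beta> z = 0"
    using e[of x x] e[of x y] e[of x z] d by auto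
  have y: "p y * \<alpha> y + q y * \<beta> y = 1" "p y * \<alpha> z + q y * \<beta> z = 0"
    using e[of y y] e[of y z] d by auto
  have z: "p z * \<alpha> y + q z * \<beta> y = 0" "p z * \<alpha> z + q z * \<beta> z = 1"
    using e[of z y] e[of z z] d by auto
  define D where "D = \<alpha> y * \<beta> z - \<alpha> z * \<beta> y"
  have "p x * D = (p x * \<alpha> y + q x * \<beta> y) * \<beta> z - (p x * \<alpha> z + q x * \<beta> z) * \<beta> y"
    "q x * D = (p x * \<alpha> z + q x * \<beta> z) * \<alpha> y - (p x * \<alpha> y + q x * \<beta> y) * \<alpha> z"
    by (simp_all add: D_def algebra_simps)
  then have "D = 0" using x by auto
  moreover have "(p y * q z - q y * p z) * D
      = (p y * \<alpha> y + q y * \<beta> y) * (p z * \<alpha> z + q z * \<beta> z) - (p y * \<alpha> z + q y * \<beta> z) * (p z * \<alpha> y + q z * \<beta> y)"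
    by (simp add: D_def algebra_simps)
  ultimately show False using y z by simp
qed

context two_systems
begin

text \<open>In the representation of S', \<phi> s and \<phi> t are reflections and move vectors
  along fixed directions \<alpha> and \<beta>. The group they generate moves each vector by a
  combination of \<alpha> and \<beta>. A generator of S' in it moves its own simple root to the
  negative, so that root lies in the plane, which has no room for three of them.\<close>

lemma pair_class_size:
  assumes s: "s \<in> S" and t: "t \<in> S" and pair: "\<And>z. z \<in> S \<Longrightarrow> conjugate s z \<Longrightarrow> z \<in> {s, t}"
    and st: "conjugate s t"
    and y: "x \<in> S'" "y \<in> S'" "z \<in> S'" "conjugate s x" "conjugate s y" "conjugate s z"
  shows "x = y \<or> x = z \<or> y = z"
proof (rule ccontr)
  assume "\<not> (x = y \<or> x = z \<or> y = z)"
  then have d: "x \<noteq> y" "x \<noteq> z" "y \<noteq> z" by auto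
  obtain \<phi> where \<phi>: "retracts (conj_class s) \<phi>" using class_retracts[of s] s by blast
  have h: "\<phi> \<in> hom W W" using \<phi> by (simp add: retracts_def)
  have root: "\<exists>\<alpha>. \<forall>v. \<exists>a. B.rep (\<phi> r) v = (\<lambda>i. v i + a * \<alpha> i)"
    if r: "r \<in> S" "conjugate s r" for r
  proof -
    obtain g k where g: "g \<in> carrier W" "k \<in> S'" "r = g \<otimes> k \<otimes> inv g" using partner[OF r(1)] .
    have "conjugate r k" using g conjugate_sym[of k r] by (auto simp: conjugate_def)
    then have "conjugate s k" by (rule conjugate_trans[OF S_closed[OF s] r(2)])
    then have "\<phi> k = k" using \<phi> g(2) by (simp add: retracts_def conj_class_def)
    then have e: "\<phi> r = \<phi> g \<otimes> k \<otimes> inv (\<phi> g)" unfolding g(3) using hom_conj[OF h g(1), of k] g(2) by simp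
    have "\<phi> g \<in> carrier W" using hom_in_carrier[OF h g(1)] .
    then have "B.rep (\<phi> r) v = (\<lambda>i. v i + (- 2 * B.bil (B.rep (\<phi> g) (unit_vec k)) v) * B.rep (\<phi> g) (unit_vec k) i)" for v
      unfolding e using B.rep_reflection[OF _ g(2), of "\<phi> g" v] by simp
    then show ?thesis by blast
  qed
  obtain \<alpha> where \<alpha>: "\<forall>v. \<exists>a. B.rep (\<phi> s) v = (\<lambda>i. v i + a * \<alpha> i)" using root[OF s] s by auto
  obtain \<beta> where \<beta>: "\<forall>v. \<exists>a. B.rep (\<phi> t) v = (\<lambda>i. v i + a * \<beta> i)" using root[OF t st] by auto
  have c: "\<phi> s \<in> carrier W" "\<phi> t \<in> carrier W" using retracts_square(1)[OF \<phi>] s t by auto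
  have inv: "inv (\<phi> s) = \<phi> s" "inv (\<phi> t) = \<phi> t"
    using retracts_square(2)[OF \<phi>] s t c by (auto intro: inv_equality)
  have span: "\<exists>p q. B.rep g v = (\<lambda>i. v i + (p * \<alpha> i + q * \<beta> i))"
    if "g \<in> generate W {\<phi> s, \<phi> t}" for g v
    using that
  proof (induction arbitrary: v)
    case one
    show ?case by (intro exI[of _ 0]) simp
  next
    case (incl k)
    then consider "k = \<phi> s" | "k = \<phi> t" by blast
    then show ?case
    proof cases
      case 1
      obtain a where "B.rep (\<phi> s) v = (\<lambda>i. v i + a * \<alpha> i)" using \<alpha> by blast
      then show ?thesis unfolding 1 by (intro exI[of _ a] exI[of _ 0]) simp
    next
      case 2
      obtain a where "B.rep (\<phi> t) v = (\<lambda>i. v i + a * \<beta> i)" using \<beta> by blast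
      then show ?thesis unfolding 2 by (intro exI[of _ 0] exI[of _ a]) simp
    qed
  next
    case (inv k)
    then consider "inv k = \<phi> s" | "inv k = \<phi> t" using \<open>inv (\<phi> s) = \<phi> s\<close> \<open>inv (\<phi> t) = \<phi> t\<close> by auto
    then show ?case
    proof cases
      case 1
      obtain a where "B.rep (\<phi> s) v = (\<lambda>i. v i + a * \<alpha> i)" using \<alpha> by blast
      then show ?thesis unfolding 1 by (intro exI[of _ a] exI[of _ 0]) simp
    next
      case 2
      obtain a where "B.rep (\<phi> t) v = (\<lambda>i. v i + a * \<beta> i)" using \<beta> by blast
      then show ?thesis unfolding 2 by (intro exI[of _ 0] exI[of _ a]) simp
    qed
  next
    case (eng g k)
    have gk: "g \<in> carrier W" "k \<in> carrier W"
      using eng(1,2) generate_incl[of "{\<phi> s, \<phi> t}"] c by auto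
    obtain p q where 1: "B.rep k v = (\<lambda>i. v i + (p * \<alpha> i + q * \<beta> i))" using eng.IH(2) by blast
    obtain p' q' where 2: "B.rep g (B.rep k v) = (\<lambda>i. B.rep k v i + (p' * \<alpha> i + q' * \<beta> i))"
      using eng.IH(1) by blast
    show ?case
      by (intro exI[of _ "p + p'"] exI[of _ "q + q'"])
        (use gk 1 2 in \<open>simp add: algebra_simps\<close>)
  qed
  have "\<exists>p q. \<forall>j. unit_vec i j = p * \<alpha> j + q * \<beta> j" if i: "i \<in> {x, y, z}" for i
  proof -
    have iS: "i \<in> S'" "conjugate s i" using i y by auto
    have "i \<in> generate W {\<phi> s, \<phi> t}" by (rule pair_class_image[OF s t pair \<phi> iS])
    then obtain p q where "B.rep i (unit_vec i) = (\<lambda>j. unit_vec i j + (p * \<alpha> j + q * \<beta> j))"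
      using span by blast
    then have e: "(\<lambda>j. - unit_vec i j) = (\<lambda>j. unit_vec i j + (p * \<alpha> j + q * \<beta> j))"
      using B.rep_S_unit[OF iS(1)] by simp
    have "unit_vec i j = (- p / 2) * \<alpha> j + (- q / 2) * \<beta> j" for j
      using fun_cong[OF e, of j] by simp
    then show ?thesis by blast
  qed
  then obtain p q where pq: "\<And>i j. i \<in> {x, y, z} \<Longrightarrow> unit_vec i j = p i * \<alpha> j + q i * \<beta> j"
    by metis
  show False
    by (rule no_identity_in_plane[of x y z p \<alpha> q \<beta>]) (use pq d in \<open>auto simp: unit_vec_def\<close>)
qed

end

text \<open>At most one generator of a class has finite edges leaving the class; u and v may be
  equal or belong to different classes.\<close>

definition (in group) tight :: "'a set \<Rightarrow> bool" where
  "tight S \<longleftrightarrow> (\<forall>x\<in>S. \<forall>y\<in>S. \<forall>u\<in>S. \<forall>v\<in>S. x \<noteq> y \<longrightarrow> conjugate x y \<longrightarrow>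
     \<not> conjugate x u \<longrightarrow> \<not> conjugate x v \<longrightarrow> ord (x \<otimes> u) = 0 \<or> ord (y \<otimes> v) = 0)"

lemma (in group) tightD:
  "tight S \<Longrightarrow> x \<in> S \<Longrightarrow> y \<in> S \<Longrightarrow> u \<in> S \<Longrightarrow> v \<in> S \<Longrightarrow> x \<noteq> y \<Longrightarrow> conjugate x y \<Longrightarrow>
    \<not> conjugate x u \<Longrightarrow> \<not> conjugate x v \<Longrightarrow> ord (x \<otimes> u) = 0 \<or> ord (y \<otimes> v) = 0"
  unfolding tight_def by (metis (no_types))

context coxeter
begin

lemma parabolic_meets_class:
  assumes J: "J \<subseteq> S" and f: "f \<in> carrier W" and g: "g \<in> carrier W" and x: "x \<in> S"
    and r: "r = g \<otimes> x \<otimes> inv g" "inv f \<otimes> r \<otimes> f \<in> generate W J"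
  obtains z where "z \<in> J" "conjugate x z"
proof -
  have e: "inv f \<otimes> r \<otimes> f = (inv f \<otimes> g) \<otimes> x \<otimes> inv (inv f \<otimes> g)"
    using conj_mult[of "inv f" g x] f g x r(1) by simp
  obtain h z where h: "h \<in> generate W J" "z \<in> J" "(inv f \<otimes> g) \<otimes> x \<otimes> inv (inv f \<otimes> g) = h \<otimes> z \<otimes> inv h"
    using parabolic_reflection[OF J, of "inv f \<otimes> g" x] f g x r(2) e by auto
  have hc: "h \<in> carrier W" and zc: "z \<in> carrier W" using generate_closed[OF J h(1)] h(2) J by auto
  have "conjugate x (h \<otimes> z \<otimes> inv h)"
    unfolding h(3)[symmetric] using f g by (intro conjugateI) simp
  moreover have "conjugate (h \<otimes> z \<otimes> inv h) z" by (rule conjugate_sym[OF zc conjugateI[OF hc]])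
  ultimately have "conjugate x z" by (rule conjugate_trans[OF S_closed[OF x]])
  then show thesis by (rule that[OF h(2)])
qed

end

context odd_pair
begin

lemma subset_of_finite_edges:
  assumes "J \<subseteq> S" "t \<in> J" "\<And>x y. x \<in> J \<Longrightarrow> y \<in> J \<Longrightarrow> ord (x \<otimes> y) \<noteq> 0"
  shows "J \<subseteq> {s, t}"
  using assms neighbours_t by blast

end

section \<open>Finite edges leaving a class in the second system\<close>

context two_systems
begin

lemma other_system_odd:
  assumes O: "odd_pair W S p q T"
    and s: "s \<in> S'" "conjugate p s" and t: "t \<in> S'" "conjugate p t"
  shows "odd (ord (s \<otimes> t))"
proof -
  interpret O: odd_pair W S p q T by (rule O)
  have "ord (s \<otimes> t) dvd ord (p \<otimes> q)"
    by (rule pair_class_ord_dvd[OF O.s O.t O.pair_class O.odd_ord s t])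
  then show ?thesis using O.odd_ord by (metis dvd_trans)
qed

lemma conjugator:
  assumes p: "p \<in> carrier W" and c: "conjugate p s"
  obtains g where "g \<in> carrier W" "s = g \<otimes> p \<otimes> inv g"
  using c that by (auto simp: conjugate_def)

lemma not_conjugate_partner:
  assumes p: "p \<in> S" and ps: "conjugate p s" and u: "u \<in> S'" and su: "\<not> conjugate s u"
  obtains h k where "h \<in> carrier W" "k \<in> S" "u = h \<otimes> k \<otimes> inv h" "\<not> conjugate p k"
proof -
  obtain h k where h: "h \<in> carrier W" "k \<in> S" "u = h \<otimes> k \<otimes> inv h" using partner'[OF u] .
  have "\<not> conjugate p k"
  proof
    assume pk: "conjugate p k"
    have "conjugate k u" unfolding h(3) by (rule conjugateI[OF h(1)])
    then have "conjugate p u" by (rule conjugate_trans[OF S_closed[OF p] pk])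
    moreover have "conjugate s p" by (rule conjugate_sym[OF S_closed[OF p] ps])
    ultimately have "conjugate s u"
      using conjugate_trans[OF conjugate_closed[OF S_closed[OF p] ps]] by metis
    then show False using su by simp
  qed
  then show thesis by (rule that[OF h])
qed

text \<open>The case of a common neighbour. The finite group of s and t is conjugate into some W_J
  of the first system with only finite edges. If J misses the leaf q, it has at most one generator
  of the class, and the retraction would identify s with t; so J contains q and hence lies in {p,
  q}.\<close>

lemma tight_same:
  assumes O: "odd_pair W S p q T"
    and s: "s \<in> S'" "conjugate p s" and t: "t \<in> S'" "conjugate p t" and ne: "s \<noteq> t"
    and u: "u \<in> S'" "\<not> conjugate s u" and fin: "ord (s \<otimes> u) \<noteq> 0" "ord (t \<otimes> u) \<noteq> 0"
  shows False
proof -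
  interpret O: odd_pair W S p q T by (rule O)
  have p: "p \<in> S" by (rule O.s)
  interpret P: involution_pair W s t by (rule B.S_pair[OF s(1) t(1)])
  have "ord (s \<otimes> t) \<noteq> 0" using other_system_odd[OF O s t] by (metis even_zero)
  then have finF: "finite (generate W {s, t})" by (rule P.finite_generate)
  have "subgroup (generate W {s, t}) W" using s t by (intro generate_is_subgroup) auto
  then obtain f J where f: "f \<in> carrier W" and J: "J \<subseteq> S"
    and Jfin: "\<And>x y. x \<in> J \<Longrightarrow> y \<in> J \<Longrightarrow> ord (x \<otimes> y) \<noteq> 0"
    and in_J: "\<And>h. h \<in> generate W {s, t} \<Longrightarrow> inv f \<otimes> h \<otimes> f \<in> generate W J"
    using finite_subgroup_parabolic[OF _ finF] by blast
  have "J \<subseteq> {p, q}"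
  proof (cases "q \<in> J")
    case True
    then show ?thesis using O.subset_of_finite_edges[OF J] Jfin by blast
  next
    case False
    obtain \<phi> where \<phi>: "retracts (conj_class p) \<phi>" using class_retracts[of p] p by blast
    have e: "\<phi> s = s" "\<phi> t = t" using \<phi> s t by (auto simp: retracts_def conj_class_def)
    have "\<phi> s = \<phi> t"
    proof (rule retracts_unique_image[OF \<phi> J _ f _ _ in_J[OF P.a_in] in_J[OF P.b_in]])
      fix x y assume "x \<in> J \<inter> conj_class p" "y \<in> J \<inter> conj_class p"
      then have "x \<in> {p, q}" "y \<in> {p, q}" "x \<in> J" "y \<in> J"
        using O.pair_class J by (auto simp: conj_class_def)
      then show "x = y" using False by auto
    qed (use e s t B.S_nontrivial in auto)
    then show ?thesis using e ne by simp
  qed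
  then have "generate W J \<subseteq> generate W {p, q}" by (rule mono_generate)
  then have st: "inv f \<otimes> s \<otimes> f \<in> generate W {p, q}" "inv f \<otimes> t \<otimes> f \<in> generate W {p, q}"
    using in_J[OF P.a_in] in_J[OF P.b_in] by auto
  obtain g where g: "g \<in> carrier W" "s = g \<otimes> p \<otimes> inv g" using conjugator[OF S_closed[OF p] s(2)] .
  obtain g' where g': "g' \<in> carrier W" "t = g' \<otimes> p \<otimes> inv g'" using conjugator[OF S_closed[OF p] t(2)] .
  obtain h k where h: "h \<in> carrier W" "k \<in> S" "u = h \<otimes> k \<otimes> inv h" "\<not> conjugate p k"
    using not_conjugate_partner[OF p s(2) u] .
  show False
    by (rule O.no_common_neighbour[OF f g(1) g'(1) g(2) g'(2) ne st h fin])
qed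

text \<open>Two finite edges leaving a class at different ends would put the reflections s, u and the
  transported v into one conjugate of the parabolic subgroup attached to the pair.\<close>

lemma finite_edges_common:
  assumes O: "odd_pair W S p q T"
    and s: "s \<in> S'" "conjugate p s" and t: "t \<in> S'" "conjugate p t"
    and u: "u \<in> S'" "\<not> conjugate s u" and v: "v \<in> S'" "\<not> conjugate s v"
    and fin: "ord (s \<otimes> u) \<noteq> 0" "ord (t \<otimes> v) \<noteq> 0"
  obtains g w where "g \<in> carrier W" "w \<in> generate W {s, t}"
    "inv g \<otimes> s \<otimes> g \<in> generate W T" "inv g \<otimes> u \<otimes> g \<in> generate W T"
    "inv g \<otimes> (w \<otimes> v \<otimes> inv w) \<otimes> g \<in> generate W T"
proof -
  interpret O: odd_pair W S p q T by (rule O)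
  have p: "p \<in> S" by (rule O.s)
  interpret P: involution_pair W t s by (rule B.S_pair[OF t(1) s(1)])
  have "odd (ord (t \<otimes> s))" by (rule other_system_odd[OF O t s])
  then obtain w where w: "w \<in> generate W {t, s}" "s = w \<otimes> t \<otimes> inv w" by (rule P.odd_conjugate)
  have wc: "w \<in> carrier W" using w(1) B.generate_closed[of "{t, s}"] s t by auto
  obtain g where g: "g \<in> carrier W" "s = g \<otimes> p \<otimes> inv g" using conjugator[OF S_closed[OF p] s(2)] .
  have gs: "inv g \<otimes> s \<otimes> g = p" unfolding g(2) using conj_inv_cancel(1)[OF g(1), of p] p by simp
  have t_eq: "t = (inv w \<otimes> g) \<otimes> p \<otimes> inv (inv w \<otimes> g)"
  proof -
    have "t = inv w \<otimes> s \<otimes> w" unfolding w(2) using conj_inv_cancel(1)[OF wc, of t] t by simp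
    also have "\<dots> = (inv w \<otimes> g) \<otimes> p \<otimes> inv (inv w \<otimes> g)"
      unfolding g(2) using conj_mult[of "inv w" g p] wc g(1) p by simp
    finally show ?thesis .
  qed
  obtain h k where h: "h \<in> carrier W" "k \<in> S" "u = h \<otimes> k \<otimes> inv h" "\<not> conjugate p k"
    using not_conjugate_partner[OF p s(2) u] .
  obtain h' k' where h': "h' \<in> carrier W" "k' \<in> S" "v = h' \<otimes> k' \<otimes> inv h'" "\<not> conjugate p k'"
    using not_conjugate_partner[OF p s(2) v] .
  have "inv g \<otimes> u \<otimes> g \<in> generate W T"
    by (rule O.finite_neighbour_parabolic[OF g(1) h(1,2) g(2) h(3,4) fin(1)])
  moreover have "inv (inv w \<otimes> g) \<otimes> v \<otimes> (inv w \<otimes> g) \<in> generate W T"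
    using O.finite_neighbour_parabolic[OF _ h'(1,2) t_eq h'(3,4) fin(2)] wc g(1) by simp
  then have "inv g \<otimes> (w \<otimes> v \<otimes> inv w) \<otimes> g \<in> generate W T"
    using wc g(1) v(1) by (simp add: inv_mult_group m_assoc)
  moreover have "p \<in> generate W T" using O.T(2) by (rule generate.incl)
  moreover have "w \<in> generate W {s, t}" using w(1) by (simp add: insert_commute)
  ultimately show thesis using that[OF g(1)] gs by simp
qed

text \<open>The case of conjugate neighbours. The retraction onto the class of u kills s and t,
  hence w, and so it sends w v inv w to v. Both u and w v inv w lie in one conjugate of W_T, where T
  has at most one generator of that class; therefore u = v, the case already settled.\<close>

lemma tight_same_class:
  assumes O: "odd_pair W S p q T"
    and s: "s \<in> S'" "conjugate p s" and t: "t \<in> S'" "conjugate p t" and ne: "s \<noteq> t"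
    and u: "u \<in> S'" "\<not> conjugate s u" and v: "v \<in> S'" "\<not> conjugate s v" and uv: "conjugate u v"
    and fin: "ord (s \<otimes> u) \<noteq> 0" "ord (t \<otimes> v) \<noteq> 0"
  shows False
proof -
  interpret O: odd_pair W S p q T by (rule O)
  obtain g w where g: "g \<in> carrier W" "w \<in> generate W {s, t}"
    "inv g \<otimes> s \<otimes> g \<in> generate W T" "inv g \<otimes> u \<otimes> g \<in> generate W T"
    "inv g \<otimes> (w \<otimes> v \<otimes> inv w) \<otimes> g \<in> generate W T"
    using finite_edges_common[OF O s t u v fin] .
  have wc: "w \<in> carrier W" using g(2) B.generate_closed[of "{s, t}"] s t by auto
  obtain \<phi> where \<phi>: "retracts (conj_class u) \<phi>" using class_retracts[of u] u by blast
  have h: "\<phi> \<in> hom W W" using \<phi> by (simp add: retracts_def)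
  have uc: "u \<in> carrier W" using u(1) by simp
  have e: "\<phi> u = u" "\<phi> v = v" using \<phi> u(1) v(1) uv by (auto simp: retracts_def conj_class_def)
  have st: "conjugate s t"
    by (rule conjugate_trans[OF _ conjugate_sym[OF S_closed[OF O.s] s(2)] t(2)]) (use s in simp)
  have "s \<notin> conj_class u"
    using conjugate_sym[OF uc, of s] u(2) by (auto simp: conj_class_def)
  moreover have "t \<notin> conj_class u"
  proof
    assume "t \<in> conj_class u"
    then have "conjugate t u" using conjugate_sym[OF uc, of t] by (simp add: conj_class_def)
    then have "conjugate s u" using conjugate_trans[OF _ st] s(1) by simp
    then show False using u(2) by simp
  qed
  ultimately have "\<phi> ` {s, t} \<subseteq> {\<one>, \<one>}" using \<phi> s t by (auto simp: retracts_def)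
  moreover have "\<phi> w \<in> generate W (\<phi> ` {s, t})" using hom_generate[OF h _ g(2)] s t by simp
  ultimately have "\<phi> w = \<one>" using generate_involution[of \<one>] by auto
  then have ev: "\<phi> (w \<otimes> v \<otimes> inv w) = v" using hom_conj[OF h wc, of v] e v(1) by simp
  have "\<phi> u = \<phi> (w \<otimes> v \<otimes> inv w)"
  proof (rule retracts_unique_image[OF \<phi> O.T(1) _ g(1) _ _ g(4,5)])
    fix x y assume xy: "x \<in> T \<inter> conj_class u" "y \<in> T \<inter> conj_class u"
    then have "conjugate x u" "conjugate u y"
      using conjugate_sym[OF uc, of x] by (auto simp: conj_class_def)
    moreover have "x \<in> carrier W" using xy O.T(1) by blast
    ultimately have "conjugate x y" using conjugate_trans by metis
    then show "x = y" using O.T_classes xy by blast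
  qed (use e ev u v wc B.S_nontrivial in auto)
  then have "u = v" using e ev by simp
  then show False using tight_same[OF O s t ne u] fin by blast
qed

lemma finite_conj_subgroup:
  assumes "subgroup H W" "finite H" "g \<in> carrier W"
  shows "subgroup {k \<in> carrier W. inv g \<otimes> k \<otimes> g \<in> H} W" "finite {k \<in> carrier W. inv g \<otimes> k \<otimes> g \<in> H}"
proof -
  let ?F = "{k \<in> carrier W. inv g \<otimes> k \<otimes> g \<in> H}"
  show "subgroup ?F W"
  proof (rule subgroupI)
    have "inv g \<otimes> \<one> \<otimes> g = \<one>" using assms(3) by simp
    then have "\<one> \<in> ?F" using subgroup.one_closed[OF assms(1)] by simp
    then show "?F \<noteq> {}" by blast
  next
    fix k assume k: "k \<in> ?F"
    have "inv g \<otimes> inv k \<otimes> g = inv (inv g \<otimes> k \<otimes> g)"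
      using k assms(3) by (simp add: inv_mult_group m_assoc)
    then show "inv k \<in> ?F" using k subgroup.m_inv_closed[OF assms(1)] by simp
  next
    fix k l assume k: "k \<in> ?F" and l: "l \<in> ?F"
    have "inv g \<otimes> (k \<otimes> l) \<otimes> g = (inv g \<otimes> k \<otimes> g) \<otimes> (inv g \<otimes> l \<otimes> g)"
      using conj_conj_prod[of "inv g" k l] k l assms(3) by simp
    then show "k \<otimes> l \<in> ?F" using k l subgroup.m_closed[OF assms(1)] by simp
  qed auto
  have "?F \<subseteq> (\<lambda>h. g \<otimes> h \<otimes> inv g) ` H"
  proof
    fix k assume k: "k \<in> ?F"
    then have "k = g \<otimes> (inv g \<otimes> k \<otimes> g) \<otimes> inv g" using conj_inv_cancel(2)[OF assms(3)] by simp
    then show "k \<in> (\<lambda>h. g \<otimes> h \<otimes> inv g) ` H" using k by blast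
  qed
  then show "finite ?F" using assms(2) by (meson finite_imageI finite_subset)
qed

text \<open>The conjugate of W_T containing s, u and w v inv w is finite, so it is conjugate into a
  parabolic subgroup of S' with only finite edges. That one contains generators x, y, z conjugate to
  s, u, v. Since x is s or t, either s has a finite edge to z, a conjugate of v, or t has one to y,
  a conjugate of u; both are excluded by the case of conjugate neighbours.\<close>

lemma tight_pair_class:
  assumes O: "odd_pair W S p q T"
    and s: "s \<in> S'" "conjugate p s" and t: "t \<in> S'" "conjugate p t" and ne: "s \<noteq> t"
    and u: "u \<in> S'" "\<not> conjugate s u" and v: "v \<in> S'" "\<not> conjugate s v"
    and fin: "ord (s \<otimes> u) \<noteq> 0" "ord (t \<otimes> v) \<noteq> 0"
  shows False
proof -
  interpret O: odd_pair W S p q T by (rule O)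
  obtain g w where g: "g \<in> carrier W" "w \<in> generate W {s, t}"
    "inv g \<otimes> s \<otimes> g \<in> generate W T" "inv g \<otimes> u \<otimes> g \<in> generate W T"
    "inv g \<otimes> (w \<otimes> v \<otimes> inv w) \<otimes> g \<in> generate W T"
    using finite_edges_common[OF O s t u v fin] .
  have wc: "w \<in> carrier W" using g(2) B.generate_closed[of "{s, t}"] s t by auto
  let ?F = "{k \<in> carrier W. inv g \<otimes> k \<otimes> g \<in> generate W T}"
  obtain f J where f: "f \<in> carrier W" and J: "J \<subseteq> S'"
    and Jfin: "\<And>x y. x \<in> J \<Longrightarrow> y \<in> J \<Longrightarrow> ord (x \<otimes> y) \<noteq> 0"
    and in_J: "\<And>h. h \<in> ?F \<Longrightarrow> inv f \<otimes> h \<otimes> f \<in> generate W J"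
    by (rule B.finite_subgroup_parabolic[OF finite_conj_subgroup[OF O.subgroup_T O.T(4) g(1)]])
      (rule that)
  have F: "s \<in> ?F" "u \<in> ?F" "w \<otimes> v \<otimes> inv w \<in> ?F" using g(3-5) s u v wc by auto
  have sc: "s \<in> carrier W" and uc: "u \<in> carrier W" and vc: "v \<in> carrier W" using s u v by auto
  obtain x where x: "x \<in> J" "conjugate s x"
    using B.parabolic_meets_class[OF J f one_closed s(1) _ in_J[OF F(1)]] sc by auto
  obtain y where y: "y \<in> J" "conjugate u y"
    using B.parabolic_meets_class[OF J f one_closed u(1) _ in_J[OF F(2)]] uc by auto
  obtain z where z: "z \<in> J" "conjugate v z"
    using B.parabolic_meets_class[OF J f wc v(1) refl in_J[OF F(3)]] by blast
  have S': "x \<in> S'" "y \<in> S'" "z \<in> S'" using J x(1) y(1) z(1) by auto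
  have "conjugate p x" by (rule conjugate_trans[OF S_closed[OF O.s] s(2) x(2)])
  then have "x = s \<or> x = t"
    using pair_class_size[OF O.s O.t O.pair_class odd_imp_conjugate[OF O.s O.t O.odd_ord]
      s(1) t(1) S'(1) s(2) t(2)] ne by auto
  then show False
  proof
    assume "x = s"
    have sz: "\<not> conjugate s z"
      using conjugate_trans[OF sc, of z v] conjugate_sym[OF vc z(2)] v(2) by blast
    have zv: "conjugate z v" by (rule conjugate_sym[OF vc z(2)])
    show False
      by (rule tight_same_class[OF O s t ne S'(3) sz v zv]) (use Jfin[OF x(1) z(1)] \<open>x = s\<close> fin in auto)
  next
    assume "x = t"
    have sy: "\<not> conjugate s y"
      using conjugate_trans[OF sc, of y u] conjugate_sym[OF uc y(2)] u(2) by blast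
    show False
      by (rule tight_same_class[OF O s t ne u S'(2) sy y(2)]) (use Jfin[OF x(1) y(1)] \<open>x = t\<close> fin in auto)
  qed
qed

text \<open>A class with a single generator in S has a single one in S'. Two conjugate generators of
  S' therefore come with two conjugate generators of S, and their odd pair supplies the
  leaf.\<close>

theorem tight_other_system:
  assumes pairs: "\<And>x y. x \<in> S \<Longrightarrow> y \<in> S \<Longrightarrow> x \<noteq> y \<Longrightarrow> conjugate x y \<Longrightarrow>
      \<exists>p q T. conjugate x p \<and> odd_pair W S p q T"
  shows "tight S'"
  unfolding tight_def
proof (intro ballI impI, rule ccontr)
  fix s t u v assume st: "s \<in> S'" "t \<in> S'" "s \<noteq> t" "conjugate s t"
    and u: "u \<in> S'" "\<not> conjugate s u" and v: "v \<in> S'" "\<not> conjugate s v"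
    and "\<not> (ord (s \<otimes> u) = 0 \<or> ord (t \<otimes> v) = 0)"
  then have fin: "ord (s \<otimes> u) \<noteq> 0" "ord (t \<otimes> v) \<noteq> 0" by auto
  have sc: "s \<in> carrier W" using st(1) by simp
  obtain x where x: "x \<in> S" "conjugate s x"
    using two_systems.partner_conjugate[OF swap st(1)] by blast
  have xs: "conjugate x s" by (rule conjugate_sym[OF sc x(2)])
  have xt: "conjugate x t" by (rule conjugate_trans[OF S_closed[OF x(1)] xs st(4)])
  obtain y where y: "y \<in> S" "conjugate x y" "y \<noteq> x"
    using single_class[OF x(1) _ st(1,2) xs xt] st(3) by blast
  obtain p q T where p: "conjugate x p" and O: "odd_pair W S p q T"
    using pairs[OF x(1) y(1) _ y(2)] y(3) by metis
  have pc: "p \<in> carrier W" by (rule conjugate_closed[OF S_closed[OF x(1)] p])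
  have px: "conjugate p x" by (rule conjugate_sym[OF S_closed[OF x(1)] p])
  have ps: "conjugate p s" by (rule conjugate_trans[OF pc px xs])
  have pt: "conjugate p t" by (rule conjugate_trans[OF pc px xt])
  show False by (rule tight_pair_class[OF O st(1) ps st(2) pt st(3) u v fin])
qed

text \<open>Tits's theorem in S' places x and y in a conjugate of some W_J with only finite edges.
  By tightness J meets the two classes in x' and y' only, so the retraction \<phi> onto these
  classes carries x and y to reflections in one conjugate of the dihedral group of x' and y'. Hence
  \<phi>(x y) is killed by the order of x' y', and applying the retraction \<psi> of the first
  system recovers x y.\<close>

theorem finite_edge_transfer:
  assumes tight: "tight S'" and x: "x \<in> S" and y: "y \<in> S" and nc: "\<not> conjugate x y"
    and fin: "ord (x \<otimes> y) \<noteq> 0"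
  obtains x' y' where "x' \<in> S'" "y' \<in> S'" "conjugate x x'" "conjugate y y'"
    "ord (x' \<otimes> y') \<noteq> 0" "ord (x \<otimes> y) dvd ord (x' \<otimes> y')"
proof -
  have xc: "x \<in> carrier W" and yc: "y \<in> carrier W" using x y by auto
  interpret P: involution_pair W x y by (rule S_pair[OF x y])
  have finF: "finite (generate W {x, y})" by (rule P.finite_generate[OF fin])
  have subF: "subgroup (generate W {x, y}) W" using xc yc by (intro generate_is_subgroup) auto
  obtain f J where f: "f \<in> carrier W" and J: "J \<subseteq> S'"
    and Jfin: "\<And>x y. x \<in> J \<Longrightarrow> y \<in> J \<Longrightarrow> ord (x \<otimes> y) \<noteq> 0"
    and in_J: "\<And>h. h \<in> generate W {x, y} \<Longrightarrow> inv f \<otimes> h \<otimes> f \<in> generate W J"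
    by (rule B.finite_subgroup_parabolic[OF subF finF]) (rule that)
  have meets: "\<exists>z\<in>J. conjugate a z" if a: "a \<in> S" "inv f \<otimes> a \<otimes> f \<in> generate W J" for a
  proof -
    obtain g b where g: "g \<in> carrier W" "b \<in> S'" "a = g \<otimes> b \<otimes> inv g" using partner[OF a(1)] .
    obtain z where z: "z \<in> J" "conjugate b z"
      using B.parabolic_meets_class[OF J f g a(2)] .
    have "conjugate b a" unfolding g(3) by (rule conjugateI[OF g(1)])
    then have "conjugate a b" using conjugate_sym g(2) by simp
    then have "conjugate a z" by (rule conjugate_trans[OF S_closed[OF a(1)] _ z(2)])
    then show ?thesis using z(1) by blast
  qed
  obtain x' where x': "x' \<in> J" "conjugate x x'" using meets[OF x in_J[OF P.a_in]] by blast
  obtain y' where y': "y' \<in> J" "conjugate y y'" using meets[OF y in_J[OF P.b_in]] by blast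
  have S': "x' \<in> S'" "y' \<in> S'" using J x'(1) y'(1) by auto
  have nc': "\<not> conjugate x' y'"
  proof
    assume "conjugate x' y'"
    then have "conjugate x y'" by (rule conjugate_trans[OF xc x'(2)])
    then show False using conjugate_trans[OF xc, of y' y] conjugate_sym[OF yc y'(2)] nc by blast
  qed
  have x'c: "x' \<in> carrier W" and y'c: "y' \<in> carrier W" using S' by auto
  have nc'': "\<not> conjugate y' x'" using nc' conjugate_sym[OF y'c] by blast
  let ?C = "conj_class x \<union> conj_class y"
  \<comment> \<open>A second member of the class of x' in J would also have a finite edge to y',
    which tightness forbids.\<close>
  have JC: "J \<inter> ?C \<subseteq> {x', y'}"
  proof
    fix z assume z: "z \<in> J \<inter> ?C"
    then have zS: "z \<in> S'" using J by blast
    consider "conjugate x z" | "conjugate y z" using z by (auto simp: conj_class_def)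
    then show "z \<in> {x', y'}"
    proof cases
      case 1
      have "conjugate x' z" by (rule conjugate_trans[OF x'c conjugate_sym[OF xc x'(2)] 1])
      then show ?thesis
        using tightD[OF tight S'(1) zS S'(2) S'(2) _ _ nc' nc'] Jfin x' y' z by blast
    next
      case 2
      have "conjugate y' z" by (rule conjugate_trans[OF y'c conjugate_sym[OF yc y'(2)] 2])
      then show ?thesis
        using tightD[OF tight S'(2) zS S'(1) S'(1) _ _ nc'' nc''] Jfin x' y' z by blast
    qed
  qed
  have Cconj: "g \<otimes> z \<otimes> inv g \<in> ?C" if "z \<in> ?C" "g \<in> carrier W" for z g
    using that class_conj[OF xc] class_conj[OF yc] by blast
  obtain \<phi> where \<phi>: "retracts ?C \<phi>" using retracts_exists[OF Cconj] by blast
  obtain \<psi> where \<psi>: "two_systems.retracts W S' S ?C \<psi>"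
    using two_systems.retracts_exists[OF swap Cconj] by blast
  have \<phi>h: "\<phi> \<in> hom W W" and \<phi>S': "\<And>z. z \<in> S' \<Longrightarrow> \<phi> z = (if z \<in> ?C then z else \<one>)"
    using \<phi> by (auto simp: retracts_def)
  have \<psi>h: "\<psi> \<in> hom W W" and \<psi>S: "\<And>z. z \<in> S \<Longrightarrow> \<psi> z = (if z \<in> ?C then z else \<one>)"
    and \<psi>S': "\<And>z. z \<in> S' \<Longrightarrow> z \<notin> ?C \<Longrightarrow> \<psi> z = \<one>"
    using \<psi> by (auto simp: two_systems.retracts_def[OF swap])
  have \<phi>c: "\<phi> g \<in> carrier W" if "g \<in> carrier W" for g using hom_in_carrier[OF \<phi>h that] .
  have \<psi>c: "\<psi> g \<in> carrier W" if "g \<in> carrier W" for g using hom_in_carrier[OF \<psi>h that] .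
  \<comment> \<open>On the generators of S', \<phi> kills only those outside the two classes, and
    \<psi> kills these as well.\<close>
  have \<psi>\<phi>: "\<psi> (\<phi> g) = \<psi> g" if "g \<in> carrier W" for g
    using that
  proof (induction rule: B.coxeter_induct)
    case one
    then show ?case using hom_one[OF \<phi>h is_group is_group] by simp
  next
    case (step h z)
    have "\<psi> (\<phi> z) = \<psi> z"
      using \<phi>S'[OF step(2)] \<psi>S'[OF step(2)] hom_one[OF \<psi>h is_group is_group] by simp
    then show ?case using step \<phi>c by (simp add: hom_mult[OF \<phi>h] hom_mult[OF \<psi>h])
  qed
  interpret Q: involution_pair W x' y' by (rule B.S_pair[OF S'])
  \<comment> \<open>The parity character of S' separates the reflections of the dihedral group from
    its rotations.\<close>
  obtain \<chi> :: "'a \<Rightarrow> int" where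
    \<chi>: "\<And>g h. g \<in> carrier W \<Longrightarrow> h \<in> carrier W \<Longrightarrow> \<chi> (g \<otimes> h) = \<chi> g * \<chi> h"
    "\<And>g. g \<in> carrier W \<Longrightarrow> \<chi> g = 1 \<or> \<chi> g = -1" "\<And>s. s \<in> S' \<Longrightarrow> \<chi> s = -1"
    by (rule B.parity_character) (rule that)
  have \<chi>conj: "\<chi> (g \<otimes> z \<otimes> inv g) = \<chi> z" if "g \<in> carrier W" "z \<in> carrier W" for g z
  proof -
    have "(g \<otimes> z \<otimes> inv g) \<otimes> g = g \<otimes> z" using that by (simp add: m_assoc)
    then have "\<chi> (g \<otimes> z \<otimes> inv g) * \<chi> g = \<chi> g * \<chi> z"
      using \<chi>(1)[of "g \<otimes> z \<otimes> inv g" g] \<chi>(1)[of g z] that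
      by (metis inv_closed m_closed)
    then show ?thesis using \<chi>(2)[OF that(1)] by auto
  qed
  have \<chi>rot: "\<chi> (Q.c [^] (i::int)) = 1" for i
  proof -
    have c: "\<chi> Q.c = 1" using \<chi>(1)[OF x'c y'c] \<chi>(3) S' by simp
    have one: "\<chi> \<one> = 1" using \<chi>(1)[of \<one> \<one>] \<chi>(2)[of \<one>] by auto
    have nat: "\<chi> (Q.c [^] (n::nat)) = 1" for n
      by (induction n) (simp_all add: one c \<chi>(1))
    have "\<chi> (inv (Q.c [^] (n::nat))) = 1" for n
      using \<chi>(1)[of "Q.c [^] n" "inv (Q.c [^] n)"] nat one by simp
    then show ?thesis
      using nat by (cases i rule: int_cases2) (simp_all add: int_pow_int int_pow_neg_int)
  qed
  have form: "\<exists>i::int. \<phi> a = \<phi> f \<otimes> (Q.c [^] i \<otimes> x') \<otimes> inv (\<phi> f)"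
    if a: "a \<in> S" "a \<in> ?C" "a \<in> generate W {x, y}" for a
  proof -
    have ac: "a \<in> carrier W" using a(1) by simp
    have k: "inv f \<otimes> a \<otimes> f \<in> generate W J" by (rule in_J[OF a(3)])
    define X where "X = \<phi> (inv f \<otimes> a \<otimes> f)"
    have "\<phi> ` J \<subseteq> generate W {x', y'}"
    proof
      fix b assume "b \<in> \<phi> ` J"
      then obtain z where z: "z \<in> J" "b = \<phi> z" by blast
      show "b \<in> generate W {x', y'}"
      proof (cases "z \<in> ?C")
        case True
        then have "b = z" "z \<in> {x', y'}" using \<phi>S'[of z] z J JC by auto
        then show ?thesis by (auto intro: generate.incl)
      next
        case False
        then show ?thesis using \<phi>S'[of z] z J by (auto simp: generate.one)
      qed
    qed
    moreover have "subgroup (generate W {x', y'}) W" using S' by (intro generate_is_subgroup) auto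
    ultimately have "generate W (\<phi> ` J) \<subseteq> generate W {x', y'}" by (rule generate_subgroup_incl)
    then have X: "X \<in> generate W {x', y'}"
      using hom_generate[OF \<phi>h _ k] J B.S_carrier unfolding X_def by blast
    have a_eq: "a = f \<otimes> (inv f \<otimes> a \<otimes> f) \<otimes> inv f" using conj_inv_cancel(2)[OF f ac] by simp
    have \<phi>a: "\<phi> a = \<phi> f \<otimes> X \<otimes> inv (\<phi> f)"
      unfolding X_def by (subst a_eq) (rule hom_conj[OF \<phi>h f], use f ac in simp)
    have Xc: "X \<in> carrier W" unfolding X_def using \<phi>c f ac by simp
    obtain g b where g: "g \<in> carrier W" "b \<in> S'" "a = g \<otimes> b \<otimes> inv g" using partner[OF a(1)] .
    have "b \<in> ?C"
    proof -
      have "b = inv g \<otimes> a \<otimes> inv (inv g)" unfolding g(3) using conj_inv_cancel(1)[OF g(1), of b] g by simp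
      then show ?thesis using Cconj[OF a(2), of "inv g"] g(1) by simp
    qed
    then have "\<phi> a = \<phi> g \<otimes> b \<otimes> inv (\<phi> g)" unfolding g(3) using hom_conj[OF \<phi>h g(1), of b] \<phi>S'[OF g(2)] g(2) by simp
    then have "\<chi> (\<phi> a) = -1" using \<chi>conj[OF \<phi>c[OF g(1)], of b] \<chi>(3)[OF g(2)] g(2) by simp
    then have \<chi>X: "\<chi> X = -1" unfolding \<phi>a using \<chi>conj[OF \<phi>c[OF f] Xc] by simp
    show ?thesis
      using X
    proof (cases rule: Q.generate_cases)
      case (1 i)
      then show ?thesis using \<chi>X \<chi>rot[of i] by simp
    next
      case (2 i)
      then show ?thesis using \<phi>a by blast
    qed
  qed
  have xC: "x \<in> ?C" and yC: "y \<in> ?C" using xc yc by (auto simp: conj_class_def)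
  obtain i :: int where i: "\<phi> x = \<phi> f \<otimes> (Q.c [^] i \<otimes> x') \<otimes> inv (\<phi> f)"
    using form[OF x xC P.a_in] by blast
  obtain j :: int where j: "\<phi> y = \<phi> f \<otimes> (Q.c [^] j \<otimes> x') \<otimes> inv (\<phi> f)"
    using form[OF y yC P.b_in] by blast
  let ?n = "ord (x' \<otimes> y')"
  have "\<phi> (x \<otimes> y) = \<phi> f \<otimes> Q.c [^] (i - j) \<otimes> inv (\<phi> f)"
    using hom_mult[OF \<phi>h xc yc] conj_conj_prod[OF \<phi>c[OF f]] x'c y'c Q.refl_mult[of i j] unfolding i j by simp
  then have "\<phi> (x \<otimes> y) [^] int ?n = \<phi> f \<otimes> Q.c [^] ((i - j) * int ?n) \<otimes> inv (\<phi> f)"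
    using int_pow_conj[OF \<phi>c[OF f], of "Q.c [^] (i - j)" "int ?n"] x'c y'c by (simp add: int_pow_pow)
  also have "Q.c [^] ((i - j) * int ?n) = \<one>" using x'c y'c by (simp add: int_pow_eq_id)
  finally have "\<phi> (x \<otimes> y) [^] ?n = \<one>" using \<phi>c[OF f] by (simp add: int_pow_int)
  moreover have "\<psi> (\<phi> (x \<otimes> y)) = x \<otimes> y"
    using \<psi>\<phi>[of "x \<otimes> y"] hom_mult[OF \<psi>h xc yc] \<psi>S[OF x] \<psi>S[OF y] xC yC xc yc by simp
  moreover have "\<psi> (\<phi> (x \<otimes> y) [^] ?n) = \<psi> (\<phi> (x \<otimes> y)) [^] ?n"
  proof -
    interpret h: group_hom W W \<psi> using \<psi>h by unfold_locales
    show ?thesis using \<phi>c xc yc by (simp add: h.hom_nat_pow)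
  qed
  ultimately have "(x \<otimes> y) [^] ?n = \<one>" using hom_one[OF \<psi>h is_group is_group] by simp
  then have "ord (x \<otimes> y) dvd ?n" using xc yc by (simp add: pow_eq_id)
  then show thesis using that[OF S' x'(2) y'(2) Jfin[OF x'(1) y'(1)]] by blast
qed

end

section \<open>Matching the generators\<close>

text \<open>The generator at which all finite edges leaving its class start. A class without such
  edges has every member as a hub, so a choice is made later.\<close>

definition (in group) hub :: "'a set \<Rightarrow> 'a \<Rightarrow> bool" where
  "hub S d \<longleftrightarrow> d \<in> S \<and> (\<forall>x\<in>S. conjugate d x \<longrightarrow> x \<noteq> d \<longrightarrow> (\<forall>u\<in>S. \<not> conjugate x u \<longrightarrow> ord (x \<otimes> u) = 0))"

lemma (in group) hubD:
  "hub S d \<Longrightarrow> x \<in> S \<Longrightarrow> conjugate d x \<Longrightarrow> u \<in> S \<Longrightarrow> \<not> conjugate x u \<Longrightarrow> ord (x \<otimes> u) \<noteq> 0 \<Longrightarrow> x = d"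
  unfolding hub_def by metis

lemma (in coxeter) hub_exists:
  assumes "tight S" and c: "c \<in> S"
  shows "\<exists>d. conjugate c d \<and> hub S d"
proof (cases "\<exists>d\<in>S. conjugate c d \<and> (\<exists>v\<in>S. \<not> conjugate d v \<and> ord (d \<otimes> v) \<noteq> 0)")
  case True
  then obtain d v where d: "d \<in> S" "conjugate c d" "v \<in> S" "\<not> conjugate d v" "ord (d \<otimes> v) \<noteq> 0" by blast
  have dc: "d \<in> carrier W" using d(1) by simp
  have "ord (x \<otimes> u) = 0" if x: "x \<in> S" "conjugate d x" "x \<noteq> d" and u: "u \<in> S" "\<not> conjugate x u" for x u
  proof -
    have "\<not> conjugate d u"
      using conjugate_trans[OF S_closed[OF x(1)], of d u] conjugate_sym[OF dc x(2)] u(2) by blast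
    then show ?thesis using tightD[OF assms(1) d(1) x(1) d(3) u(1) _ x(2) d(4)] x(3) d(5) by blast
  qed
  then have "hub S d" using d(1) by (simp add: hub_def)
  then show ?thesis using d(2) by blast
next
  case False
  have "ord (x \<otimes> u) = 0" if "x \<in> S" "conjugate c x" "u \<in> S" "\<not> conjugate x u" for x u
    using False that by blast
  then have "hub S c" using c by (simp add: hub_def)
  moreover have "conjugate c c" using c by simp
  ultimately show ?thesis by blast
qed

text \<open>Hubs are matched with hubs, and in a class of two the other members with each other.
  Finite edges between different classes join hubs in both systems, so transferring an edge forth
  and back gives divisibility of orders both ways. Inside a class both divisibilities come from the
  retraction onto it.\<close>

theorem (in two_systems) matching_exists:
  assumes tight: "tight S" "tight S'"
    and size: "\<And>x y z. x \<in> S \<Longrightarrow> y \<in> S \<Longrightarrow> z \<in> S \<Longrightarrow> conjugate x y \<Longrightarrow> conjugate x z \<Longrightarrow> x = y \<or> x = z \<or> y = z"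
    and size': "\<And>x y z. x \<in> S' \<Longrightarrow> y \<in> S' \<Longrightarrow> z \<in> S' \<Longrightarrow> conjugate x y \<Longrightarrow> conjugate x z \<Longrightarrow> x = y \<or> x = z \<or> y = z"
    and odd: "\<And>x y. x \<in> S \<Longrightarrow> y \<in> S \<Longrightarrow> x \<noteq> y \<Longrightarrow> conjugate x y \<Longrightarrow> odd (ord (x \<otimes> y))"
  shows "\<exists>\<psi>. bij_betw \<psi> S S' \<and> (\<forall>x\<in>S. \<forall>y\<in>S. ord (x \<otimes> y) = ord (\<psi> x \<otimes> \<psi> y))"
proof -
  \<comment> \<open>The predicate chosen from depends only on the class of x, so conjugate
    generators receive the same hub.\<close>
  define \<eta> where "\<eta> x = (SOME d. conjugate x d \<and> hub S d)" for x
  define \<eta>' where "\<eta>' x = (SOME d. conjugate x d \<and> hub S' d)" for x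
  have \<eta>: "conjugate x (\<eta> x)" "hub S (\<eta> x)" if x: "x \<in> S" for x
    using someI_ex[OF hub_exists[OF tight(1) x]] by (simp_all add: \<eta>_def)
  have \<eta>': "conjugate x (\<eta>' x)" "hub S' (\<eta>' x)" if x: "x \<in> S" for x
  proof -
    obtain y where y: "y \<in> S'" "conjugate x y" using partner_conjugate[OF x] .
    obtain d where d: "conjugate y d" "hub S' d" using B.hub_exists[OF tight(2) y(1)] by blast
    have "conjugate x d" by (rule conjugate_trans[OF S_closed[OF x] y(2) d(1)])
    then have "\<exists>d. conjugate x d \<and> hub S' d" using d(2) by blast
    from someI_ex[OF this] show "conjugate x (\<eta>' x)" "hub S' (\<eta>' x)" by (simp_all add: \<eta>'_def)
  qed
  have \<eta>S: "\<eta> x \<in> S" and \<eta>'S: "\<eta>' x \<in> S'" if "x \<in> S" for x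
    using \<eta>(2)[OF that] \<eta>'(2)[OF that] by (simp_all add: hub_def)
  have conj_iff: "conjugate x d \<longleftrightarrow> conjugate y d" if "x \<in> S" "y \<in> S" "conjugate x y" for x y d
    using conjugate_trans[OF S_closed[OF that(2)] conjugate_sym[OF S_closed[OF that(1)] that(3)]]
      conjugate_trans[OF S_closed[OF that(1)] that(3)] by blast
  have \<eta>_eq: "\<eta> x = \<eta> y" "\<eta>' x = \<eta>' y" if "x \<in> S" "y \<in> S" "conjugate x y" for x y
    unfolding \<eta>_def \<eta>'_def using conj_iff[OF that] by simp_all
  define \<psi> where "\<psi> x = (if x = \<eta> x then \<eta>' x else (SOME z. z \<in> S' \<and> conjugate x z \<and> z \<noteq> \<eta>' x))" for x
  \<comment> \<open>If the hub were the only generator of the class in S', the class would also have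
    a single generator in S, making x its own hub.\<close>
  have other: "\<psi> x \<in> S' \<and> conjugate x (\<psi> x) \<and> \<psi> x \<noteq> \<eta>' x" if x: "x \<in> S" and ne: "x \<noteq> \<eta> x" for x
  proof -
    have "\<exists>z. z \<in> S' \<and> conjugate x z \<and> z \<noteq> \<eta>' x"
    proof (rule ccontr)
      assume no: "\<nexists>z. z \<in> S' \<and> conjugate x z \<and> z \<noteq> \<eta>' x"
      have xc: "x \<in> carrier W" using x by simp
      have c: "conjugate (\<eta>' x) x" by (rule conjugate_sym[OF xc \<eta>'(1)[OF x]])
      have ec: "\<eta>' x \<in> carrier W" using \<eta>'S[OF x] by simp
      have "x = \<eta> x"
      proof (rule two_systems.single_class[OF swap \<eta>'S[OF x] _ x \<eta>S[OF x] c])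
        show "conjugate (\<eta>' x) (\<eta> x)" by (rule conjugate_trans[OF ec c \<eta>(1)[OF x]])
        fix z assume z: "z \<in> S'" "conjugate (\<eta>' x) z"
        have "conjugate x z" by (rule conjugate_trans[OF xc \<eta>'(1)[OF x] z(2)])
        then show "z = \<eta>' x" using no z(1) by blast
      qed
      then show False using ne by simp
    qed
    from someI_ex[OF this] show ?thesis using ne by (simp add: \<psi>_def)
  qed
  have \<psi>: "\<psi> x \<in> S'" "conjugate x (\<psi> x)" and \<psi>_hub: "\<psi> x = \<eta>' x \<longleftrightarrow> x = \<eta> x" if x: "x \<in> S" for x
  proof -
    show "\<psi> x \<in> S'" "conjugate x (\<psi> x)" "\<psi> x = \<eta>' x \<longleftrightarrow> x = \<eta> x"
      using other[OF x] \<eta>'S[OF x] \<eta>'(1)[OF x] by (cases "x = \<eta> x"; simp add: \<psi>_def)+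
  qed
  have conj_back: "conjugate x y" if "x \<in> S" "y \<in> S" "conjugate (\<psi> x) (\<psi> y)" for x y
  proof -
    have "conjugate x (\<psi> y)"
      by (rule conjugate_trans[OF S_closed[OF that(1)] \<psi>(2)[OF that(1)] that(3)])
    then show ?thesis
      by (rule conjugate_trans[OF S_closed[OF that(1)] _ conjugate_sym[OF S_closed[OF that(2)] \<psi>(2)[OF that(2)]]])
  qed
  have inj: "x = y" if x: "x \<in> S" and y: "y \<in> S" and e: "\<psi> x = \<psi> y" for x y
  proof -
    have "conjugate (\<psi> x) (\<psi> y)" using e \<psi>(1)[OF y] by simp
    then have c: "conjugate x y" by (rule conj_back[OF x y])
    note eq = \<eta>_eq[OF x y c]
    show ?thesis
    proof (cases "x = \<eta> x")
      case True
      then show ?thesis using \<psi>_hub[OF x] \<psi>_hub[OF y] e eq by simp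
    next
      case False
      then have "y \<noteq> \<eta> x" using \<psi>_hub[OF x] \<psi>_hub[OF y] e eq by simp
      then show ?thesis using size[OF x y \<eta>S[OF x] c \<eta>(1)[OF x]] False by blast
    qed
  qed
  have surj: "\<exists>x\<in>S. \<psi> x = w" if w: "w \<in> S'" for w
  proof -
    have wc: "w \<in> carrier W" using w by simp
    obtain x where x: "x \<in> S" "conjugate w x" using two_systems.partner_conjugate[OF swap w] .
    have xw: "conjugate x w" by (rule conjugate_sym[OF wc x(2)])
    show ?thesis
    proof (cases "w = \<eta>' x")
      case True
      have "\<eta> (\<eta> x) = \<eta> x" "\<eta>' (\<eta> x) = \<eta>' x"
        using \<eta>_eq[OF x(1) \<eta>S[OF x(1)] \<eta>(1)[OF x(1)]] by simp_all
      then have "\<psi> (\<eta> x) = w" using True by (simp add: \<psi>_def)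
      then show ?thesis using \<eta>S[OF x(1)] by blast
    next
      case False
      obtain y where y: "y \<in> S" "conjugate x y" "y \<noteq> \<eta> x"
      proof (rule ccontr)
        assume "\<not> thesis"
        then have only: "z = \<eta> x" if "z \<in> S" "conjugate x z" for z using that \<open>\<And>y. y \<in> S \<Longrightarrow> conjugate x y \<Longrightarrow> y \<noteq> \<eta> x \<Longrightarrow> thesis\<close> by blast
        have "x = \<eta> x" using only[OF x(1)] x(1) by simp
        have "w = \<eta>' x"
        proof (rule single_class[OF x(1) _ w \<eta>'S[OF x(1)] xw \<eta>'(1)[OF x(1)]])
          show "z = x" if "z \<in> S" "conjugate x z" for z using only[OF that] \<open>x = \<eta> x\<close> by simp
        qed
        then show False using False by simp
      qed
      note eq = \<eta>_eq[OF x(1) y(1,2)]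
      have ne: "\<psi> y \<noteq> \<eta>' x" using \<psi>_hub[OF y(1)] y(3) eq by simp
      have c1: "conjugate x (\<psi> y)" by (rule conjugate_trans[OF S_closed[OF x(1)] y(2) \<psi>(2)[OF y(1)]])
      have "conjugate w (\<psi> y)" by (rule conjugate_trans[OF wc x(2) c1])
      moreover have "conjugate w (\<eta>' x)" by (rule conjugate_trans[OF wc x(2) \<eta>'(1)[OF x(1)]])
      ultimately have "\<psi> y = w"
        using size'[OF w \<psi>(1)[OF y(1)] \<eta>'S[OF x(1)]] ne False by blast
      then show ?thesis using y(1) by blast
    qed
  qed
  have bij: "bij_betw \<psi> S S'"
  proof (rule bij_betw_imageI)
    show "inj_on \<psi> S" using inj by (rule inj_onI)
    have "S' \<subseteq> \<psi> ` S" using surj by (metis image_eqI subsetI)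
    then show "\<psi> ` S = S'" using \<psi>(1) by auto
  qed
  have dvd_fwd: "x = \<eta> x \<and> ord (\<psi> x \<otimes> \<psi> y) \<noteq> 0 \<and> ord (x \<otimes> y) dvd ord (\<psi> x \<otimes> \<psi> y)"
    if x: "x \<in> S" and y: "y \<in> S" and nc: "\<not> conjugate x y" and fin: "ord (x \<otimes> y) \<noteq> 0" for x y
  proof -
    have xc: "x \<in> carrier W" and yc: "y \<in> carrier W" using x y by auto
    have nc': "\<not> conjugate y x" using conjugate_sym[OF yc] nc by blast
    have fin': "ord (y \<otimes> x) \<noteq> 0" using fin ord_sym[OF x y] by simp
    have hx: "x = \<eta> x" by (rule hubD[OF \<eta>(2)[OF x] x conjugate_sym[OF xc \<eta>(1)[OF x]] y nc fin])
    have hy: "y = \<eta> y" by (rule hubD[OF \<eta>(2)[OF y] y conjugate_sym[OF yc \<eta>(1)[OF y]] x nc' fin'])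
    obtain a b where ab: "a \<in> S'" "b \<in> S'" "conjugate x a" "conjugate y b" "ord (a \<otimes> b) \<noteq> 0"
      "ord (x \<otimes> y) dvd ord (a \<otimes> b)"
      using finite_edge_transfer[OF tight(2) x y nc fin] .
    have nab: "\<not> conjugate a b"
    proof
      assume "conjugate a b"
      then have "conjugate x b" by (rule conjugate_trans[OF xc ab(3)])
      then show False using conjugate_trans[OF xc _ conjugate_sym[OF yc ab(4)]] nc by blast
    qed
    have ac: "a \<in> carrier W" and bc: "b \<in> carrier W" using ab(1,2) by auto
    have nba: "\<not> conjugate b a" using conjugate_sym[OF bc] nab by blast
    have fba: "ord (b \<otimes> a) \<noteq> 0" using ab(5) B.ord_sym[OF ab(1,2)] by simp
    have ex: "\<eta>' x \<in> carrier W" and ey: "\<eta>' y \<in> carrier W" using \<eta>'S x y by auto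
    have ca: "conjugate (\<eta>' x) a" by (rule conjugate_trans[OF ex conjugate_sym[OF xc \<eta>'(1)[OF x]] ab(3)])
    have cb: "conjugate (\<eta>' y) b" by (rule conjugate_trans[OF ey conjugate_sym[OF yc \<eta>'(1)[OF y]] ab(4)])
    have "a = \<eta>' x" by (rule hubD[OF \<eta>'(2)[OF x] ab(1) ca ab(2) nab ab(5)])
    moreover have "b = \<eta>' y" by (rule hubD[OF \<eta>'(2)[OF y] ab(2) cb ab(1) nba fba])
    ultimately have "a = \<psi> x" "b = \<psi> y" using \<psi>_hub[OF x] \<psi>_hub[OF y] hx hy by simp_all
    then show ?thesis using hx ab(5,6) by simp
  qed
  have dvd_bwd: "ord (x \<otimes> y) \<noteq> 0 \<and> ord (\<psi> x \<otimes> \<psi> y) dvd ord (x \<otimes> y)"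
    if x: "x \<in> S" and y: "y \<in> S" and nc: "\<not> conjugate x y" and fin: "ord (\<psi> x \<otimes> \<psi> y) \<noteq> 0" for x y
  proof -
    have xc: "x \<in> carrier W" and yc: "y \<in> carrier W" using x y by auto
    have ncp: "\<not> conjugate (\<psi> x) (\<psi> y)" using conj_back[OF x y] nc by blast
    obtain a b where ab: "a \<in> S" "b \<in> S" "conjugate (\<psi> x) a" "conjugate (\<psi> y) b" "ord (a \<otimes> b) \<noteq> 0"
      "ord (\<psi> x \<otimes> \<psi> y) dvd ord (a \<otimes> b)"
      using two_systems.finite_edge_transfer[OF swap tight(1) \<psi>(1)[OF x] \<psi>(1)[OF y] ncp fin] .
    have xa: "conjugate x a" by (rule conjugate_trans[OF xc \<psi>(2)[OF x] ab(3)])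
    have yb: "conjugate y b" by (rule conjugate_trans[OF yc \<psi>(2)[OF y] ab(4)])
    have nab: "\<not> conjugate a b"
      using conj_iff[OF x ab(1) xa, of b] conj_iff[OF y ab(2) yb, of x] conjugate_sym[OF xc, of b]
        conjugate_sym[OF yc, of x] conjugate_sym[OF S_closed[OF ab(2)], of x] nc by blast
    have p: "\<psi> a = \<psi> x" "\<psi> b = \<psi> y"
    proof -
      have nba: "\<not> conjugate b a" using conjugate_sym[OF S_closed[OF ab(2)]] nab by blast
      have fba: "ord (b \<otimes> a) \<noteq> 0" using ab(5) ord_sym[OF ab(1,2)] by simp
      have fyx: "ord (\<psi> y \<otimes> \<psi> x) \<noteq> 0" using fin B.ord_sym[OF \<psi>(1)[OF x] \<psi>(1)[OF y]] by simp
      have nyx: "\<not> conjugate (\<psi> y) (\<psi> x)"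
        using conjugate_sym[of "\<psi> y" "\<psi> x"] \<psi>(1)[OF y] ncp by auto
      have hub': "\<psi> u = \<eta>' u" if u: "u \<in> S" "v \<in> S" "\<not> conjugate (\<psi> u) (\<psi> v)" "ord (\<psi> u \<otimes> \<psi> v) \<noteq> 0" for u v
      proof -
        have "\<eta>' u \<in> carrier W" using \<eta>'S[OF u(1)] by simp
        then have "conjugate (\<eta>' u) (\<psi> u)"
          by (rule conjugate_trans[OF _ conjugate_sym[OF S_closed[OF u(1)] \<eta>'(1)[OF u(1)]] \<psi>(2)[OF u(1)]])
        then show ?thesis by (rule hubD[OF \<eta>'(2)[OF u(1)] \<psi>(1)[OF u(1)] _ \<psi>(1)[OF u(2)] u(3,4)])
      qed
      have "a = \<eta> a" "b = \<eta> b" using dvd_fwd[OF ab(1,2) nab ab(5)] dvd_fwd[OF ab(2,1) nba fba] by auto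
      moreover have "x = \<eta> x" using hub'[OF x y ncp fin] \<psi>_hub[OF x] by simp
      moreover have "y = \<eta> y" using hub'[OF y x nyx fyx] \<psi>_hub[OF y] by simp
      ultimately have "a = x" "b = y" using \<eta>_eq(1)[OF x ab(1) xa] \<eta>_eq(1)[OF y ab(2) yb] by simp_all
      then show "\<psi> a = \<psi> x" "\<psi> b = \<psi> y" by simp_all
    qed
    have "a = x" "b = y" using inj[OF ab(1) x p(1)] inj[OF ab(2) y p(2)] by simp_all
    then show ?thesis using ab(5,6) by simp
  qed
  have "ord (x \<otimes> y) = ord (\<psi> x \<otimes> \<psi> y)" if x: "x \<in> S" and y: "y \<in> S" for x y
  proof (cases "conjugate x y")
    case True
    show ?thesis
    proof (cases "x = y")
      case True
      then show ?thesis using x \<psi>(1)[OF x] by simp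
    next
      case False
      have cy: "conjugate x (\<psi> y)" by (rule conjugate_trans[OF S_closed[OF x] True \<psi>(2)[OF y]])
      have ne: "\<psi> x \<noteq> \<psi> y" using inj[OF x y] False by blast
      have px: "\<psi> x \<in> carrier W" using \<psi>(1)[OF x] by simp
      have cx: "conjugate (\<psi> x) x" by (rule conjugate_sym[OF S_closed[OF x] \<psi>(2)[OF x]])
      have cxy: "conjugate (\<psi> x) (\<psi> y)" by (rule conjugate_trans[OF px cx cy])
      have cx'y: "conjugate (\<psi> x) y" by (rule conjugate_trans[OF px cx True])
      have 1: "ord (\<psi> x \<otimes> \<psi> y) dvd ord (x \<otimes> y)"
      proof (rule pair_class_ord_dvd[OF x y _ odd[OF x y False True] \<psi>(1)[OF x] \<psi>(2)[OF x] \<psi>(1)[OF y] cy])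
        show "z \<in> {x, y}" if "z \<in> S" "conjugate x z" for z
          using size[OF x y that(1) True that(2)] False by blast
      qed
      \<comment> \<open>A divisor of an odd number is odd; the reverse divisibility starts from an
        odd pair of S'.\<close>
      have od: "odd (ord (\<psi> x \<otimes> \<psi> y))" using 1 odd[OF x y False True] by (metis dvd_trans)
      have 2: "ord (x \<otimes> y) dvd ord (\<psi> x \<otimes> \<psi> y)"
      proof (rule two_systems.pair_class_ord_dvd[OF swap \<psi>(1)[OF x] \<psi>(1)[OF y] _ od x cx y cx'y])
        show "z \<in> {\<psi> x, \<psi> y}" if "z \<in> S'" "conjugate (\<psi> x) z" for z
          using size'[OF \<psi>(1)[OF x] \<psi>(1)[OF y] that(1) cxy that(2)] ne by blast
      qed
      show ?thesis using 1 2 by (rule dvd_antisym[rotated])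
    qed
  next
    case False
    show ?thesis
    proof (cases "ord (x \<otimes> y) = 0")
      case True
      then show ?thesis using dvd_bwd[OF x y False] by metis
    next
      case f: False
      then have "ord (\<psi> x \<otimes> \<psi> y) \<noteq> 0" "ord (x \<otimes> y) dvd ord (\<psi> x \<otimes> \<psi> y)"
        using dvd_fwd[OF x y False] by auto
      then show ?thesis using dvd_bwd[OF x y False] by (metis dvd_antisym)
    qed
  qed
  then show ?thesis using bij by blast
qed

section \<open>Reflection rigidity\<close>

lemma (in group) odd_enat_cox_m: "odd_enat (cox_m G x y) \<longleftrightarrow> odd (ord (x \<otimes> y))"
  by (auto simp: odd_enat_def cox_m_def elt_order_def)

context coxeter
begin

lemma spherical_pair:
  assumes "x \<in> S" "y \<in> S" "ord (x \<otimes> y) \<noteq> 0"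
  shows "spherical W S {x, y}"
proof -
  interpret P: involution_pair W x y by (rule S_pair[OF assms(1,2)])
  show ?thesis using P.finite_generate[OF assms(3)] assms(1,2) by (simp add: spherical_def)
qed

lemma maximal_spherical_above:
  assumes "spherical W S U"
  obtains M where "maximal_spherical W S M" "U \<subseteq> M"
proof -
  have "{V. spherical W S V} \<subseteq> Pow S" by (auto simp: spherical_def)
  then have "finite {V. spherical W S V}" using finite_S by (meson finite_Pow_iff finite_subset)
  from finite_has_maximal2[OF this, of U] assms
  obtain M where "spherical W S M" "U \<subseteq> M" "\<forall>V. spherical W S V \<longrightarrow> M \<subseteq> V \<longrightarrow> M = V" by auto
  then show thesis using that[of M] by (auto simp: maximal_spherical_def)
qed

section \<open>Consequences of the three hypotheses on odd edges\<close>

context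
  assumes odd_maximal: "\<And>s t. s \<in> S \<Longrightarrow> t \<in> S \<Longrightarrow> s \<noteq> t \<Longrightarrow> odd (ord (s \<otimes> t)) \<Longrightarrow>
      maximal_spherical W S {s, t}"
    and no_odd_path: "\<And>s t u. s \<in> S \<Longrightarrow> t \<in> S \<Longrightarrow> u \<in> S \<Longrightarrow> s \<noteq> t \<Longrightarrow> s \<noteq> u \<Longrightarrow> t \<noteq> u \<Longrightarrow>
      odd (ord (s \<otimes> t)) \<Longrightarrow> odd (ord (t \<otimes> u)) \<Longrightarrow> False"
    and few_maximal: "\<And>s t. s \<in> S \<Longrightarrow> t \<in> S \<Longrightarrow> s \<noteq> t \<Longrightarrow> odd (ord (s \<otimes> t)) \<Longrightarrow>
      card {T. maximal_spherical W S T \<and> T \<inter> {s, t} \<noteq> {}} \<le> 2"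
begin

text \<open>The set consists of x, as x x has order 1, and its odd neighbours. Without odd paths of
  two edges it is closed under odd edges, hence under conjugacy of generators.\<close>

lemma conjugate_odd:
  assumes x: "x \<in> S" and y: "y \<in> S" and c: "conjugate x y"
  shows "odd (ord (x \<otimes> y))"
proof -
  let ?A = "{z \<in> S. odd (ord (x \<otimes> z))}"
  have step: "t \<in> ?A" if st: "s \<in> S" "t \<in> S" "odd (ord (s \<otimes> t))" and s: "s \<in> ?A" for s t
  proof (cases "s = x \<or> t = x \<or> s = t")
    case True
    then show ?thesis using st s x by auto
  next
    case False
    then show ?thesis using no_odd_path[OF x st(1,2)] st(3) s by auto
  qed
  have "y \<in> ?A"
  proof (rule conjugate_same_sign[OF _ _ x y c])
    fix s t assume st: "s \<in> S" "t \<in> S" "odd (ord (s \<otimes> t))"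
    then have "odd (ord (t \<otimes> s))" using ord_sym by simp
    then show "s \<in> ?A \<longleftrightarrow> t \<in> ?A" using step st by blast
  qed (use x in auto)
  then show ?thesis by simp
qed

lemma conjugate_pair:
  assumes "x \<in> S" "y \<in> S" "z \<in> S" "conjugate x y" "conjugate x z" "x \<noteq> y"
  shows "z \<in> {x, y}"
proof (rule ccontr)
  assume "z \<notin> {x, y}"
  moreover have "odd (ord (y \<otimes> x))" using conjugate_odd[of x y] assms ord_sym by simp
  ultimately show False
    using no_odd_path[of y x z] conjugate_odd[of x z] assms by auto
qed

text \<open>The pair is itself one of the at most two maximal spherical subsets that meet it, which
  leaves room for one more.\<close>

lemma maximal_at_pair:
  assumes s: "s \<in> S" and t: "t \<in> S" and ne: "s \<noteq> t" and odd: "odd (ord (s \<otimes> t))"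
    and M: "maximal_spherical W S M" "M \<inter> {s, t} \<noteq> {}" "M \<noteq> {s, t}"
    and N: "maximal_spherical W S N" "N \<inter> {s, t} \<noteq> {}" "N \<noteq> {s, t}"
  shows "M = N"
proof (rule ccontr)
  assume MN: "M \<noteq> N"
  let ?X = "{T. maximal_spherical W S T \<and> T \<inter> {s, t} \<noteq> {}}"
  have "?X \<subseteq> Pow S" by (auto simp: maximal_spherical_def spherical_def)
  then have "finite ?X" using finite_S by (meson finite_Pow_iff finite_subset)
  moreover have "{{s, t}, M, N} \<subseteq> ?X" using M N odd_maximal[OF s t ne odd] by auto
  ultimately have "card {{s, t}, M, N} \<le> card ?X" by (rule card_mono)
  moreover have "card {{s, t}, M, N} = 3" using M(3) N(3) MN by auto
  ultimately show False using few_maximal[OF s t ne odd] by simp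
qed

text \<open>Every finite neighbour of s other than t lies, together with s, in the one further
  maximal spherical subset meeting the pair, so T lies in it and W_T is finite. Two conjugate
  members of T would form a maximal spherical pair and exhaust T; one of them would be s and the
  other t, which is not in T.\<close>

lemma leaf_odd_pair:
  assumes s: "s \<in> S" and t: "t \<in> S" and ne: "s \<noteq> t" and odd: "odd (ord (s \<otimes> t))"
    and leaf: "\<And>v. v \<in> S \<Longrightarrow> ord (t \<otimes> v) \<noteq> 0 \<Longrightarrow> v \<in> {s, t}"
  shows "\<exists>T. odd_pair W S s t T"
proof -
  define T where "T = {u \<in> S. u \<noteq> t \<and> ord (s \<otimes> u) \<noteq> 0}"
  have sT: "s \<in> T" using s ne by (simp add: T_def)
  have above: "\<exists>M. maximal_spherical W S M \<and> {s, u} \<subseteq> M \<and> M \<inter> {s, t} \<noteq> {} \<and> M \<noteq> {s, t}"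
    if u: "u \<in> T" "u \<noteq> s" for u
  proof -
    have "spherical W S {s, u}" using u by (intro spherical_pair s) (auto simp: T_def)
    then obtain M where M: "maximal_spherical W S M" "{s, u} \<subseteq> M" by (rule maximal_spherical_above)
    have "M \<noteq> {s, t}" using M(2) u by (auto simp: T_def)
    then show ?thesis using M by blast
  qed
  have fin: "finite (generate W T)"
  proof (cases "T = {s}")
    case True
    have "generate W T \<subseteq> {\<one>, s}"
      using generate_involution[of s _ T] s True by auto
    then show ?thesis by (rule finite_subset) simp
  next
    case False
    then obtain u where u: "u \<in> T" "u \<noteq> s" using sT by blast
    obtain M where M: "maximal_spherical W S M" "{s, u} \<subseteq> M" "M \<inter> {s, t} \<noteq> {}" "M \<noteq> {s, t}"
      using above[OF u] by blast
    have "T \<subseteq> M"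
    proof
      fix v assume v: "v \<in> T"
      show "v \<in> M"
      proof (cases "v = s")
        case False
        obtain N where N: "maximal_spherical W S N" "{s, v} \<subseteq> N" "N \<inter> {s, t} \<noteq> {}" "N \<noteq> {s, t}"
          using above[OF v False] by blast
        have "M = N" by (rule maximal_at_pair[OF s t ne odd M(1,3,4) N(1,3,4)])
        then show ?thesis using N(2) by blast
      qed (use M(2) in blast)
    qed
    then have "generate W T \<subseteq> generate W M" by (rule mono_generate)
    moreover have "finite (generate W M)" using M(1) by (simp add: maximal_spherical_def spherical_def)
    ultimately show ?thesis by (rule finite_subset)
  qed
  have st: "conjugate s t" by (rule odd_imp_conjugate[OF s t odd])
  have "odd_pair W S s t T"
  proof unfold_locales
    show "x \<in> {s, t}" if "x \<in> S" "conjugate s x" for x by (rule conjugate_pair[OF s t that(1) st that(2) ne])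
    show "x = y" if xy: "x \<in> T" "y \<in> T" "conjugate x y" for x y
    proof (rule ccontr)
      assume neq: "x \<noteq> y"
      have S: "x \<in> S" "y \<in> S" using xy by (auto simp: T_def)
      have "maximal_spherical W S {x, y}"
        by (rule odd_maximal[OF S neq conjugate_odd[OF S xy(3)]])
      moreover have "spherical W S T" using fin by (auto simp: spherical_def T_def)
      ultimately have "T = {x, y}" using xy by (auto simp: maximal_spherical_def)
      then have "conjugate s x \<and> conjugate s y"
        using sT xy(3) conjugate_sym[OF S_closed[OF S(1)] xy(3)] S by auto
      then have "x \<in> {s, t}" "y \<in> {s, t}" using conjugate_pair[OF s t _ st _ ne] S by auto
      then show False using neq xy by (auto simp: T_def)
    qed
  qed (use s t ne odd leaf sT fin in \<open>auto simp: T_def\<close>)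
  then show ?thesis by blast
qed

text \<open>If neither end is a leaf, both have further finite neighbours, and the maximal spherical
  subsets above these two edges coincide. The common subset contains s and t, so by maximality it
  equals {s, t}, although it contains a further neighbour.\<close>

lemma conjugate_odd_pair:
  assumes s: "s \<in> S" and t: "t \<in> S" and ne: "s \<noteq> t" and c: "conjugate s t"
  shows "\<exists>T. odd_pair W S s t T \<or> odd_pair W S t s T"
proof (rule ccontr)
  assume no: "\<nexists>T. odd_pair W S s t T \<or> odd_pair W S t s T"
  have odd: "odd (ord (s \<otimes> t))" by (rule conjugate_odd[OF s t c])
  then have odd': "odd (ord (t \<otimes> s))" using ord_sym[OF s t] by simp
  obtain u where u: "u \<in> S" "ord (s \<otimes> u) \<noteq> 0" "u \<notin> {t, s}"
    using leaf_odd_pair[OF t s _ odd'] ne no by blast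
  obtain v where v: "v \<in> S" "ord (t \<otimes> v) \<noteq> 0" "v \<notin> {s, t}"
    using leaf_odd_pair[OF s t ne odd] no by blast
  obtain M where M: "maximal_spherical W S M" "{s, u} \<subseteq> M"
    using maximal_spherical_above[OF spherical_pair[OF s u(1,2)]] .
  obtain N where N: "maximal_spherical W S N" "{t, v} \<subseteq> N"
    using maximal_spherical_above[OF spherical_pair[OF t v(1,2)]] .
  have "M \<noteq> {s, t}" "N \<noteq> {s, t}" using M(2) N(2) u(3) v(3) by auto
  then have "M = N" using maximal_at_pair[OF s t ne odd M(1) _ _ N(1)] M(2) N(2) by blast
  then have "{s, t} \<subseteq> M" using M(2) N(2) by blast
  moreover have "spherical W S M" using M(1) by (simp add: maximal_spherical_def)
  ultimately have "M = {s, t}"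
    using odd_maximal[OF s t ne odd] by (simp add: maximal_spherical_def)
  then show False using \<open>M \<noteq> {s, t}\<close> by simp
qed

lemma tight_S: "tight S"
  unfolding tight_def
proof (intro ballI impI, rule ccontr)
  fix x y u v assume x: "x \<in> S" and y: "y \<in> S" and ne: "x \<noteq> y" and c: "conjugate x y"
    and u: "u \<in> S" "\<not> conjugate x u" and v: "v \<in> S" "\<not> conjugate x v"
    and "\<not> (ord (x \<otimes> u) = 0 \<or> ord (y \<otimes> v) = 0)"
  then have fin: "ord (x \<otimes> u) \<noteq> 0" "ord (y \<otimes> v) \<noteq> 0" by auto
  have xx: "conjugate x x" using x by simp
  obtain T where "odd_pair W S x y T \<or> odd_pair W S y x T"
    using conjugate_odd_pair[OF x y ne c] by blast
  then show False
  proof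
    assume "odd_pair W S x y T"
    then interpret O: odd_pair W S x y T .
    have "v \<in> {x, y}" by (rule O.neighbours_t[OF v(1) fin(2)])
    then show False using v(2) c xx by auto
  next
    assume "odd_pair W S y x T"
    then interpret O: odd_pair W S y x T .
    have "u \<in> {y, x}" by (rule O.neighbours_t[OF u(1) fin(1)])
    then show False using u(2) c xx by auto
  qed
qed

theorem matching_with_other_system:
  assumes "coxeter_system W S'" "reflections W S = reflections W S'"
  shows "\<exists>\<psi>. bij_betw \<psi> S S' \<and> (\<forall>x\<in>S. \<forall>y\<in>S. ord (x \<otimes> y) = ord (\<psi> x \<otimes> \<psi> y))"
proof -
  interpret two_systems W S S' using assms by unfold_locales
  have pairs: "\<exists>p q T. conjugate x p \<and> odd_pair W S p q T"
    if x: "x \<in> S" and y: "y \<in> S" and ne: "x \<noteq> y" and c: "conjugate x y" for x y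
  proof -
    have "conjugate x x" using x by simp
    then show ?thesis using conjugate_odd_pair[OF x y ne c] c by blast
  qed
  \<comment> \<open>Several generators of S' in a class rule out a single one in S, so S has exactly
    two, and then the plane bounds the class in S'.\<close>
  have size': "x = y \<or> x = z \<or> y = z"
    if S': "x \<in> S'" "y \<in> S'" "z \<in> S'" and c: "conjugate x y" "conjugate x z" for x y z
  proof (rule ccontr)
    assume no: "\<not> (x = y \<or> x = z \<or> y = z)"
    have xc: "x \<in> carrier W" using S'(1) by simp
    obtain a where a: "a \<in> S" "conjugate x a" using two_systems.partner_conjugate[OF swap S'(1)] .
    have ax: "conjugate a x" by (rule conjugate_sym[OF xc a(2)])
    have ay: "conjugate a y" by (rule conjugate_trans[OF S_closed[OF a(1)] ax c(1)])
    have az: "conjugate a z" by (rule conjugate_trans[OF S_closed[OF a(1)] ax c(2)])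
    obtain b where b: "b \<in> S" "conjugate a b" "b \<noteq> a"
      using single_class[OF a(1) _ S'(1,2) ax ay] no by blast
    have pair: "w \<in> {a, b}" if "w \<in> S" "conjugate a w" for w
      using conjugate_pair[OF a(1) b(1) that(1) b(2) that(2)] b(3) by simp
    show False using pair_class_size[OF a(1) b(1) pair b(2) S' ax ay az] no by blast
  qed
  show ?thesis
  proof (rule matching_exists[OF tight_S tight_other_system[OF pairs] _ size'])
    show "x = y \<or> x = z \<or> y = z" if "x \<in> S" "y \<in> S" "z \<in> S" "conjugate x y" "conjugate x z" for x y z
      using conjugate_pair[OF that] by auto
    show "odd (ord (x \<otimes> y))" if "x \<in> S" "y \<in> S" "x \<noteq> y" "conjugate x y" for x y
      using conjugate_odd[OF that(1,2,4)] .
  qed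
qed

end

end

theorem theorem1p2:
  fixes W :: "('a, 'b) monoid_scheme" and S :: "'a set"
  assumes cox: "coxeter_system W S"
    and odd_maximal: "\<And>s t. s \<in> S \<Longrightarrow> t \<in> S \<Longrightarrow> s \<noteq> t \<Longrightarrow> odd_enat (cox_m W s t) \<Longrightarrow>
          maximal_spherical W S {s, t}"
    and no_odd_path: "\<not> (\<exists>s t u. {s, t, u} \<subseteq> S \<and> card {s, t, u} = 3 \<and>
          odd_enat (cox_m W s t) \<and> odd_enat (cox_m W t u))"
    and few_maximal: "\<And>s t. s \<in> S \<Longrightarrow> t \<in> S \<Longrightarrow> s \<noteq> t \<Longrightarrow> odd_enat (cox_m W s t) \<Longrightarrow>
          card {T. maximal_spherical W S T \<and> T \<inter> {s, t} \<noteq> {}} \<le> 2"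
  shows "reflection_rigid W S"
proof -
  have "group W" using cox by (auto simp: coxeter_system_def has_presentation_def)
  then interpret coxeter W S using cox by (simp add: coxeter_def coxeter_axioms_def)
  have path: False
    if "s \<in> S" "t \<in> S" "u \<in> S" "s \<noteq> t" "s \<noteq> u" "t \<noteq> u"
      "odd (ord (s \<otimes>\<^bsub>W\<^esub> t))" "odd (ord (t \<otimes>\<^bsub>W\<^esub> u))" for s t u
  proof -
    have "{s, t, u} \<subseteq> S" "card {s, t, u} = 3" using that by auto
    then show False using no_odd_path that(7,8) by (metis odd_enat_cox_m)
  qed
  have "coxeter_isomorphic W S W S'"
    if S': "coxeter_system W S'" "reflections W S = reflections W S'" for S'
  proof -
    have "\<exists>\<psi>. bij_betw \<psi> S S' \<and> (\<forall>x\<in>S. \<forall>y\<in>S. ord (x \<otimes>\<^bsub>W\<^esub> y) = ord (\<psi> x \<otimes>\<^bsub>W\<^esub> \<psi> y))"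
      by (rule matching_with_other_system[OF odd_maximal[unfolded odd_enat_cox_m] path
            few_maximal[unfolded odd_enat_cox_m] S'])
    then obtain \<psi> where "bij_betw \<psi> S S'"
      "\<forall>x\<in>S. \<forall>y\<in>S. ord (x \<otimes>\<^bsub>W\<^esub> y) = ord (\<psi> x \<otimes>\<^bsub>W\<^esub> \<psi> y)" by blast
    then show ?thesis
      unfolding coxeter_isomorphic_def cox_m_def elt_order_def by (intro exI[of _ \<psi>]) simp
  qed
  then show ?thesis by (simp add: reflection_rigid_def)
qed

end
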